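(* Let $n\ge 3$. Consider the diagram of groups with rows $$1\to A\to G\to W\to 1,$$ $$1\to M_0\xrightarrow{\,t\,}\operatorname{Aut}(G)\to\operatorname{Aut}_S(A)\to 1,$$ $$1\to H^1(W,A)\to \operatorname{Out}(G)\to\operatorname{Aut}_W(A)\rtimes\operatorname{Out}(W)\to 1,$$ and columns $$1\to A\xrightarrow{\,\iota\,}M_0\to H^1(W,A)\to 1,\qquad 1\to G\to\operatorname{Aut}(G)\to\operatorname{Out}(G)\to 1,$$ $$1\to W\to\operatorname{Aut}_S(A)\to\operatorname{Aut}_W(A)\rtimes\operatorname{Out}(W)\to 1 .$$ This $3\times 3$ diagram is commutative, and every row and every column is exact. In particular, up to isomorphism, the bottom row is a short exact sequence $$1\to\mathbb Z^{n(n-2)}\times(\mathbb Z/2)^n\to\operatorname{Out}(G)\to(\mathbb Z/2)^n\rtimes\operatorname{Out}(W)\to 1 .$$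
   Context: For a positive integer $n$ let $G=\langle x_1,\dots,x_n\mid x_i^{-1}x_j^2x_i=x_j^{-2}\ \text{for all } i\ne j\rangle$. Let $A=\langle x_1^2,\dots,x_n^2\rangle\le G$; it is known that $A$ is normal and free abelian with basis $x_1^2,\dots,x_n^2$. Let $W=G/A$, which is the free product of the $n$ groups $\langle\bar x_i\rangle\cong C_2$ ($\bar x_i=x_iA$). $W$ acts on $A$ by $\bar g\cdot a=gag^{-1}$. For $n\ge3$ the subgroup $A$ is characteristic in $G$. $M_0$ is the additive group of integer $n\times n$ matrices with zero diagonal. For $\mathfrak a=[a_{ij}]\in M_0$, $t_{\mathfrak a}$ is the unique automorphism of $G$ with $t_{\mathfrak a}(x_i)=x_i(x_1^2)^{a_{i1}}\cdots(x_n^2)^{a_{in}}$ for all $i$, and $t(\mathfrak a)=t_{\mathfrak a}$. The map $\iota:A\to M_0$ sends $(x_1^2)^{a_1}\cdots(x_n^2)^{a_n}$ to the matrix $[a_{ij}]$ with $a_{ii}=0$ and $a_{ij}=-2a_j$ for $i\neq j$; thus $t_{\iota(a)}$ is conjugation $g\mapsto aga^{-1}$. $\operatorname{Aut}_W(A)$ is the group of $W$-module automorphisms of $A$. $\operatorname{Aut}_S(A)$ is the group (with component-wise multiplication) of semi-linear automorphisms of $A$: pairs $(f,F)\in\operatorname{Aut}(A)\times\operatorname{Aut}(W)$ such that $f(w\cdot a)=F(w)\cdot f(a)$ for all $w\in W,a\in A$. Maps: $\operatorname{Aut}(G)\to\operatorname{Aut}_S(A)$ sends $\varphi$ to $(\varphi|_A,\bar\varphi)$,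 where $\bar\varphi$ is the automorphism induced on $W$. $G\to\operatorname{Aut}(G)$ sends $g$ to conjugation $h\mapsto ghg^{-1}$. $W\to\operatorname{Aut}_S(A)$ sends $w$ to $(a\mapsto w\cdot a,\ v\mapsto wvw^{-1})$. $M_0\to H^1(W,A)$ sends $\mathfrak a$ to the class of the 1-cocycle $\bar g\mapsto t_{\mathfrak a}(g)g^{-1}$. $H^1(W,A)\to\operatorname{Out}(G)$ sends the class of a 1-cocycle $c$ to the class of the automorphism $g\mapsto c(\bar g)g$. The extension $1\to\operatorname{Aut}_W(A)\to\operatorname{Aut}_S(A)/W\to\operatorname{Out}(W)\to1$ (first map induced by $f\mapsto(f,\mathrm{id})$, second by $(f,F)\mapsto F$; the quotient is by the image of $W$) splits, and $\operatorname{Aut}_W(A)\rtimes\operatorname{Out}(W)$ denotes $\operatorname{Aut}_S(A)/W$ identified with a semidirect product via such a splitting; $\operatorname{Aut}_S(A)\to\operatorname{Aut}_W(A)\rtimes\operatorname{Out}(W)$ is the corresponding quotient map, and $\operatorname{Out}(G)\to\operatorname{Aut}_W(A)\rtimes\operatorname{Out}(W)$ is induced by $\operatorname{Aut}(G)\to\operatorname{Aut}_S(A)$. The remaining maps are the inclusion and the canonical projections. *)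

theory Defs
  imports "HOL-Algebra.Product_Groups" "HOL-Algebra.Bij" "Jordan_Normal_Form.Matrix"
begin

section \<open>Groups given by generators and relations\<close>

text \<open>The letter \<open>(x, True)\<close> stands for \<open>x\<close> and \<open>(x, False)\<close> for its inverse.\<close>

type_synonym 'a word = "('a \<times> bool) list"

definition words :: "'a set \<Rightarrow> 'a word set" where
  "words S = lists (S \<times> UNIV)"

inductive_set pres_cong :: "'a set \<Rightarrow> ('a word \<times> 'a word) set \<Rightarrow> ('a word \<times> 'a word) set"
  for S :: "'a set" and R :: "('a word \<times> 'a word) set" where
  refl: "w \<in> words S \<Longrightarrow> (w, w) \<in> pres_cong S R"
| sym: "(u, v) \<in> pres_cong S R \<Longrightarrow> (v, u) \<in> pres_cong S R"
| trans: "(u, v) \<in> pres_cong S R \<Longrightarrow> (v, w) \<in> pres_cong S R \<Longrightarrow> (u, w) \<in> pres_cong S R"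
| cancel: "u \<in> words S \<Longrightarrow> v \<in> words S \<Longrightarrow> x \<in> S \<Longrightarrow>
    (u @ [(x, b), (x, \<not> b)] @ v, u @ v) \<in> pres_cong S R"
| relation: "u \<in> words S \<Longrightarrow> v \<in> words S \<Longrightarrow> (l, r) \<in> R \<Longrightarrow> l \<in> words S \<Longrightarrow> r \<in> words S \<Longrightarrow>
    (u @ l @ v, u @ r @ v) \<in> pres_cong S R"

definition presented_group :: "'a set \<Rightarrow> ('a word \<times> 'a word) set \<Rightarrow> 'a word set monoid" where
  "presented_group S R =
    \<lparr>carrier = words S // pres_cong S R,
     monoid.mult = (\<lambda>P Q. \<Union>u\<in>P. \<Union>v\<in>Q. pres_cong S R `` {u @ v}),
     one = pres_cong S R `` {[]}\<rparr>"

definition pres_gen :: "'a set \<Rightarrow> ('a word \<times> 'a word) set \<Rightarrow> 'a \<Rightarrow> 'a word set" where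
  "pres_gen S R x = pres_cong S R `` {[(x, True)]}"

lemma words_simps [simp]:
  "[] \<in> words S" "u @ v \<in> words S \<longleftrightarrow> u \<in> words S \<and> v \<in> words S"
  "p # u \<in> words S \<longleftrightarrow> fst p \<in> S \<and> u \<in> words S"
  by (cases p; auto simp: words_def)+

lemma pres_cong_words: "(u, v) \<in> pres_cong S R \<Longrightarrow> u \<in> words S \<and> v \<in> words S"
  by (induction rule: pres_cong.induct) auto

lemma equiv_pres_cong: "equiv (words S) (pres_cong S R)"
proof (rule equivI)
  show "pres_cong S R \<subseteq> words S \<times> words S"
    using pres_cong_words by fastforce
  show "refl_on (words S) (pres_cong S R)"
    by (simp add: pres_cong.refl refl_on_def)
  show "Relation.sym (pres_cong S R)"
    by (meson pres_cong.sym symI)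
  show "Relation.trans (pres_cong S R)"
    by (meson pres_cong.trans transI)
qed

lemma pres_cong_context:
  assumes "(u, v) \<in> pres_cong S R" "p \<in> words S" "q \<in> words S"
  shows "(p @ u @ q, p @ v @ q) \<in> pres_cong S R"
  using assms(1)
proof (induction rule: pres_cong.induct)
  case (refl w)
  then show ?case using assms by (auto intro: pres_cong.refl)
next
  case (cancel u v x b)
  then show ?case using pres_cong.cancel[of "p @ u" S "v @ q" x b R] assms by simp
next
  case (relation u v l r)
  then show ?case using pres_cong.relation[of "p @ u" S "v @ q" l r R] assms by simp
qed (blast intro: pres_cong.sym pres_cong.trans)+

lemma pres_cong_append:
  assumes "(u, u') \<in> pres_cong S R" "(v, v') \<in> pres_cong S R"
  shows "(u @ v, u' @ v') \<in> pres_cong S R"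
proof -
  have "u' \<in> words S" "v \<in> words S"
    using assms pres_cong_words by blast+
  then show ?thesis
    using pres_cong_context[OF assms(1), of "[]" v] pres_cong_context[OF assms(2), of u' "[]"]
      pres_cong.trans by fastforce
qed

lemma presented_mult:
  assumes "u \<in> words S" "v \<in> words S"
  shows "pres_cong S R `` {u} \<otimes>\<^bsub>presented_group S R\<^esub> pres_cong S R `` {v} = pres_cong S R `` {u @ v}"
proof -
  have "congruent2 (pres_cong S R) (pres_cong S R) (\<lambda>u v. pres_cong S R `` {u @ v})"
    by (auto simp: congruent2_def intro!: equiv_class_eq[OF equiv_pres_cong] pres_cong_append)
  then show ?thesis
    unfolding presented_group_def
    by (simp add: UN_equiv_class2[OF equiv_pres_cong equiv_pres_cong _ assms])
qed

lemma group_presented_group: "group (presented_group S R)"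
proof -
  let ?c = "\<lambda>u. pres_cong S R `` {u}" and ?G = "presented_group S R"
  have car: "P \<in> carrier ?G \<longleftrightarrow> (\<exists>u\<in>words S. P = ?c u)" for P
    by (auto simp: presented_group_def quotient_def)
  have one: "\<one>\<^bsub>?G\<^esub> = ?c []" by (simp add: presented_group_def)
  have inv: "\<exists>v\<in>words S. (v @ u, []) \<in> pres_cong S R" if "u \<in> words S" for u
    using that
  proof (induction u)
    case Nil
    then show ?case using pres_cong.refl[of "[]"] by fastforce
  next
    case (Cons p u)
    obtain x b where p: "p = (x, b)" by fastforce
    from Cons obtain v where v: "v \<in> words S" "(v @ u, []) \<in> pres_cong S R" by auto
    have "((v @ [(x, \<not> b)]) @ p # u, v @ u) \<in> pres_cong S R"
      using pres_cong.cancel[of v S u x "\<not> b" R] v Cons.prems p by simp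
    then show ?case using v p Cons.prems
      by (intro bexI[of _ "v @ [(x, \<not> b)]"]) (auto intro: pres_cong.trans)
  qed
  show ?thesis
  proof (rule groupI)
    fix P assume "P \<in> carrier ?G"
    then obtain u where u: "u \<in> words S" "P = ?c u" using car by auto
    show "\<one>\<^bsub>?G\<^esub> \<otimes>\<^bsub>?G\<^esub> P = P" using u by (simp add: one presented_mult)
    obtain v where v: "v \<in> words S" "(v @ u, []) \<in> pres_cong S R" using inv u by auto
    then show "\<exists>Q\<in>carrier ?G. Q \<otimes>\<^bsub>?G\<^esub> P = \<one>\<^bsub>?G\<^esub>"
      using u car by (intro bexI[of _ "?c v"])
        (auto simp: one presented_mult equiv_class_eq[OF equiv_pres_cong])
  qed (auto simp: car one presented_mult intro: bexI[of _ "[]"])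
qed


section \<open>Short exact sequences, outer automorphisms, semidirect products\<close>

text \<open>The library predicate \<open>short_exact_sequence\<close> needs all groups to have the same element type.\<close>

definition ses ::
  "('a, 'd) monoid_scheme \<Rightarrow> ('a \<Rightarrow> 'b) \<Rightarrow> ('b, 'e) monoid_scheme \<Rightarrow> ('b \<Rightarrow> 'c) \<Rightarrow> ('c, 'f) monoid_scheme \<Rightarrow> bool"
  where
  "ses A f B g C \<longleftrightarrow> group A \<and> group B \<and> group C \<and> f \<in> mon A B \<and> g \<in> epi B C \<and>
     f ` carrier A = kernel B C g"

definition conj_auto :: "('a, 'b) monoid_scheme \<Rightarrow> 'a \<Rightarrow> 'a \<Rightarrow> 'a" where
  "conj_auto G g = (\<lambda>h\<in>carrier G. g \<otimes>\<^bsub>G\<^esub> h \<otimes>\<^bsub>G\<^esub> inv\<^bsub>G\<^esub> g)"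

definition Inn :: "('a, 'b) monoid_scheme \<Rightarrow> ('a \<Rightarrow> 'a) set" where
  "Inn G = conj_auto G ` carrier G"

definition Out :: "('a, 'b) monoid_scheme \<Rightarrow> ('a \<Rightarrow> 'a) set monoid" where
  "Out G = AutoGroup G Mod Inn G"

definition out_class :: "('a, 'b) monoid_scheme \<Rightarrow> ('a \<Rightarrow> 'a) \<Rightarrow> ('a \<Rightarrow> 'a) set" where
  "out_class G \<phi> = Inn G #>\<^bsub>AutoGroup G\<^esub> \<phi>"

definition semidirect ::
  "('a, 'c) monoid_scheme \<Rightarrow> ('b, 'd) monoid_scheme \<Rightarrow> ('b \<Rightarrow> 'a \<Rightarrow> 'a) \<Rightarrow> ('a \<times> 'b) monoid" where
  "semidirect N H \<theta> =
    \<lparr>carrier = carrier N \<times> carrier H,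
     monoid.mult = (\<lambda>(a, h) (b, k). (a \<otimes>\<^bsub>N\<^esub> \<theta> h b, h \<otimes>\<^bsub>H\<^esub> k)),
     one = (\<one>\<^bsub>N\<^esub>, \<one>\<^bsub>H\<^esub>)\<rparr>"


section \<open>Modules over a group: automorphisms and first cohomology\<close>

text \<open>\<open>act :: 'w \<Rightarrow> 'a \<Rightarrow> 'a\<close> is a left action of \<open>W\<close> on the (multiplicatively written) abelian group \<open>A\<close>.\<close>

definition mod_Aut :: "('w, 'c) monoid_scheme \<Rightarrow> 'a monoid \<Rightarrow> ('w \<Rightarrow> 'a \<Rightarrow> 'a) \<Rightarrow> ('a \<Rightarrow> 'a) monoid" where
  "mod_Aut W A act =
    (AutoGroup A)\<lparr>carrier := {f \<in> auto A. \<forall>w\<in>carrier W. \<forall>a\<in>carrier A. f (act w a) = act w (f a)}\<rparr>"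

definition semilin_Aut ::
  "('w, 'c) monoid_scheme \<Rightarrow> 'a monoid \<Rightarrow> ('w \<Rightarrow> 'a \<Rightarrow> 'a) \<Rightarrow> (('a \<Rightarrow> 'a) \<times> ('w \<Rightarrow> 'w)) monoid" where
  "semilin_Aut W A act =
    (AutoGroup A \<times>\<times> AutoGroup W)\<lparr>carrier :=
      {(f, F) \<in> auto A \<times> auto W. \<forall>w\<in>carrier W. \<forall>a\<in>carrier A. f (act w a) = act (F w) (f a)}\<rparr>"

definition cocycles :: "('w, 'c) monoid_scheme \<Rightarrow> 'a monoid \<Rightarrow> ('w \<Rightarrow> 'a \<Rightarrow> 'a) \<Rightarrow> ('w \<Rightarrow> 'a) monoid" where
  "cocycles W A act =
    (product_group (carrier W) (\<lambda>_. A))\<lparr>carrier :=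
      {c \<in> carrier W \<rightarrow>\<^sub>E carrier A.
        \<forall>v\<in>carrier W. \<forall>w\<in>carrier W. c (v \<otimes>\<^bsub>W\<^esub> w) = c v \<otimes>\<^bsub>A\<^esub> act v (c w)}\<rparr>"

definition coboundaries :: "('w, 'c) monoid_scheme \<Rightarrow> 'a monoid \<Rightarrow> ('w \<Rightarrow> 'a \<Rightarrow> 'a) \<Rightarrow> ('w \<Rightarrow> 'a) set" where
  "coboundaries W A act = (\<lambda>a. \<lambda>w\<in>carrier W. act w a \<otimes>\<^bsub>A\<^esub> inv\<^bsub>A\<^esub> a) ` carrier A"

definition H1 :: "('w, 'c) monoid_scheme \<Rightarrow> 'a monoid \<Rightarrow> ('w \<Rightarrow> 'a \<Rightarrow> 'a) \<Rightarrow> ('w \<Rightarrow> 'a) set monoid" where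
  "H1 W A act = cocycles W A act Mod coboundaries W A act"


section \<open>The groups \<open>G\<close>, \<open>A\<close>, \<open>W\<close> and \<open>M\<^sub>0\<close>\<close>

text \<open>Generators, rows and columns are indexed by \<open>0, \<dots>, n - 1\<close>.\<close>

definition rels :: "nat \<Rightarrow> (nat word \<times> nat word) set" where
  "rels n = {([(i, False), (j, True), (j, True), (i, True)], [(j, False), (j, False)]) | i j.
     i < n \<and> j < n \<and> i \<noteq> j}"

type_synonym G_elt = "nat word set"

definition grpG :: "nat \<Rightarrow> G_elt monoid" where
  "grpG n = presented_group {..<n} (rels n)"

definition gen :: "nat \<Rightarrow> nat \<Rightarrow> G_elt" where
  "gen n i = pres_gen {..<n} (rels n) i"

definition sq :: "nat \<Rightarrow> nat \<Rightarrow> G_elt" where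
  "sq n i = gen n i [^]\<^bsub>grpG n\<^esub> (2::nat)"

definition setA :: "nat \<Rightarrow> G_elt set" where
  "setA n = generate (grpG n) (sq n ` {..<n})"

definition grpA :: "nat \<Rightarrow> G_elt monoid" where
  "grpA n = (grpG n)\<lparr>carrier := setA n\<rparr>"

definition A_elt :: "nat \<Rightarrow> (nat \<Rightarrow> int) \<Rightarrow> G_elt" where
  "A_elt n e = (\<Otimes>\<^bsub>grpA n\<^esub>j\<in>{..<n}. sq n j [^]\<^bsub>grpG n\<^esub> e j)"

definition grpW :: "nat \<Rightarrow> G_elt set monoid" where
  "grpW n = grpG n Mod setA n"

definition G_to_W :: "nat \<Rightarrow> G_elt \<Rightarrow> G_elt set" where
  "G_to_W n g = setA n #>\<^bsub>grpG n\<^esub> g"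

text \<open>Here and below, \<open>the_elem (f ` P)\<close> is the value of the map induced by \<open>f\<close> on the class \<open>P\<close>.\<close>

definition actW :: "nat \<Rightarrow> G_elt set \<Rightarrow> G_elt \<Rightarrow> G_elt" where
  "actW n w a = the_elem ((\<lambda>g. g \<otimes>\<^bsub>grpG n\<^esub> a \<otimes>\<^bsub>grpG n\<^esub> inv\<^bsub>grpG n\<^esub> g) ` w)"

definition M0 :: "nat \<Rightarrow> int mat monoid" where
  "M0 n = (monoid_mat TYPE(int) n n)\<lparr>carrier := {M \<in> carrier_mat n n. \<forall>i<n. M $$ (i, i) = 0}\<rparr>"

abbreviation "AutG n \<equiv> AutoGroup (grpG n)"
abbreviation "OutG n \<equiv> Out (grpG n)"
abbreviation "OutW n \<equiv> Out (grpW n)"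
abbreviation "AutWA n \<equiv> mod_Aut (grpW n) (grpA n) (actW n)"
abbreviation "AutSA n \<equiv> semilin_Aut (grpW n) (grpA n) (actW n)"
abbreviation "Z1WA n \<equiv> cocycles (grpW n) (grpA n) (actW n)"
abbreviation "B1WA n \<equiv> coboundaries (grpW n) (grpA n) (actW n)"
abbreviation "H1WA n \<equiv> H1 (grpW n) (grpA n) (actW n)"


section \<open>The maps of the diagram\<close>

definition tmap :: "nat \<Rightarrow> int mat \<Rightarrow> G_elt \<Rightarrow> G_elt" where
  "tmap n M = (THE \<phi>. \<phi> \<in> auto (grpG n) \<and>
     (\<forall>i<n. \<phi> (gen n i) = gen n i \<otimes>\<^bsub>grpG n\<^esub> A_elt n (\<lambda>j. M $$ (i, j))))"

definition iota :: "nat \<Rightarrow> G_elt \<Rightarrow> int mat" where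
  "iota n a = (THE M. \<exists>e. a = A_elt n e \<and> M = mat n n (\<lambda>(i, j). if i = j then 0 else - 2 * e j))"

definition AutG_to_AutSA :: "nat \<Rightarrow> (G_elt \<Rightarrow> G_elt) \<Rightarrow> (G_elt \<Rightarrow> G_elt) \<times> (G_elt set \<Rightarrow> G_elt set)" where
  "AutG_to_AutSA n \<phi> =
    (restrict \<phi> (setA n), \<lambda>w\<in>carrier (grpW n). the_elem ((\<lambda>g. G_to_W n (\<phi> g)) ` w))"

definition W_to_AutSA :: "nat \<Rightarrow> G_elt set \<Rightarrow> (G_elt \<Rightarrow> G_elt) \<times> (G_elt set \<Rightarrow> G_elt set)" where
  "W_to_AutSA n w = (\<lambda>a\<in>setA n. actW n w a, conj_auto (grpW n) w)"

definition M0_to_H1 :: "nat \<Rightarrow> int mat \<Rightarrow> (G_elt set \<Rightarrow> G_elt) set" where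
  "M0_to_H1 n M = B1WA n #>\<^bsub>Z1WA n\<^esub>
    (\<lambda>w\<in>carrier (grpW n). the_elem ((\<lambda>g. tmap n M g \<otimes>\<^bsub>grpG n\<^esub> inv\<^bsub>grpG n\<^esub> g) ` w))"

definition H1_to_OutG :: "nat \<Rightarrow> (G_elt set \<Rightarrow> G_elt) set \<Rightarrow> (G_elt \<Rightarrow> G_elt) set" where
  "H1_to_OutG n C = the_elem
    ((\<lambda>c. out_class (grpG n) (\<lambda>g\<in>carrier (grpG n). c (G_to_W n g) \<otimes>\<^bsub>grpG n\<^esub> g)) ` C)"


section \<open>The extension of \<open>Out(W)\<close> by \<open>Aut\<^sub>W(A)\<close>\<close>

definition AutSA_mod_W :: "nat \<Rightarrow> ((G_elt \<Rightarrow> G_elt) \<times> (G_elt set \<Rightarrow> G_elt set)) set monoid" where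
  "AutSA_mod_W n = AutSA n Mod (W_to_AutSA n ` carrier (grpW n))"

definition AutSA_class ::
  "nat \<Rightarrow> (G_elt \<Rightarrow> G_elt) \<times> (G_elt set \<Rightarrow> G_elt set) \<Rightarrow> ((G_elt \<Rightarrow> G_elt) \<times> (G_elt set \<Rightarrow> G_elt set)) set"
  where
  "AutSA_class n p = (W_to_AutSA n ` carrier (grpW n)) #>\<^bsub>AutSA n\<^esub> p"

definition ext_incl :: "nat \<Rightarrow> (G_elt \<Rightarrow> G_elt) \<Rightarrow> ((G_elt \<Rightarrow> G_elt) \<times> (G_elt set \<Rightarrow> G_elt set)) set" where
  "ext_incl n f = AutSA_class n (f, \<lambda>w\<in>carrier (grpW n). w)"

definition ext_proj ::
  "nat \<Rightarrow> ((G_elt \<Rightarrow> G_elt) \<times> (G_elt set \<Rightarrow> G_elt set)) set \<Rightarrow> (G_elt set \<Rightarrow> G_elt set) set" where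
  "ext_proj n P = the_elem ((\<lambda>(f, F). out_class (grpW n) F) ` P)"

definition splitting ::
  "nat \<Rightarrow> ((G_elt set \<Rightarrow> G_elt set) set \<Rightarrow> ((G_elt \<Rightarrow> G_elt) \<times> (G_elt set \<Rightarrow> G_elt set)) set) \<Rightarrow> bool" where
  "splitting n s \<longleftrightarrow> s \<in> hom (OutW n) (AutSA_mod_W n) \<and> (\<forall>q\<in>carrier (OutW n). ext_proj n (s q) = q)"

text \<open>The conjugation action of \<open>Out(W)\<close> on \<open>Aut\<^sub>W(A)\<close> through a splitting \<open>s\<close>.\<close>

definition split_act ::
  "nat \<Rightarrow> ((G_elt set \<Rightarrow> G_elt set) set \<Rightarrow> ((G_elt \<Rightarrow> G_elt) \<times> (G_elt set \<Rightarrow> G_elt set)) set) \<Rightarrow>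
   (G_elt set \<Rightarrow> G_elt set) set \<Rightarrow> (G_elt \<Rightarrow> G_elt) \<Rightarrow> (G_elt \<Rightarrow> G_elt)" where
  "split_act n s q = (\<lambda>f\<in>carrier (AutWA n). inv_into (carrier (AutWA n)) (ext_incl n)
     (s q \<otimes>\<^bsub>AutSA_mod_W n\<^esub> ext_incl n f \<otimes>\<^bsub>AutSA_mod_W n\<^esub> inv\<^bsub>AutSA_mod_W n\<^esub> (s q)))"

definition AutWA_OutW ::
  "nat \<Rightarrow> ((G_elt set \<Rightarrow> G_elt set) set \<Rightarrow> ((G_elt \<Rightarrow> G_elt) \<times> (G_elt set \<Rightarrow> G_elt set)) set) \<Rightarrow>
   ((G_elt \<Rightarrow> G_elt) \<times> (G_elt set \<Rightarrow> G_elt set) set) monoid" where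
  "AutWA_OutW n s = semidirect (AutWA n) (OutW n) (split_act n s)"

definition split_iso ::
  "nat \<Rightarrow> ((G_elt set \<Rightarrow> G_elt set) set \<Rightarrow> ((G_elt \<Rightarrow> G_elt) \<times> (G_elt set \<Rightarrow> G_elt set)) set) \<Rightarrow>
   (G_elt \<Rightarrow> G_elt) \<times> (G_elt set \<Rightarrow> G_elt set) set \<Rightarrow> ((G_elt \<Rightarrow> G_elt) \<times> (G_elt set \<Rightarrow> G_elt set)) set" where
  "split_iso n s = (\<lambda>(f, q). ext_incl n f \<otimes>\<^bsub>AutSA_mod_W n\<^esub> s q)"

definition AutSA_to_semidirect ::
  "nat \<Rightarrow> ((G_elt set \<Rightarrow> G_elt set) set \<Rightarrow> ((G_elt \<Rightarrow> G_elt) \<times> (G_elt set \<Rightarrow> G_elt set)) set) \<Rightarrow>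
   (G_elt \<Rightarrow> G_elt) \<times> (G_elt set \<Rightarrow> G_elt set) \<Rightarrow> (G_elt \<Rightarrow> G_elt) \<times> (G_elt set \<Rightarrow> G_elt set) set" where
  "AutSA_to_semidirect n s p = inv_into (carrier (AutWA_OutW n s)) (split_iso n s) (AutSA_class n p)"

definition OutG_to_semidirect ::
  "nat \<Rightarrow> ((G_elt set \<Rightarrow> G_elt set) set \<Rightarrow> ((G_elt \<Rightarrow> G_elt) \<times> (G_elt set \<Rightarrow> G_elt set)) set) \<Rightarrow>
   (G_elt \<Rightarrow> G_elt) set \<Rightarrow> (G_elt \<Rightarrow> G_elt) \<times> (G_elt set \<Rightarrow> G_elt set) set" where
  "OutG_to_semidirect n s P = the_elem ((\<lambda>\<phi>. AutSA_to_semidirect n s (AutG_to_AutSA n \<phi>)) ` P)"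

abbreviation Z_pow :: "nat \<Rightarrow> (nat \<Rightarrow> int) monoid" where
  "Z_pow m \<equiv> product_group {..<m} (\<lambda>_. integer_group)"

abbreviation Z2_pow :: "nat \<Rightarrow> (nat \<Rightarrow> int) monoid" where
  "Z2_pow m \<equiv> product_group {..<m} (\<lambda>_. integer_mod_group 2)"

end

theory Submission
  imports Defs
begin

text \<open>The group \<open>G\<close> is an extension of \<open>W\<close>, a free product of groups of order two, by the free abelian group
\<open>A\<close> on the squares of the generators, on which \<open>x\<^sub>i\<close> acts by fixing \<open>x\<^sub>i\<^sup>2\<close> and inverting the other
\<open>x\<^sub>j\<^sup>2\<close>.  Two concrete actions of \<open>G\<close> give this: an affine representation yields coordinates on \<open>A\<close>
(\<open>A_elt_eq_iff\<close>) and the signs by which \<open>G\<close> acts on them (\<open>conj_A_elt\<close>), and the action on reduced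
words yields unique normal forms in \<open>W\<close> (\<open>wprod_inj\<close>).  Comparing reduced words shows for \<open>n \<ge> 3\<close> that
\<open>W\<close> has no nontrivial abelian normal subgroup; since automorphisms of \<open>G\<close> map \<open>A\<close> to an abelian normal
subgroup, \<open>A\<close> is characteristic and \<open>Aut(G)\<close> acts on \<open>A\<close> and on \<open>W\<close>.

An automorphism that is trivial on \<open>A\<close> and on \<open>W\<close> multiplies each \<open>x\<^sub>i\<close> by an element of \<open>A\<close> whose
\<open>i\<close>-th coordinate vanishes, because \<open>x\<^sub>i\<^sup>2\<close> is fixed; so it is some \<open>t\<^sub>\<aa>\<close> (\<open>tmap_range\<close>).  On the other
hand these automorphisms are the maps \<open>g \<mapsto> c(g) g\<close> for the cocycles \<open>c\<close> of \<open>W\<close> in \<open>A\<close>.  Hence \<open>M\<^sub>0\<close> is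
the group of cocycles, with \<open>\<iota>(A)\<close> as the group of coboundaries (\<open>cocycle_of_iso\<close>, \<open>B1_eq\<close>).

The main point is that every semi-linear automorphism \<open>(f, F)\<close> comes from an automorphism of \<open>G\<close>
(\<open>r_surj\<close>).  Involutions of \<open>W\<close> are conjugate to generators (\<open>involution_conjugate\<close>), so \<open>F\<close> maps
generators to conjugates of generators and lifts to an endomorphism \<open>\<phi>\<close> of \<open>G\<close> doing the same
(\<open>positive_hom_exists\<close>).  The restriction of \<open>\<phi>\<close> to \<open>A\<close> depends on \<open>F\<close> only
(\<open>positive_square_unique\<close>); therefore the lifts of \<open>F\<close> and of its inverse are inverse to each other
on \<open>A\<close>, and \<open>\<phi>\<close> is an automorphism.  Now \<open>f\<close> differs from \<open>\<phi>\<close> on \<open>A\<close> by a \<open>W\<close>-module automorphism, which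
is a change of signs (\<open>AutWA_sq\<close>) and is induced by \<open>x\<^sub>i \<mapsto> x\<^sub>i\<^sup>\<plusminus>\<^sup>1\<close>.  The same lifts provide the splitting
over \<open>Out(W)\<close>: they are compatible with composition, and an inner automorphism of \<open>W\<close> lifts to an inner
automorphism of \<open>G\<close>, whose class in \<open>Aut\<^sub>S(A)/W\<close> is trivial (\<open>splitting_exists\<close>).

Exactness of the bottom row then follows from that of the other rows and columns by a diagram chase
(\<open>nine_lemma\<close>).  In it, \<open>H\<^sup>1(W, A)\<close> is computed column by column: the off-diagonal part of a column of
integers modulo the even constant columns is described by differences of entries and one parity
(\<open>ses_M0_product\<close>).  A module automorphism of \<open>A\<close> is described by \<open>n\<close> signs (\<open>AutWA_iso\<close>).\<close>


section \<open>Cosets, automorphism groups and short exact sequences\<close>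

text \<open>The value on a coset of the map induced by \<open>h\<close> is found at any representative; all maps between
  quotients below are evaluated in this way.\<close>

lemma the_elem_coset:
  assumes "group G" "subgroup N G" "x \<in> carrier G" "\<And>k. k \<in> N \<Longrightarrow> h (k \<otimes>\<^bsub>G\<^esub> x) = h x"
  shows "the_elem (h ` (N #>\<^bsub>G\<^esub> x)) = h x"
proof -
  have "h ` (N #>\<^bsub>G\<^esub> x) = {h x}"
    using assms(4) group.rcos_self[OF assms(1,3,2)] unfolding r_coset_def by auto
  then show ?thesis by simp
qed

lemma coset_eq_iff:
  assumes "group G" "subgroup N G" "x \<in> carrier G" "y \<in> carrier G"
  shows "N #>\<^bsub>G\<^esub> x = N #>\<^bsub>G\<^esub> y \<longleftrightarrow> x \<otimes>\<^bsub>G\<^esub> inv\<^bsub>G\<^esub> y \<in> N"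
proof -
  interpret group G by fact
  interpret N: subgroup N G by fact
  show ?thesis
  proof
    assume "N #>\<^bsub>G\<^esub> x = N #>\<^bsub>G\<^esub> y"
    then show "x \<otimes>\<^bsub>G\<^esub> inv\<^bsub>G\<^esub> y \<in> N"
      by (metis assms(3,4) is_group N.rcos_module_imp rcos_self assms(2))
  next
    assume "x \<otimes>\<^bsub>G\<^esub> inv\<^bsub>G\<^esub> y \<in> N"
    then have "x \<in> N #>\<^bsub>G\<^esub> y" by (simp add: N.rcos_module_rev assms)
    then show "N #>\<^bsub>G\<^esub> x = N #>\<^bsub>G\<^esub> y" using repr_independence assms by metis
  qed
qed

lemma coset_eq_self_iff:
  assumes "group G" "subgroup N G" "x \<in> carrier G"
  shows "N #>\<^bsub>G\<^esub> x = N \<longleftrightarrow> x \<in> N"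
proof -
  interpret group G by fact
  show ?thesis
    using coset_eq_iff[OF assms(1,2,3), of "\<one>\<^bsub>G\<^esub>"] assms(2,3) subgroup.subset[OF assms(2)]
    by (simp add: coset_mult_one)
qed

lemma (in group) cancel_left:
  "x \<in> carrier G \<Longrightarrow> y \<in> carrier G \<Longrightarrow> inv x \<otimes> (x \<otimes> y) = y"
  "x \<in> carrier G \<Longrightarrow> y \<in> carrier G \<Longrightarrow> x \<otimes> (inv x \<otimes> y) = y"
  by (simp_all add: m_assoc[symmetric])

lemma (in group) conj_mult:
  "g \<in> carrier G \<Longrightarrow> x \<in> carrier G \<Longrightarrow> y \<in> carrier G \<Longrightarrow>
    (g \<otimes> x \<otimes> inv g) \<otimes> (g \<otimes> y \<otimes> inv g) = g \<otimes> (x \<otimes> y) \<otimes> inv g"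
  by (simp add: m_assoc cancel_left)

lemma hom_image_normal:
  assumes "group G" "group H" "h \<in> hom G H" "h ` carrier G = carrier H" "N \<lhd> G"
  shows "h ` N \<lhd> H"
proof -
  interpret G: group G by fact
  interpret H: group H by fact
  interpret h: group_hom G H h by unfold_locales (rule assms)
  interpret N: normal N G by fact
  show ?thesis
    unfolding H.normal_inv_iff
  proof (intro conjI ballI)
    show "subgroup (h ` N) H" by (rule h.subgroup_img_is_subgroup[OF N.subgroup_axioms])
    fix x y assume "x \<in> carrier H" "y \<in> h ` N"
    then have "x \<in> h ` carrier G" using assms(4) by simp
    then obtain g where g: "g \<in> carrier G" "x = h g" by blast
    obtain k where k: "k \<in> N" "y = h k" using \<open>y \<in> h ` N\<close> by blast
    have "x \<otimes>\<^bsub>H\<^esub> y \<otimes>\<^bsub>H\<^esub> inv\<^bsub>H\<^esub> x = h (g \<otimes>\<^bsub>G\<^esub> k \<otimes>\<^bsub>G\<^esub> inv\<^bsub>G\<^esub> g)"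
      using g k N.subset by auto
    then show "x \<otimes>\<^bsub>H\<^esub> y \<otimes>\<^bsub>H\<^esub> inv\<^bsub>H\<^esub> x \<in> h ` N" using N.inv_op_closed2[OF g(1) k(1)] by simp
  qed
qed

lemma carrier_AutoGroup [simp]: "carrier (AutoGroup G) = auto G"
  by (simp add: AutoGroup_def)

lemma mult_AutoGroup [simp]:
  "\<phi> \<in> auto G \<Longrightarrow> \<psi> \<in> auto G \<Longrightarrow> \<phi> \<otimes>\<^bsub>AutoGroup G\<^esub> \<psi> = compose (carrier G) \<phi> \<psi>"
  by (simp add: AutoGroup_def BijGroup_def auto_def)

lemma one_AutoGroup [simp]: "\<one>\<^bsub>AutoGroup G\<^esub> = (\<lambda>x\<in>carrier G. x)"
  by (simp add: AutoGroup_def BijGroup_def)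

lemma auto_hom: "\<phi> \<in> auto G \<Longrightarrow> \<phi> \<in> hom G G"
  by (simp add: auto_def)

lemma auto_closed [simp]: "\<phi> \<in> auto G \<Longrightarrow> x \<in> carrier G \<Longrightarrow> \<phi> x \<in> carrier G"
  using hom_in_carrier[OF auto_hom] .

lemma auto_mult:
  "\<phi> \<in> auto G \<Longrightarrow> x \<in> carrier G \<Longrightarrow> y \<in> carrier G \<Longrightarrow> \<phi> (x \<otimes>\<^bsub>G\<^esub> y) = \<phi> x \<otimes>\<^bsub>G\<^esub> \<phi> y"
  using hom_mult[OF auto_hom] .

lemma auto_inv:
  "group G \<Longrightarrow> \<phi> \<in> auto G \<Longrightarrow> x \<in> carrier G \<Longrightarrow> \<phi> (inv\<^bsub>G\<^esub> x) = inv\<^bsub>G\<^esub> \<phi> x"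
  using group_hom.hom_inv[of G G \<phi> x] by (simp add: auto_hom group_hom_def group_hom_axioms_def)

lemma auto_bij: "\<phi> \<in> auto G \<Longrightarrow> bij_betw \<phi> (carrier G) (carrier G)"
  by (simp add: auto_def Bij_def)

lemma auto_eqI:
  "\<phi> \<in> auto G \<Longrightarrow> \<psi> \<in> auto G \<Longrightarrow> (\<And>x. x \<in> carrier G \<Longrightarrow> \<phi> x = \<psi> x) \<Longrightarrow> \<phi> = \<psi>"
  unfolding auto_def Bij_def by (auto intro: extensionalityI)

lemma restrict_auto:
  assumes "\<phi> \<in> hom G G" "bij_betw \<phi> (carrier G) (carrier G)" "group G"
  shows "restrict \<phi> (carrier G) \<in> auto G"
  unfolding auto_def Bij_def
proof (intro IntI CollectI)
  show "restrict \<phi> (carrier G) \<in> hom G G"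
    using assms(1) group.is_monoid[OF assms(3)] hom_mult[OF assms(1)]
    by (intro homI) (auto simp: hom_in_carrier[OF assms(1)] monoid.m_closed)
  show "bij_betw (restrict \<phi> (carrier G)) (carrier G) (carrier G)"
    using assms(2) bij_betw_cong[of "carrier G" "restrict \<phi> (carrier G)" \<phi>] by auto
qed auto

lemma AutoGroup_inv_app:
  assumes "group G" "\<phi> \<in> auto G" "x \<in> carrier G"
  shows "(inv\<^bsub>AutoGroup G\<^esub> \<phi>) (\<phi> x) = x"
proof -
  interpret A: group "AutoGroup G" using assms by (simp add: group.AutoGroup)
  have "inv\<^bsub>AutoGroup G\<^esub> \<phi> \<in> auto G" "inv\<^bsub>AutoGroup G\<^esub> \<phi> \<otimes>\<^bsub>AutoGroup G\<^esub> \<phi> = \<one>\<^bsub>AutoGroup G\<^esub>"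
    using A.inv_closed[of \<phi>] assms A.l_inv[of \<phi>] by auto
  then show ?thesis using assms by (auto simp: compose_def fun_eq_iff split: if_splits)
qed

lemma AutoGroup_app_inv:
  assumes "group G" "\<phi> \<in> auto G" "x \<in> carrier G"
  shows "\<phi> ((inv\<^bsub>AutoGroup G\<^esub> \<phi>) x) = x"
proof -
  obtain y where "y \<in> carrier G" "x = \<phi> y"
    using assms auto_bij[of \<phi> G] unfolding bij_betw_def by auto
  then show ?thesis using AutoGroup_inv_app[OF assms(1,2)] by simp
qed

lemma hom_of_epi:
  assumes "group B" "g \<in> hom B C" "\<And>z. z \<in> carrier C \<Longrightarrow> \<exists>y\<in>carrier B. g y = z"
    and f: "f \<in> hom B D" and \<alpha>: "\<And>y. y \<in> carrier B \<Longrightarrow> \<alpha> (g y) = f y"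
  shows "\<alpha> \<in> hom C D"
proof (rule homI)
  fix u assume "u \<in> carrier C"
  then obtain x where x: "x \<in> carrier B" "g x = u" using assms(3) by blast
  then show "\<alpha> u \<in> carrier D" using \<alpha> hom_in_carrier[OF f] by auto
  fix v assume "v \<in> carrier C"
  then obtain y where y: "y \<in> carrier B" "g y = v" using assms(3) by blast
  have "x \<otimes>\<^bsub>B\<^esub> y \<in> carrier B" using x y assms(1) by (simp add: group.is_monoid monoid.m_closed)
  then show "\<alpha> (u \<otimes>\<^bsub>C\<^esub> v) = \<alpha> u \<otimes>\<^bsub>D\<^esub> \<alpha> v"
    using \<alpha>[of "x \<otimes>\<^bsub>B\<^esub> y"] \<alpha>[of x] \<alpha>[of y] hom_mult[OF assms(2) x(1) y(1)] hom_mult[OF f x(1) y(1)] x y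
    by simp
qed

lemma sesD:
  assumes "ses A f B g C"
  shows "group A" "group B" "group C" "f \<in> hom A B" "g \<in> hom B C"
    "x \<in> carrier A \<Longrightarrow> f x \<in> carrier B"
    "y \<in> carrier B \<Longrightarrow> g y \<in> carrier C"
    "x \<in> carrier A \<Longrightarrow> x' \<in> carrier A \<Longrightarrow> f x = f x' \<Longrightarrow> x = x'"
    "z \<in> carrier C \<Longrightarrow> \<exists>y\<in>carrier B. g y = z"
    "x \<in> carrier A \<Longrightarrow> g (f x) = \<one>\<^bsub>C\<^esub>"
    "y \<in> carrier B \<Longrightarrow> g y = \<one>\<^bsub>C\<^esub> \<Longrightarrow> \<exists>x\<in>carrier A. f x = y"
proof -
  have s: "group A" "group B" "group C" "f \<in> hom A B" "g \<in> hom B C" "inj_on f (carrier A)"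
    "g ` carrier B = carrier C" "f ` carrier A = {y \<in> carrier B. g y = \<one>\<^bsub>C\<^esub>}"
    using assms unfolding ses_def mon_def epi_def kernel_def by auto
  show "group A" "group B" "group C" "f \<in> hom A B" "g \<in> hom B C" using s by auto
  show "x \<in> carrier A \<Longrightarrow> f x \<in> carrier B" "y \<in> carrier B \<Longrightarrow> g y \<in> carrier C"
    using hom_in_carrier s by metis+
  show "x \<in> carrier A \<Longrightarrow> x' \<in> carrier A \<Longrightarrow> f x = f x' \<Longrightarrow> x = x'"
    using inj_onD[OF s(6)] by blast
  show "z \<in> carrier C \<Longrightarrow> \<exists>y\<in>carrier B. g y = z"  proof -
    assume "z \<in> carrier C"
    then have "z \<in> g ` carrier B" using s(7) by simp
    then show ?thesis by blast
  qed
  show "x \<in> carrier A \<Longrightarrow> g (f x) = \<one>\<^bsub>C\<^esub>"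
    "y \<in> carrier B \<Longrightarrow> g y = \<one>\<^bsub>C\<^esub> \<Longrightarrow> \<exists>x\<in>carrier A. f x = y"
  proof -
    show "x \<in> carrier A \<Longrightarrow> g (f x) = \<one>\<^bsub>C\<^esub>" using s(8) by blast
    assume "y \<in> carrier B" "g y = \<one>\<^bsub>C\<^esub>"
    then have "y \<in> f ` carrier A" using s(8) by simp
    then show "\<exists>x\<in>carrier A. f x = y" by blast
  qed
qed

lemma sesI:
  assumes "group A" "group B" "group C" "f \<in> hom A B" "g \<in> hom B C"
    "\<And>x. x \<in> carrier A \<Longrightarrow> f x = \<one>\<^bsub>B\<^esub> \<Longrightarrow> x = \<one>\<^bsub>A\<^esub>"
    "\<And>z. z \<in> carrier C \<Longrightarrow> \<exists>y\<in>carrier B. g y = z"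
    "\<And>x. x \<in> carrier A \<Longrightarrow> g (f x) = \<one>\<^bsub>C\<^esub>"
    "\<And>y. y \<in> carrier B \<Longrightarrow> g y = \<one>\<^bsub>C\<^esub> \<Longrightarrow> \<exists>x\<in>carrier A. f x = y"
  shows "ses A f B g C"
proof -
  have "f \<in> mon A B"
    using mon_iff_hom_one[OF assms(1,2)] assms(4,6) by auto
  moreover have "g \<in> epi B C" using assms(5,7) unfolding epi_iff_subset by force
  moreover have "f ` carrier A = kernel B C g"
    using assms(8,9) hom_in_carrier[OF assms(4)] unfolding kernel_def by fastforce
  ultimately show ?thesis using assms unfolding ses_def by auto
qed

lemma ses_Mod:
  assumes "group A" "group B" "f \<in> mon A B" "f ` carrier A \<lhd> B"
  shows "ses A f B (\<lambda>x. f ` carrier A #>\<^bsub>B\<^esub> x) (B Mod f ` carrier A)"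
proof -
  interpret N: normal "f ` carrier A" B by fact
  have "f \<in> hom A B" "inj_on f (carrier A)" using assms by (auto simp: mon_def)
  then show ?thesis
    unfolding ses_def epi_def kernel_def
    using assms N.r_coset_hom_Mod N.factorgroup_is_group
      coset_eq_self_iff[OF assms(2) N.subgroup_axioms] N.subset
    by (simp add: carrier_FactGroup) blast
qed

lemma ses_iso_right:
  assumes "ses A f B g C" "h \<in> iso C D" "group D"
  shows "ses A f B (h \<circ> g) D"
proof (rule sesI)
  have h: "h \<in> hom C D" "bij_betw h (carrier C) (carrier D)" using assms by (auto simp: iso_def)
  note s = sesD[OF assms(1)]
  show "h \<circ> g \<in> hom B D" using s(5) h(1) hom_compose by blast
  show "\<exists>y\<in>carrier B. (h \<circ> g) y = z" if "z \<in> carrier D" for z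
    using that h(2) s(9) unfolding bij_betw_def by (metis comp_apply imageE)
  have h1: "h \<one>\<^bsub>C\<^esub> = \<one>\<^bsub>D\<^esub>" using hom_one h(1) s(3) assms(3) by blast
  show "(h \<circ> g) (f x) = \<one>\<^bsub>D\<^esub>" if "x \<in> carrier A" for x using s(10)[OF that] h1 by simp
  show "\<exists>x\<in>carrier A. f x = y" if "y \<in> carrier B" "(h \<circ> g) y = \<one>\<^bsub>D\<^esub>" for y
  proof (rule s(11))
    show "g y = \<one>\<^bsub>C\<^esub>" using that h1 h(2) s(7)[OF that(1)] s(3)
      unfolding bij_betw_def inj_on_def by (metis comp_apply group.is_monoid monoid.one_closed)
  qed fact
  show "x = \<one>\<^bsub>A\<^esub>" if "x \<in> carrier A" "f x = \<one>\<^bsub>B\<^esub>" for x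
    using that s(8)[of x "\<one>\<^bsub>A\<^esub>"] s(1,2) hom_one[OF s(4)] by (simp add: group.is_monoid)
qed (use sesD[OF assms(1)] assms in auto)

lemma ses_iso_left:
  assumes "ses A f B g C" "h \<in> iso D A" "group D"
  shows "ses D (f \<circ> h) B g C"
proof -
  have h: "h \<in> hom D A" "inj_on h (carrier D)" "h ` carrier D = carrier A"
    using assms by (auto simp: iso_def bij_betw_def)
  have "f \<circ> h \<in> mon D B"
    using assms(1) h unfolding ses_def mon_def by (auto intro: hom_compose comp_inj_on)
  moreover have "(f \<circ> h) ` carrier D = f ` carrier A" unfolding image_comp[symmetric] h(3) ..
  ultimately show ?thesis using assms unfolding ses_def by auto
qed

lemma ses_iso_middle:
  assumes "ses A f B g C" "h \<in> iso B' B" "group B'" "f' \<in> hom A B'"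
    "\<And>x. x \<in> carrier A \<Longrightarrow> h (f' x) = f x"
  shows "ses A f' B' (g \<circ> h) C"
proof (rule sesI)
  note s = sesD[OF assms(1)]
  have h: "h \<in> hom B' B" "bij_betw h (carrier B') (carrier B)" using assms(2) by (auto simp: iso_def)
  show "group A" "group B'" "group C" "f' \<in> hom A B'" by fact+
  show "g \<circ> h \<in> hom B' C" using hom_compose[OF h(1) s(5)] .
  show "x = \<one>\<^bsub>A\<^esub>" if x: "x \<in> carrier A" "f' x = \<one>\<^bsub>B'\<^esub>" for x
  proof -
    have "f x = f \<one>\<^bsub>A\<^esub>"
      using assms(5)[OF x(1)] x(2) hom_one[OF h(1) assms(3) s(2)] hom_one[OF s(4,1,2)] by simp
    then show ?thesis using s(8)[OF x(1)] s(1) by (simp add: group.is_monoid)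
  qed
  show "\<exists>y\<in>carrier B'. (g \<circ> h) y = z" if z: "z \<in> carrier C" for z
  proof -
    obtain y where y: "y \<in> carrier B" "g y = z" using s(9)[OF z] by blast
    have "y \<in> h ` carrier B'" using h(2) y by (simp add: bij_betw_def)
    then show ?thesis using y by auto
  qed
  show "(g \<circ> h) (f' x) = \<one>\<^bsub>C\<^esub>" if "x \<in> carrier A" for x using assms(5)[OF that] s(10)[OF that] by simp
  show "\<exists>x\<in>carrier A. f' x = y" if y: "y \<in> carrier B'" "(g \<circ> h) y = \<one>\<^bsub>C\<^esub>" for y
  proof -
    have "h y \<in> carrier B" using hom_in_carrier[OF h(1) y(1)] .
    then obtain x where x: "x \<in> carrier A" "f x = h y" using s(11)[of "h y"] y(2) by auto
    then have "h (f' x) = h y" using assms(5) by simp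
    then show ?thesis
      using inj_onD[of h "carrier B'" "f' x" y] h(2) hom_in_carrier[OF assms(4) x(1)] y(1) x(1)
      by (auto simp: bij_betw_def)
  qed
qed

text \<open>The two quotient maps have the same kernel and therefore factor through each other.\<close>

lemma ses_quotient_unique:
  assumes "ses A f B g C" "ses A f B g' C'"
  shows "\<exists>\<alpha>. \<alpha> \<in> iso C C'"
proof -
  note s = sesD[OF assms(1)] and s' = sesD[OF assms(2)]
  interpret B: group B by (rule s(2))
  interpret C: group C by (rule s(3))
  interpret C': group C' by (rule s'(3))
  interpret g: group_hom B C g by unfold_locales (rule s(5))
  interpret g': group_hom B C' g' by unfold_locales (rule s'(5))
  have ker: "g y = \<one>\<^bsub>C\<^esub> \<longleftrightarrow> g' y = \<one>\<^bsub>C'\<^esub>" if "y \<in> carrier B" for y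
    using s(10,11) s'(10,11) that by metis
  have eq: "g y = g z \<longleftrightarrow> g' y = g' z" if yz: "y \<in> carrier B" "z \<in> carrier B" for y z
  proof -
    have "g y = g z \<longleftrightarrow> g (y \<otimes>\<^bsub>B\<^esub> inv\<^bsub>B\<^esub> z) = \<one>\<^bsub>C\<^esub>" using yz C.inv_solve_right'[of "\<one>\<^bsub>C\<^esub>" "g y" "g z"] by auto
    also have "\<dots> \<longleftrightarrow> g' (y \<otimes>\<^bsub>B\<^esub> inv\<^bsub>B\<^esub> z) = \<one>\<^bsub>C'\<^esub>" by (rule ker) (use yz in simp)
    also have "\<dots> \<longleftrightarrow> g' y = g' z" using yz C'.inv_solve_right'[of "\<one>\<^bsub>C'\<^esub>" "g' y" "g' z"] by auto
    finally show ?thesis .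
  qed
  define \<alpha> where "\<alpha> z = g' (SOME y. y \<in> carrier B \<and> g y = z)" for z
  have \<alpha>: "\<alpha> (g y) = g' y" if y: "y \<in> carrier B" for y
  proof -
    have "\<exists>x. x \<in> carrier B \<and> g x = g y" using y by blast
    from someI_ex[OF this] show ?thesis unfolding \<alpha>_def using eq y by blast
  qed
  have "\<alpha> \<in> iso C C'"
    unfolding iso_kernel_image[OF C.is_group C'.is_group]
  proof (intro conjI equalityI subsetI)
    show "\<alpha> \<in> hom C C'" by (rule hom_of_epi[OF B.is_group s(5,9) s'(5) \<alpha>])
    show "u \<in> {\<one>\<^bsub>C\<^esub>}" if "u \<in> kernel C C' \<alpha>" for u
    proof -
      have u: "u \<in> carrier C" "\<alpha> u = \<one>\<^bsub>C'\<^esub>" using that by (auto simp: kernel_def)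
      obtain x where "x \<in> carrier B" "g x = u" using s(9)[OF u(1)] by blast
      then show ?thesis using u \<alpha> ker by auto
    qed
    show "u \<in> kernel C C' \<alpha>" if "u \<in> {\<one>\<^bsub>C\<^esub>}" for u
      using that \<alpha>[OF B.one_closed] by (simp add: kernel_def)
    show "u \<in> \<alpha> ` carrier C" if u: "u \<in> carrier C'" for u
    proof -
      obtain x where x: "x \<in> carrier B" "g' x = u" using s'(9)[OF u] by blast
      then have "u = \<alpha> (g x)" using \<alpha> by simp
      then show ?thesis using x by simp
    qed
    show "u \<in> carrier C'" if u: "u \<in> \<alpha> ` carrier C" for u
    proof -
      obtain z where z: "z \<in> carrier C" "u = \<alpha> z" using u by blast
      obtain x where x: "x \<in> carrier B" "g x = z" using s(9)[OF z(1)] by blast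
      then show ?thesis using z \<alpha>[OF x(1)] by auto
    qed
  qed
  then show ?thesis by blast
qed

text \<open>A diagram chase: the exactness of the upper two rows and of all columns descends to the
  quotients at the bottom.\<close>

lemma nine_lemma:
  assumes r1: "ses A i G p W" and r2: "ses M t U r S"
    and c1: "ses A \<iota> M \<mu> H" and c2: "ses G c U \<omega> Q" and c3: "ses W d S e T"
    and sq1: "\<And>x. x \<in> carrier A \<Longrightarrow> t (\<iota> x) = c (i x)"
    and sq2: "\<And>g. g \<in> carrier G \<Longrightarrow> r (c g) = d (p g)"
    and sq3: "\<And>m. m \<in> carrier M \<Longrightarrow> a (\<mu> m) = \<omega> (t m)"
    and sq4: "\<And>u. u \<in> carrier U \<Longrightarrow> b (\<omega> u) = e (r u)"
  shows "ses H a Q b T"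
proof (rule sesI)
  note R1 = sesD[OF r1] and R2 = sesD[OF r2] and C1 = sesD[OF c1] and C2 = sesD[OF c2]
    and C3 = sesD[OF c3]
  show "group H" "group Q" "group T" by fact+
  show "a \<in> hom H Q" by (rule hom_of_epi[OF C1(2,5,9) hom_compose[OF R2(4) C2(5)]]) (simp_all add: sq3)
  show "b \<in> hom Q T" by (rule hom_of_epi[OF C2(2,5,9) hom_compose[OF R2(5) C3(5)]]) (simp_all add: sq4)
  show "\<exists>y\<in>carrier Q. b y = z" if z: "z \<in> carrier T" for z
  proof -
    obtain y where y: "y \<in> carrier S" "e y = z" using C3(9)[OF z] by blast
    obtain u where u: "u \<in> carrier U" "r u = y" using R2(9)[OF y(1)] by blast
    then show ?thesis using sq4[OF u(1)] C2(7)[OF u(1)] y by auto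
  qed
  show "b (a x) = \<one>\<^bsub>T\<^esub>" if x: "x \<in> carrier H" for x
  proof -
    obtain m where m: "m \<in> carrier M" "\<mu> m = x" using C1(9)[OF x] by blast
    have "b (a x) = e (r (t m))" using sq3[OF m(1)] m sq4[OF R2(6)[OF m(1)]] by simp
    then show ?thesis
      using R2(10)[OF m(1)] hom_one[OF C3(5)] C3(2,3) by simp
  qed
  show "x = \<one>\<^bsub>H\<^esub>" if x: "x \<in> carrier H" "a x = \<one>\<^bsub>Q\<^esub>" for x
  proof -
    obtain m where m: "m \<in> carrier M" "\<mu> m = x" using C1(9)[OF x(1)] by blast
    have "\<omega> (t m) = \<one>\<^bsub>Q\<^esub>" using x sq3[OF m(1)] m by simp
    then obtain g where g: "g \<in> carrier G" "c g = t m" using C2(11)[OF R2(6)[OF m(1)]] by blast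
    have "d (p g) = \<one>\<^bsub>S\<^esub>" using sq2[OF g(1)] g R2(10)[OF m(1)] by simp
    then have "p g = \<one>\<^bsub>W\<^esub>"
      using C3(8)[of "p g" "\<one>\<^bsub>W\<^esub>"] R1(7) g hom_one[OF C3(4)] C3(1,2)
      by (simp add: group.is_monoid)
    then obtain y where y: "y \<in> carrier A" "i y = g" using R1(11) g by blast
    have "\<iota> y = m" using R2(8)[OF C1(6)[OF y(1)] m(1)] sq1[OF y(1)] y g by simp
    then show ?thesis using C1(10)[OF y(1)] m by simp
  qed
  show "\<exists>x\<in>carrier H. a x = y" if y: "y \<in> carrier Q" "b y = \<one>\<^bsub>T\<^esub>" for y
  proof -
    obtain u where u: "u \<in> carrier U" "\<omega> u = y" using C2(9)[OF y(1)] by blast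
    have "e (r u) = \<one>\<^bsub>T\<^esub>" using sq4[OF u(1)] u y by simp
    then obtain w where w: "w \<in> carrier W" "d w = r u" using C3(11)[OF R2(7)[OF u(1)]] by blast
    obtain g where g: "g \<in> carrier G" "p g = w" using R1(9)[OF w(1)] by blast
    interpret U: group U by fact
    interpret S: group S by fact
    interpret Q: group Q by fact
    have cg: "c g \<in> carrier U" using C2(6) g by blast
    have "r (inv\<^bsub>U\<^esub> c g \<otimes>\<^bsub>U\<^esub> u) = inv\<^bsub>S\<^esub> r (c g) \<otimes>\<^bsub>S\<^esub> r u"
      using hom_mult[OF R2(5)] group_hom.hom_inv[of U S r "c g"] R2(5) u cg
      by (simp add: group_hom_def group_hom_axioms_def U.is_group S.is_group)
    also have "\<dots> = \<one>\<^bsub>S\<^esub>" using sq2[OF g(1)] g w R2(7)[OF u(1)] by simp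
    finally obtain m where m: "m \<in> carrier M" "t m = inv\<^bsub>U\<^esub> c g \<otimes>\<^bsub>U\<^esub> u"
      using R2(11)[of "inv\<^bsub>U\<^esub> c g \<otimes>\<^bsub>U\<^esub> u"] cg u by auto
    have "\<omega> (t m) = inv\<^bsub>Q\<^esub> \<omega> (c g) \<otimes>\<^bsub>Q\<^esub> \<omega> u"
      using hom_mult[OF C2(5)] group_hom.hom_inv[of U Q \<omega> "c g"] C2(5) u cg m
      by (simp add: group_hom_def group_hom_axioms_def U.is_group Q.is_group)
    also have "\<dots> = y" using C2(10)[OF g(1)] C2(7)[OF u(1)] u by simp
    finally show ?thesis using sq3[OF m(1)] C1(7)[OF m(1)] by auto
  qed
qed


section \<open>Inner automorphisms\<close>

lemma conj_auto_app [simp]: "h \<in> carrier G \<Longrightarrow> conj_auto G g h = g \<otimes>\<^bsub>G\<^esub> h \<otimes>\<^bsub>G\<^esub> inv\<^bsub>G\<^esub> g"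
  by (simp add: conj_auto_def)

lemma (in group) conj_auto_hom: "conj_auto G \<in> hom G (AutoGroup G)"
proof -
  have cancel: "x \<otimes> (inv x \<otimes> y) = y" "inv x \<otimes> (x \<otimes> y) = y" if "x \<in> carrier G" "y \<in> carrier G" for x y
    using that by (simp_all add: m_assoc[symmetric])
  have a: "conj_auto G g \<in> auto G" if g: "g \<in> carrier G" for g
    unfolding conj_auto_def
  proof (rule restrict_auto)
    show "(\<lambda>h. g \<otimes> h \<otimes> inv g) \<in> hom G G"
      using g by (intro homI) (auto simp: m_assoc cancel)
    show "bij_betw (\<lambda>h. g \<otimes> h \<otimes> inv g) (carrier G) (carrier G)"
      using g by (intro bij_betw_byWitness[where f' = "\<lambda>h. inv g \<otimes> h \<otimes> g"])
        (auto simp: m_assoc cancel)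
  qed (rule is_group)
  show ?thesis
  proof (rule homI)
    fix g h assume "g \<in> carrier G" "h \<in> carrier G"
    then show "conj_auto G (g \<otimes> h) = conj_auto G g \<otimes>\<^bsub>AutoGroup G\<^esub> conj_auto G h"
      by (simp add: a, simp add: compose_def conj_auto_def inv_mult_group m_assoc cong: restrict_cong)
  qed (simp add: a)
qed

lemma (in group) conj_auto_auto [simp]: "g \<in> carrier G \<Longrightarrow> conj_auto G g \<in> auto G"
  using conj_auto_hom by (auto simp: hom_def)

lemma (in group) conj_auto_conj:
  assumes "\<phi> \<in> auto G" "g \<in> carrier G"
  shows "\<phi> \<otimes>\<^bsub>AutoGroup G\<^esub> conj_auto G g = conj_auto G (\<phi> g) \<otimes>\<^bsub>AutoGroup G\<^esub> \<phi>"
  using assms by (auto simp: compose_def auto_mult auto_inv intro!: restrict_ext)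

lemma (in group) Inn_normal: "Inn G \<lhd> AutoGroup G"
proof -
  interpret A: group "AutoGroup G" by (rule AutoGroup)
  interpret c: group_hom G "AutoGroup G" "conj_auto G" by unfold_locales (rule conj_auto_hom)
  have "\<phi> \<otimes>\<^bsub>AutoGroup G\<^esub> conj_auto G g \<otimes>\<^bsub>AutoGroup G\<^esub> inv\<^bsub>AutoGroup G\<^esub> \<phi> = conj_auto G (\<phi> g)"
    if "\<phi> \<in> auto G" "g \<in> carrier G" for \<phi> g
    using that conj_auto_conj[OF that] A.inv_solve_right'[of "conj_auto G (\<phi> g)"
       "\<phi> \<otimes>\<^bsub>AutoGroup G\<^esub> conj_auto G g" \<phi>] A.m_closed[of \<phi> "conj_auto G g"]
    by (simp del: mult_AutoGroup)
  then show ?thesis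
    unfolding A.normal_inv_iff Inn_def using c.img_is_subgroup by auto
qed

lemma (in group) group_Out: "group (Out G)"
  unfolding Out_def using Inn_normal normal.factorgroup_is_group by blast

text \<open>The kernel of \<open>g \<mapsto> conj_auto G g\<close> is the centre.\<close>

lemma (in group) ses_conj_auto:
  assumes centre: "\<And>z. z \<in> carrier G \<Longrightarrow> (\<And>g. g \<in> carrier G \<Longrightarrow> z \<otimes> g = g \<otimes> z) \<Longrightarrow> z = \<one>"
  shows "ses G (conj_auto G) (AutoGroup G) (out_class G) (Out G)"
proof -
  interpret A: group "AutoGroup G" by (rule AutoGroup)
  have "conj_auto G \<in> mon G (AutoGroup G)"
    unfolding mon_iff_hom_one[OF is_group A.is_group]
  proof (intro conjI conj_auto_hom allI impI, elim conjE)
    fix z assume z: "z \<in> carrier G" "conj_auto G z = \<one>\<^bsub>AutoGroup G\<^esub>"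
    show "z = \<one>"
    proof (rule centre)
      fix g assume g: "g \<in> carrier G"
      then have "z \<otimes> g \<otimes> inv z = g" using z conj_auto_app[OF g, of z] by simp
      then show "z \<otimes> g = g \<otimes> z" using inv_solve_right'[of g "z \<otimes> g" z] z g by auto
    qed fact
  qed
  then show ?thesis
    using ses_Mod[OF is_group A.is_group] Inn_normal
    unfolding Inn_def Out_def out_class_def by auto
qed

text \<open>The class of \<open>\<phi>\<close> consists of its composites with inner automorphisms from the left, as \<open>Out G\<close> is
  formed with right cosets of \<open>Inn G\<close>.\<close>

lemma (in group) out_class_eq_iff:
  assumes "\<phi> \<in> auto G" "\<psi> \<in> auto G"
  shows "out_class G \<phi> = out_class G \<psi> \<longleftrightarrow> (\<exists>g\<in>carrier G. \<phi> = conj_auto G g \<otimes>\<^bsub>AutoGroup G\<^esub> \<psi>)"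
proof -
  interpret A: group "AutoGroup G" by (rule AutoGroup)
  interpret I: normal "Inn G" "AutoGroup G" by (rule Inn_normal)
  have "out_class G \<phi> = out_class G \<psi> \<longleftrightarrow> \<phi> \<in> out_class G \<psi>"
    unfolding out_class_def using assms A.repr_independence[of \<phi> "Inn G" \<psi>]
      A.rcos_self[of \<phi> "Inn G"] I.subgroup_axioms by auto
  also have "\<dots> \<longleftrightarrow> (\<exists>g\<in>carrier G. \<phi> = conj_auto G g \<otimes>\<^bsub>AutoGroup G\<^esub> \<psi>)"
    unfolding out_class_def r_coset_def Inn_def by auto
  finally show ?thesis .
qed

lemma (in group) carrier_Out: "carrier (Out G) = out_class G ` auto G"
  by (simp add: Out_def out_class_def carrier_FactGroup)

lemma (in group) out_class_hom: "out_class G \<in> hom (AutoGroup G) (Out G)"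
  unfolding Out_def out_class_def by (rule normal.r_coset_hom_Mod[OF Inn_normal])


section \<open>Split extensions\<close>

lemma group_semidirect:
  assumes "group N" "group H" "\<theta> \<in> hom H (AutoGroup N)"
  shows "group (semidirect N H \<theta>)"
proof -
  interpret N: group N by fact
  interpret H: group H by fact
  have th: "\<theta> h \<in> auto N" if "h \<in> carrier H" for h
    using hom_in_carrier[OF assms(3) that] by simp
  have th_mult: "\<theta> (h \<otimes>\<^bsub>H\<^esub> k) a = \<theta> h (\<theta> k a)"
    if "h \<in> carrier H" "k \<in> carrier H" "a \<in> carrier N" for h k a
    using hom_mult[OF assms(3) that(1,2)] th that by (simp add: compose_def)
  have th_one: "\<theta> \<one>\<^bsub>H\<^esub> a = a" if "a \<in> carrier N" for a
    using hom_one[OF assms(3) assms(2) N.AutoGroup] that by simp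
  note [simp] = th th_mult th_one auto_mult
  show ?thesis
    unfolding semidirect_def
  proof (rule groupI; clarsimp simp: N.m_assoc H.m_assoc)
    fix a h assume "a \<in> carrier N" "h \<in> carrier H"
    then show "\<exists>b\<in>carrier N. \<exists>k\<in>carrier H. b \<otimes>\<^bsub>N\<^esub> \<theta> k a = \<one>\<^bsub>N\<^esub> \<and> k \<otimes>\<^bsub>H\<^esub> h = \<one>\<^bsub>H\<^esub>"
      by (intro bexI[of _ "inv\<^bsub>N\<^esub> \<theta> (inv\<^bsub>H\<^esub> h) a"] bexI[of _ "inv\<^bsub>H\<^esub> h"]) auto
  qed
qed

text \<open>An element \<open>x\<close> of \<open>E\<close> differs from \<open>s (p x)\<close> by an element of the kernel of \<open>p\<close>; this decomposes
  \<open>E\<close> uniquely into elements of \<open>N\<close> and of \<open>Q\<close>, and \<open>s q\<close> acts on \<open>N\<close> by conjugation.\<close>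

lemma split_extension:
  assumes e: "ses N i E p Q" and s: "s \<in> hom Q E" and ps: "\<And>q. q \<in> carrier Q \<Longrightarrow> p (s q) = q"
  defines "\<theta> \<equiv> \<lambda>q. \<lambda>f\<in>carrier N. inv_into (carrier N) i (s q \<otimes>\<^bsub>E\<^esub> i f \<otimes>\<^bsub>E\<^esub> inv\<^bsub>E\<^esub> (s q))"
  shows "\<theta> \<in> hom Q (AutoGroup N)" (is ?hom)
    and "(\<lambda>(f, q). i f \<otimes>\<^bsub>E\<^esub> s q) \<in> iso (semidirect N Q \<theta>) E" (is ?iso)
proof -
  note S = sesD[OF e]
  interpret N: group N by fact
  interpret E: group E by fact
  interpret Q: group Q by fact
  interpret i: group_hom N E i by unfold_locales (rule S)
  interpret p: group_hom E Q p by unfold_locales (rule S)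
  interpret s: group_hom Q E s by unfold_locales (rule s)
  have cancel: "x \<otimes>\<^bsub>E\<^esub> (inv\<^bsub>E\<^esub> x \<otimes>\<^bsub>E\<^esub> y) = y" "inv\<^bsub>E\<^esub> x \<otimes>\<^bsub>E\<^esub> (x \<otimes>\<^bsub>E\<^esub> y) = y"
    if "x \<in> carrier E" "y \<in> carrier E" for x y
    using that by (simp_all add: E.m_assoc[symmetric])
  have th: "\<theta> q f \<in> carrier N \<and> i (\<theta> q f) = s q \<otimes>\<^bsub>E\<^esub> i f \<otimes>\<^bsub>E\<^esub> inv\<^bsub>E\<^esub> s q"
    if "q \<in> carrier Q" "f \<in> carrier N" for q f
  proof -
    have "p (s q \<otimes>\<^bsub>E\<^esub> i f \<otimes>\<^bsub>E\<^esub> inv\<^bsub>E\<^esub> s q) = \<one>\<^bsub>Q\<^esub>" using that by (simp add: S(10) ps)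
    then have "s q \<otimes>\<^bsub>E\<^esub> i f \<otimes>\<^bsub>E\<^esub> inv\<^bsub>E\<^esub> s q \<in> i ` carrier N"
      using S(11)[of "s q \<otimes>\<^bsub>E\<^esub> i f \<otimes>\<^bsub>E\<^esub> inv\<^bsub>E\<^esub> s q"] that by force
    then show ?thesis
      using that by (simp add: \<theta>_def inv_into_into f_inv_into_f)
  qed
  have inj: "i x = i y \<longleftrightarrow> x = y" if "x \<in> carrier N" "y \<in> carrier N" for x y
    using S(8)[OF that] by auto
  have aut: "\<theta> q \<in> auto N" if q: "q \<in> carrier Q" for q
  proof -
    have "\<theta> q \<in> hom N N"
    proof (rule homI)
      fix x y assume "x \<in> carrier N" "y \<in> carrier N"
      then have "i (\<theta> q (x \<otimes>\<^bsub>N\<^esub> y)) = i (\<theta> q x \<otimes>\<^bsub>N\<^esub> \<theta> q y)"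
        using q by (simp add: th E.m_assoc cancel)
      then show "\<theta> q (x \<otimes>\<^bsub>N\<^esub> y) = \<theta> q x \<otimes>\<^bsub>N\<^esub> \<theta> q y"
        using inj[of "\<theta> q (x \<otimes>\<^bsub>N\<^esub> y)" "\<theta> q x \<otimes>\<^bsub>N\<^esub> \<theta> q y"] th[OF q]
          \<open>x \<in> carrier N\<close> \<open>y \<in> carrier N\<close> by (simp del: i.hom_mult)
    qed (use th q in blast)
    moreover have "bij_betw (\<theta> q) (carrier N) (carrier N)"
    proof (rule bij_betw_byWitness[where f' = "\<theta> (inv\<^bsub>Q\<^esub> q)"])
      have "i (\<theta> r (\<theta> q' f)) = i f"
        if "f \<in> carrier N" "r \<in> carrier Q" "q' \<in> carrier Q" "s r = inv\<^bsub>E\<^esub> s q'" for f r q'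
        using that th by (simp add: E.m_assoc cancel)
      then have *: "\<theta> r (\<theta> q' f) = f"
        if "f \<in> carrier N" "r \<in> carrier Q" "q' \<in> carrier Q" "s r = inv\<^bsub>E\<^esub> s q'" for f r q'
        using that inj[of "\<theta> r (\<theta> q' f)" f] th[of r "\<theta> q' f"] th[of q' f] by (simp del: s.hom_inv)
      show "\<forall>f\<in>carrier N. \<theta> (inv\<^bsub>Q\<^esub> q) (\<theta> q f) = f" "\<forall>f\<in>carrier N. \<theta> q (\<theta> (inv\<^bsub>Q\<^esub> q) f) = f"
        using q by (auto intro!: *)
      show "\<theta> q ` carrier N \<subseteq> carrier N" "\<theta> (inv\<^bsub>Q\<^esub> q) ` carrier N \<subseteq> carrier N"
        using th q by auto
    qed
    ultimately show ?thesis by (auto simp: auto_def Bij_def \<theta>_def)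
  qed
  show ?hom
  proof (rule homI)
    fix q r assume qr: "q \<in> carrier Q" "r \<in> carrier Q"
    have "i (\<theta> (q \<otimes>\<^bsub>Q\<^esub> r) f) = i (\<theta> q (\<theta> r f))" if "f \<in> carrier N" for f
      using th qr that by (simp add: E.m_assoc E.inv_mult_group)
    then have "\<theta> (q \<otimes>\<^bsub>Q\<^esub> r) f = \<theta> q (\<theta> r f)" if "f \<in> carrier N" for f
      using that S(8)[of "\<theta> (q \<otimes>\<^bsub>Q\<^esub> r) f" "\<theta> q (\<theta> r f)"] th qr by blast
    then show "\<theta> (q \<otimes>\<^bsub>Q\<^esub> r) = \<theta> q \<otimes>\<^bsub>AutoGroup N\<^esub> \<theta> r"
      using qr aut by (intro auto_eqI[of _ N]) (auto simp: compose_def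
         intro!: group.is_monoid[THEN monoid.m_closed, OF N.AutoGroup, of "\<theta> q" "\<theta> r", simplified])
  qed (use aut in simp)
  have grp: "group (semidirect N Q \<theta>)" by (rule group_semidirect) (use \<open>?hom\<close> in auto)
  show ?iso
    unfolding iso_kernel_image[OF grp E.is_group]
  proof (intro conjI)
    show "(\<lambda>(f, q). i f \<otimes>\<^bsub>E\<^esub> s q) \<in> hom (semidirect N Q \<theta>) E"
      by (rule homI) (auto simp: semidirect_def th E.m_assoc cancel)
    have "x = \<one>\<^bsub>N\<^esub> \<and> q = \<one>\<^bsub>Q\<^esub>"
      if "x \<in> carrier N" "q \<in> carrier Q" "i x \<otimes>\<^bsub>E\<^esub> s q = \<one>\<^bsub>E\<^esub>" for x q
    proof -
      have "p (i x \<otimes>\<^bsub>E\<^esub> s q) = q" using that(1,2) by (simp add: S(10) ps)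
      then have "q = \<one>\<^bsub>Q\<^esub>" using that by simp
      then show ?thesis using that inj[of x "\<one>\<^bsub>N\<^esub>"] by simp
    qed
    then show "kernel (semidirect N Q \<theta>) E (\<lambda>(f, q). i f \<otimes>\<^bsub>E\<^esub> s q) = {\<one>\<^bsub>semidirect N Q \<theta>\<^esub>}"
      by (auto simp: kernel_def semidirect_def)
    show "(\<lambda>(f, q). i f \<otimes>\<^bsub>E\<^esub> s q) ` carrier (semidirect N Q \<theta>) = carrier E"
    proof (intro equalityI subsetI)
      fix x assume x: "x \<in> carrier E"
      then have "p (x \<otimes>\<^bsub>E\<^esub> inv\<^bsub>E\<^esub> s (p x)) = \<one>\<^bsub>Q\<^esub>" by (simp add: ps)
      then obtain f where f: "f \<in> carrier N" "i f = x \<otimes>\<^bsub>E\<^esub> inv\<^bsub>E\<^esub> s (p x)"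
        using S(11)[of "x \<otimes>\<^bsub>E\<^esub> inv\<^bsub>E\<^esub> s (p x)"] x by auto
      then have "x = i f \<otimes>\<^bsub>E\<^esub> s (p x)" using x by (simp add: E.m_assoc)
      then show "x \<in> (\<lambda>(f, q). i f \<otimes>\<^bsub>E\<^esub> s q) ` carrier (semidirect N Q \<theta>)"
        using f x by (intro image_eqI[of _ _ "(f, p x)"]) (auto simp: semidirect_def)
    qed (auto simp: semidirect_def)
  qed
qed

lemma semidirect_transport:
  assumes "group N" "group N'" "group Q" "f \<in> iso N N'" "\<theta> \<in> hom Q (AutoGroup N)"
  defines "\<theta>' \<equiv> \<lambda>q. \<lambda>x\<in>carrier N'. f (\<theta> q (inv_into (carrier N) f x))"
  shows "\<theta>' \<in> hom Q (AutoGroup N')"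
    and "\<And>q x. x \<in> carrier N \<Longrightarrow> \<theta>' q (f x) = f (\<theta> q x)"
    and "map_prod f id \<in> iso (semidirect N Q \<theta>) (semidirect N' Q \<theta>')"
proof -
  have f: "f \<in> hom N N'" "inj_on f (carrier N)" "f ` carrier N = carrier N'"
    using assms(4) by (auto simp: iso_def bij_betw_def)
  have th: "\<theta> q \<in> auto N" if "q \<in> carrier Q" for q using hom_in_carrier[OF assms(5) that] by simp
  have fc: "f x \<in> carrier N'" if "x \<in> carrier N" for x using f that by auto
  show th': "\<theta>' q (f x) = f (\<theta> q x)" if "x \<in> carrier N" for q x
    using that f by (simp add: \<theta>'_def fc)
  have th_mult: "\<theta> (q \<otimes>\<^bsub>Q\<^esub> r) x = \<theta> q (\<theta> r x)" if "q \<in> carrier Q" "r \<in> carrier Q" "x \<in> carrier N" for q r x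
    using hom_mult[OF assms(5) that(1,2)] th that by (simp add: compose_def)
  have aut: "\<theta>' q \<in> auto N'" if q: "q \<in> carrier Q" for q
  proof -
    have b: "bij_betw (inv_into (carrier N) f) (carrier N') (carrier N)"
      using f by (intro bij_betw_inv_into) (simp add: bij_betw_def)
    have "bij_betw (f \<circ> (\<theta> q \<circ> inv_into (carrier N) f)) (carrier N') (carrier N')"
      using b auto_bij[OF th[OF q]] f by (intro bij_betw_trans) (auto simp: bij_betw_def)
    then have "bij_betw (\<theta>' q) (carrier N') (carrier N')"
      by (rule bij_betw_cong[THEN iffD1, rotated]) (simp add: \<theta>'_def)
    moreover have "\<theta>' q \<in> hom N' N'"
    proof (rule homI)
      fix x y assume "x \<in> carrier N'" "y \<in> carrier N'"
      then have "x \<in> f ` carrier N" "y \<in> f ` carrier N" using f(3) by simp_all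
      then obtain u v where uv: "u \<in> carrier N" "v \<in> carrier N" "x = f u" "y = f v" by blast
      then show "\<theta>' q (x \<otimes>\<^bsub>N'\<^esub> y) = \<theta>' q x \<otimes>\<^bsub>N'\<^esub> \<theta>' q y"
        using th[OF q] th'[of "u \<otimes>\<^bsub>N\<^esub> v"] th'[of u] th'[of v] assms(1)
        by (simp add: hom_mult[OF f(1), symmetric] auto_mult group.is_monoid monoid.m_closed)
      show "\<theta>' q x \<in> carrier N'" using uv th' fc th q by simp
    qed
    ultimately show ?thesis by (auto simp: auto_def Bij_def \<theta>'_def)
  qed
  show "\<theta>' \<in> hom Q (AutoGroup N')"
  proof (rule homI)
    fix q r assume qr: "q \<in> carrier Q" "r \<in> carrier Q"
    then have qrc: "q \<otimes>\<^bsub>Q\<^esub> r \<in> carrier Q" using assms(3) by (simp add: group.is_monoid monoid.m_closed)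
    have "\<theta>' q \<otimes>\<^bsub>AutoGroup N'\<^esub> \<theta>' r \<in> auto N'"
      using group.is_monoid[THEN monoid.m_closed, OF group.AutoGroup[OF assms(2)], of "\<theta>' q" "\<theta>' r"]
        aut qr by simp
    moreover have "\<theta>' (q \<otimes>\<^bsub>Q\<^esub> r) x = (\<theta>' q \<otimes>\<^bsub>AutoGroup N'\<^esub> \<theta>' r) x" if x: "x \<in> carrier N'" for x
    proof -
      have "x \<in> f ` carrier N" using f(3) x by simp
      then obtain u where u: "u \<in> carrier N" "x = f u" by blast
      then show ?thesis using qr aut x th by (simp add: compose_def th' th_mult)
    qed
    ultimately show "\<theta>' (q \<otimes>\<^bsub>Q\<^esub> r) = \<theta>' q \<otimes>\<^bsub>AutoGroup N'\<^esub> \<theta>' r"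
      using aut[OF qrc] by (intro auto_eqI[of _ N']) auto
  qed (use aut in simp)
  show "map_prod f id \<in> iso (semidirect N Q \<theta>) (semidirect N' Q \<theta>')"
  proof (rule isoI)
    show "map_prod f id \<in> hom (semidirect N Q \<theta>) (semidirect N' Q \<theta>')"
      by (rule homI) (auto simp: semidirect_def fc th' hom_mult[OF f(1)] th)
    show "bij_betw (map_prod f id) (carrier (semidirect N Q \<theta>)) (carrier (semidirect N' Q \<theta>'))"
      using f by (simp add: semidirect_def bij_betw_def map_prod_inj_on map_prod_surj_on)
  qed
qed


section \<open>Groups given by generators and relations\<close>

definition word_val :: "('b, 'c) monoid_scheme \<Rightarrow> ('a \<Rightarrow> 'b) \<Rightarrow> 'a word \<Rightarrow> 'b" where
  "word_val H f u = foldr (\<lambda>p y. (if snd p then f (fst p) else inv\<^bsub>H\<^esub> f (fst p)) \<otimes>\<^bsub>H\<^esub> y) u \<one>\<^bsub>H\<^esub>"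

lemma word_val_simps [simp]:
  "word_val H f [] = \<one>\<^bsub>H\<^esub>"
  "word_val H f ((x, True) # u) = f x \<otimes>\<^bsub>H\<^esub> word_val H f u"
  "word_val H f ((x, False) # u) = inv\<^bsub>H\<^esub> f x \<otimes>\<^bsub>H\<^esub> word_val H f u"
  by (simp_all add: word_val_def)

context group
begin

lemma word_val_closed [simp]:
  assumes "f \<in> S \<rightarrow> carrier G"
  shows "u \<in> words S \<Longrightarrow> word_val G f u \<in> carrier G"
proof (induction u)
  case (Cons p u)
  then show ?case using assms by (cases p; cases "snd p") auto
qed simp

lemma word_val_append:
  assumes "f \<in> S \<rightarrow> carrier G"
  shows "u \<in> words S \<Longrightarrow> v \<in> words S \<Longrightarrow> word_val G f (u @ v) = word_val G f u \<otimes> word_val G f v"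
proof (induction u)
  case (Cons p u)
  then show ?case using assms by (cases p; cases "snd p") (auto simp: m_assoc word_val_closed[OF assms] Pi_iff)
qed (simp add: word_val_closed[OF assms])

lemma word_val_cong:
  assumes f: "f \<in> S \<rightarrow> carrier G"
    and R: "\<And>l r. (l, r) \<in> R \<Longrightarrow> l \<in> words S \<Longrightarrow> r \<in> words S \<Longrightarrow> word_val G f l = word_val G f r"
  shows "(u, v) \<in> pres_cong S R \<Longrightarrow> word_val G f u = word_val G f v"
proof (induction rule: pres_cong.induct)
  case (cancel u v x b)
  then have "word_val G f ([(x, b), (x, \<not> b)]) = \<one>" using f by (cases b) (auto simp: Pi_iff)
  then show ?case
    using cancel word_val_append[OF f, of u "[(x, b), (x, \<not> b)] @ v"]
      word_val_append[OF f, of "[(x, b), (x, \<not> b)]" v] word_val_append[OF f, of u v]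
      word_val_closed[OF f] by (simp del: append_Cons append_Nil)
next
  case (relation u v l r)
  then show ?case using R[of l r] by (simp add: word_val_append[OF f])
qed auto

text \<open>The universal property of a presentation: evaluation of words is constant on classes.\<close>

lemma presented_group_hom_exists:
  assumes f: "f \<in> S \<rightarrow> carrier G"
    and R: "\<And>l r. (l, r) \<in> R \<Longrightarrow> l \<in> words S \<Longrightarrow> r \<in> words S \<Longrightarrow> word_val G f l = word_val G f r"
  shows "\<exists>\<phi>\<in>hom (presented_group S R) G. \<forall>x\<in>S. \<phi> (pres_gen S R x) = f x"
proof -
  let ?c = "\<lambda>u. pres_cong S R `` {u}"
  define \<phi> where "\<phi> P = the_elem (word_val G f ` P)" for P
  have \<phi>: "\<phi> (?c u) = word_val G f u" if "u \<in> words S" for u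
  proof -
    have "word_val G f ` ?c u = {word_val G f u}"
    proof (intro equalityI subsetI)
      fix y assume "y \<in> word_val G f ` ?c u"
      then obtain v where "(u, v) \<in> pres_cong S R" "y = word_val G f v" by blast
      then show "y \<in> {word_val G f u}" using word_val_cong[OF f, of R u v] R by simp
    qed (use pres_cong.refl[OF that, of R] in blast)
    then show ?thesis by (simp add: \<phi>_def)
  qed
  have car: "P \<in> carrier (presented_group S R) \<longleftrightarrow> (\<exists>u\<in>words S. P = ?c u)" for P
    by (auto simp: presented_group_def quotient_def)
  have "\<phi> \<in> hom (presented_group S R) G"
    by (rule homI) (auto simp: car \<phi> word_val_closed[OF f] presented_mult word_val_append[OF f])
  moreover have "\<phi> (pres_gen S R x) = f x" if "x \<in> S" for x
    using that f \<phi>[of "[(x, True)]"] by (auto simp: pres_gen_def Pi_iff)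
  ultimately show ?thesis by blast
qed

end

lemma pres_gen_closed [simp]: "x \<in> S \<Longrightarrow> pres_gen S R x \<in> carrier (presented_group S R)"
  by (auto simp: pres_gen_def presented_group_def quotient_def intro!: bexI[of _ "[(x, True)]"])

text \<open>This turns a relation between words into an equation between the generators, and it shows that
  the generators generate.\<close>

lemma pres_class_eq_word_val:
  "u \<in> words S \<Longrightarrow> pres_cong S R `` {u} = word_val (presented_group S R) (pres_gen S R) u"
proof (induction u)
  case Nil
  then show ?case by (simp add: presented_group_def)
next
  case (Cons p u)
  let ?G = "presented_group S R" and ?c = "\<lambda>u. pres_cong S R `` {u}"
  interpret group ?G by (rule group_presented_group)
  obtain x b where p: "p = (x, b)" by fastforce
  have x: "x \<in> S" and u: "u \<in> words S" using Cons.prems p by auto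
  have "?c [(x, False)] \<otimes>\<^bsub>?G\<^esub> ?c [(x, True)] = ?c ([] @ [(x, False), (x, \<not> False)] @ [])"
    using x by (simp add: presented_mult)
  also have "\<dots> = \<one>\<^bsub>?G\<^esub>"
    using x equiv_class_eq[OF equiv_pres_cong pres_cong.cancel[of "[]" S "[]" x False R]]
    by (simp add: presented_group_def)
  finally have "inv\<^bsub>?G\<^esub> pres_gen S R x = ?c [(x, False)]"
    using x by (intro inv_equality)
      (auto simp: pres_gen_def presented_group_def quotient_def intro!: bexI[of _ "[(x, _)]"])
  moreover have "?c (p # u) = ?c [p] \<otimes>\<^bsub>?G\<^esub> ?c u"
    using Cons.prems by (subst presented_mult) auto
  ultimately show ?case
    using Cons p by (cases b) (simp_all add: pres_gen_def)
qed

lemma presented_group_induct [consumes 1, case_names one gen inv]: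
  assumes "g \<in> carrier (presented_group S R)"
    and "P \<one>\<^bsub>presented_group S R\<^esub>"
    and "\<And>x g. x \<in> S \<Longrightarrow> g \<in> carrier (presented_group S R) \<Longrightarrow> P g \<Longrightarrow>
      P (pres_gen S R x \<otimes>\<^bsub>presented_group S R\<^esub> g)"
    and "\<And>x g. x \<in> S \<Longrightarrow> g \<in> carrier (presented_group S R) \<Longrightarrow> P g \<Longrightarrow>
      P (inv\<^bsub>presented_group S R\<^esub> pres_gen S R x \<otimes>\<^bsub>presented_group S R\<^esub> g)"
  shows "P g"
proof -
  interpret group "presented_group S R" by (rule group_presented_group)
  obtain u where u: "u \<in> words S" "g = word_val (presented_group S R) (pres_gen S R) u"
  proof -
    obtain u where "u \<in> words S" "g = pres_cong S R `` {u}"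
      using assms(1) unfolding presented_group_def quotient_def by auto
    then show ?thesis using that pres_class_eq_word_val by blast
  qed
  have "P (word_val (presented_group S R) (pres_gen S R) u)" using u(1)
  proof (induction u)
    case (Cons p u)
    obtain x b where "p = (x, b)" by fastforce
    then show ?case using Cons assms(3,4) word_val_closed[of "pres_gen S R" S u]
      by (cases b) auto
  qed (use assms in simp)
  then show ?thesis using u by simp
qed

section \<open>The group \<open>G\<close> and its affine representation\<close>

text \<open>Affine maps \<open>v \<mapsto> s v + b\<close> of \<open>\<int>\<^sup>\<nat>\<close> with a diagonal sign matrix \<open>s\<close>.  Sending \<open>x\<^sub>i\<close> to the map
  that fixes the \<open>i\<close>-th coordinate direction, inverts all others and translates by the \<open>i\<close>-th unit
  vector is a representation of \<open>G\<close> in which \<open>x\<^sub>i\<^sup>2\<close> is the translation by twice that vector.  It shows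
  that the squares are independent, and its linear part is the action on \<open>A\<close>.\<close>

definition affine :: "((nat \<Rightarrow> int) \<times> (nat \<Rightarrow> int)) monoid" where
  "affine = \<lparr>carrier = {(s, b). \<forall>j. s j * s j = 1},
    monoid.mult = (\<lambda>(s, b) (s', b'). (\<lambda>j. s j * s' j, \<lambda>j. b j + s j * b' j)),
    one = (\<lambda>_. 1, \<lambda>_. 0)\<rparr>"

lemma group_affine: "group affine"
proof (rule groupI)
  fix p assume "p \<in> carrier affine"
  then obtain s b where p: "p = (s, b)" "\<forall>j. s j * s j = 1" by (auto simp: affine_def)
  then show "\<exists>q\<in>carrier affine. q \<otimes>\<^bsub>affine\<^esub> p = \<one>\<^bsub>affine\<^esub>"
    by (intro bexI[of _ "(s, \<lambda>j. - s j * b j)"]) (auto simp: affine_def)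
next
  fix p q assume "p \<in> carrier affine" "q \<in> carrier affine"
  then show "p \<otimes>\<^bsub>affine\<^esub> q \<in> carrier affine"
    by (auto simp: affine_def) (metis mult.assoc mult.left_commute mult_1)
qed (auto simp: affine_def algebra_simps)

definition affine_gen :: "nat \<Rightarrow> (nat \<Rightarrow> int) \<times> (nat \<Rightarrow> int)" where
  "affine_gen i = (\<lambda>j. if j = i then 1 else -1, \<lambda>j. if j = i then 1 else 0)"

locale square_inversion =
  fixes n :: nat
begin

abbreviation "G \<equiv> grpG n"
abbreviation "A \<equiv> grpA n"
abbreviation "W \<equiv> grpW n"
abbreviation "xx \<equiv> gen n"
abbreviation G_mult (infixl "\<cdot>" 70) where "x \<cdot> y \<equiv> x \<otimes>\<^bsub>G\<^esub> y"
abbreviation W_mult (infixl "\<star>" 70) where "v \<star> w \<equiv> v \<otimes>\<^bsub>W\<^esub> w"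

sublocale G: group G
  unfolding grpG_def by (rule group_presented_group)

lemma gen_closed [simp]: "i < n \<Longrightarrow> xx i \<in> carrier G"
  by (simp add: gen_def grpG_def)

lemma G_induct [consumes 1, case_names one gen inv]:
  assumes "g \<in> carrier G" "P \<one>\<^bsub>G\<^esub>"
    and "\<And>i g. i < n \<Longrightarrow> g \<in> carrier G \<Longrightarrow> P g \<Longrightarrow> P (xx i \<cdot> g)"
    and "\<And>i g. i < n \<Longrightarrow> g \<in> carrier G \<Longrightarrow> P g \<Longrightarrow> P (inv\<^bsub>G\<^esub> xx i \<cdot> g)"
  shows "P g"
  using presented_group_induct[of g "{..<n}" "rels n" P] assms unfolding grpG_def gen_def by blast

lemma sq_eq: "i < n \<Longrightarrow> sq n i = xx i \<cdot> xx i"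
  by (simp add: sq_def numeral_2_eq_2)

lemma sq_closed [simp]: "i < n \<Longrightarrow> sq n i \<in> carrier G"
  by (simp add: sq_eq)

lemma gen_rel:
  assumes "i < n" "j < n" "i \<noteq> j"
  shows "inv\<^bsub>G\<^esub> xx i \<cdot> sq n j \<cdot> xx i = inv\<^bsub>G\<^esub> sq n j"
proof -
  let ?S = "{..<n}" and ?R = "rels n"
  let ?l = "[(i, False), (j, True), (j, True), (i, True)]" and ?r = "[(j, False), (j, False)]"
  have "(?l, ?r) \<in> ?R" unfolding rels_def using assms by blast
  then have "(?l, ?r) \<in> pres_cong ?S ?R"
    using pres_cong.relation[of "[]" ?S "[]" ?l ?r ?R] assms by simp
  then have "word_val G xx ?l = word_val G xx ?r"
    using pres_class_eq_word_val[of ?l ?S ?R] pres_class_eq_word_val[of ?r ?S ?R]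
      equiv_class_eq[OF equiv_pres_cong, of ?l ?r ?S ?R] assms
    by (simp add: grpG_def gen_def[abs_def])
  then show ?thesis using assms by (simp add: sq_eq G.m_assoc G.inv_mult_group)
qed

lemma G_hom_exists:
  assumes "group H" "\<And>i. i < n \<Longrightarrow> f i \<in> carrier H"
    and rel: "\<And>i j. i < n \<Longrightarrow> j < n \<Longrightarrow> i \<noteq> j \<Longrightarrow>
      inv\<^bsub>H\<^esub> f i \<otimes>\<^bsub>H\<^esub> (f j \<otimes>\<^bsub>H\<^esub> f j) \<otimes>\<^bsub>H\<^esub> f i = inv\<^bsub>H\<^esub> (f j \<otimes>\<^bsub>H\<^esub> f j)"
  shows "\<exists>\<phi>\<in>hom G H. \<forall>i<n. \<phi> (xx i) = f i"
proof -
  interpret H: group H by fact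
  have "\<exists>\<phi>\<in>hom (presented_group {..<n} (rels n)) H. \<forall>i\<in>{..<n}. \<phi> (pres_gen {..<n} (rels n) i) = f i"
  proof (rule H.presented_group_hom_exists)
    fix l r assume "(l, r) \<in> rels n"
    then obtain i j where ij: "i < n" "j < n" "i \<noteq> j"
      and lr: "l = [(i, False), (j, True), (j, True), (i, True)]" "r = [(j, False), (j, False)]"
      unfolding rels_def by blast
    then show "word_val H f l = word_val H f r"
      using rel[OF ij] assms(2)[OF ij(1)] assms(2)[OF ij(2)] by (simp add: H.m_assoc H.inv_mult_group)
  qed (use assms in auto)
  then show ?thesis unfolding grpG_def gen_def by auto
qed

lemma hom_eqI:
  assumes "group H" "\<phi> \<in> hom G H" "\<psi> \<in> hom G H" "\<And>i. i < n \<Longrightarrow> \<phi> (xx i) = \<psi> (xx i)" "g \<in> carrier G"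
  shows "\<phi> g = \<psi> g"
proof -
  interpret p: group_hom G H \<phi> using assms by (simp add: group_hom_def group_hom_axioms_def)
  interpret q: group_hom G H \<psi> using assms by (simp add: group_hom_def group_hom_axioms_def)
  show ?thesis using assms(5) by (induction rule: G_induct) (auto simp: assms(4))
qed

lemma affine_exists: "\<exists>\<phi>\<in>hom G affine. \<forall>i<n. \<phi> (xx i) = affine_gen i"
proof (rule G_hom_exists[OF group_affine])
  interpret group affine by (rule group_affine)
  show c: "affine_gen i \<in> carrier affine" for i by (auto simp: affine_gen_def affine_def)
  fix i j :: nat assume "i \<noteq> j"
  let ?y = "affine_gen j \<otimes>\<^bsub>affine\<^esub> affine_gen j"
  have y: "?y \<in> carrier affine" using c by simp
  have "?y \<otimes>\<^bsub>affine\<^esub> affine_gen i \<otimes>\<^bsub>affine\<^esub> ?y = affine_gen i"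
    using \<open>i \<noteq> j\<close> by (auto simp: affine_gen_def affine_def)
  then have "?y \<otimes>\<^bsub>affine\<^esub> affine_gen i = affine_gen i \<otimes>\<^bsub>affine\<^esub> inv\<^bsub>affine\<^esub> ?y"
    using c y inv_solve_right[of "?y \<otimes>\<^bsub>affine\<^esub> affine_gen i" "affine_gen i" ?y] by simp
  then show "inv\<^bsub>affine\<^esub> affine_gen i \<otimes>\<^bsub>affine\<^esub> ?y \<otimes>\<^bsub>affine\<^esub> affine_gen i = inv\<^bsub>affine\<^esub> ?y"
    using c y by (simp only: m_assoc inv_closed, simp add: m_assoc[symmetric])
qed

definition aff :: "G_elt \<Rightarrow> (nat \<Rightarrow> int) \<times> (nat \<Rightarrow> int)" where
  "aff = (SOME \<phi>. \<phi> \<in> hom G affine \<and> (\<forall>i<n. \<phi> (xx i) = affine_gen i))"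

definition sgn_of :: "G_elt \<Rightarrow> nat \<Rightarrow> int" where "sgn_of g = fst (aff g)"

definition trans_of :: "G_elt \<Rightarrow> nat \<Rightarrow> int" where "trans_of g = snd (aff g)"

lemma aff_hom: "aff \<in> hom G affine" and aff_gen: "i < n \<Longrightarrow> aff (xx i) = affine_gen i"
  using someI_ex[OF affine_exists[unfolded Bex_def]] unfolding aff_def by auto

lemma sgn_of_gen [simp]: "i < n \<Longrightarrow> sgn_of (xx i) j = (if j = i then 1 else -1)"
  and trans_of_gen [simp]: "i < n \<Longrightarrow> trans_of (xx i) j = (if j = i then 1 else 0)"
  by (simp_all add: sgn_of_def trans_of_def aff_gen affine_gen_def)

lemma sgn_of_mult [simp]:
    "g \<in> carrier G \<Longrightarrow> h \<in> carrier G \<Longrightarrow> sgn_of (g \<cdot> h) j = sgn_of g j * sgn_of h j"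
  and trans_of_mult [simp]: "g \<in> carrier G \<Longrightarrow> h \<in> carrier G \<Longrightarrow>
    trans_of (g \<cdot> h) j = trans_of g j + sgn_of g j * trans_of h j"
  using hom_mult[OF aff_hom, of g h]
  by (simp_all add: sgn_of_def trans_of_def affine_def split: prod.splits)

lemma sgn_of_one [simp]: "sgn_of \<one>\<^bsub>G\<^esub> j = 1" and trans_of_one [simp]: "trans_of \<one>\<^bsub>G\<^esub> j = 0"
  using hom_one[OF aff_hom G.is_group group_affine]
  by (simp_all add: sgn_of_def trans_of_def) (simp_all add: affine_def)

lemma sgn_of_square: "g \<in> carrier G \<Longrightarrow> sgn_of g j * sgn_of g j = 1"
  using hom_in_carrier[OF aff_hom, of g] by (auto simp: sgn_of_def affine_def)

lemma sgn_of_cases: "g \<in> carrier G \<Longrightarrow> sgn_of g j = 1 \<or> sgn_of g j = -1"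
  using sgn_of_square[of g j] by (auto simp: zmult_eq_1_iff)

lemma sgn_of_inv [simp]:
  assumes "g \<in> carrier G" shows "sgn_of (inv\<^bsub>G\<^esub> g) j = sgn_of g j"
proof -
  have "sgn_of (inv\<^bsub>G\<^esub> g) j * sgn_of g j = 1"
    using assms sgn_of_mult[of "inv\<^bsub>G\<^esub> g" g j] by simp
  then show ?thesis using sgn_of_cases[OF assms, of j] by auto
qed

lemma trans_of_inv [simp]:
  assumes "g \<in> carrier G" shows "trans_of (inv\<^bsub>G\<^esub> g) j = - sgn_of g j * trans_of g j"
  using assms trans_of_mult[of "inv\<^bsub>G\<^esub> g" g j] by simp


section \<open>The normal subgroup \<open>A\<close>\<close>

lemma conj_pow:
  assumes "g \<in> carrier G" "a \<in> carrier G"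
  shows "g \<cdot> a [^]\<^bsub>G\<^esub> (k::int) \<cdot> inv\<^bsub>G\<^esub> g = (g \<cdot> a \<cdot> inv\<^bsub>G\<^esub> g) [^]\<^bsub>G\<^esub> k"
proof -
  interpret c: group_hom G G "conj_auto G g"
    using assms(1) auto_hom[OF G.conj_auto_auto[OF assms(1)]] by unfold_locales
  show ?thesis using c.hom_int_pow[OF assms(2), of k] assms by simp
qed

lemma conj_conj:
  assumes "g \<in> carrier G" "h \<in> carrier G" "a \<in> carrier G"
  shows "(g \<cdot> h) \<cdot> a \<cdot> inv\<^bsub>G\<^esub> (g \<cdot> h) = g \<cdot> (h \<cdot> a \<cdot> inv\<^bsub>G\<^esub> h) \<cdot> inv\<^bsub>G\<^esub> g"
  using assms by (simp add: G.m_assoc G.inv_mult_group)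

lemma conj_gen_sq:
  assumes "i < n" "j < n"
  shows "xx i \<cdot> sq n j \<cdot> inv\<^bsub>G\<^esub> xx i = sq n j [^]\<^bsub>G\<^esub> sgn_of (xx i) j"
    and "inv\<^bsub>G\<^esub> xx i \<cdot> sq n j \<cdot> xx i = sq n j [^]\<^bsub>G\<^esub> sgn_of (xx i) j"
proof -
  show 1: "inv\<^bsub>G\<^esub> xx i \<cdot> sq n j \<cdot> xx i = sq n j [^]\<^bsub>G\<^esub> sgn_of (xx i) j"
  proof (cases "i = j")
    case True
    then show ?thesis using assms by (simp add: sq_eq G.m_assoc[symmetric])
  next
    case False
    then show ?thesis using assms gen_rel[OF assms False] by (simp add: G.int_pow_neg)
  qed
  show "xx i \<cdot> sq n j \<cdot> inv\<^bsub>G\<^esub> xx i = sq n j [^]\<^bsub>G\<^esub> sgn_of (xx i) j"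
  proof (cases "i = j")
    case True
    then show ?thesis using assms by (simp add: sq_eq G.m_assoc)
  next
    case False
    have "inv\<^bsub>G\<^esub> xx i \<cdot> inv\<^bsub>G\<^esub> sq n j \<cdot> xx i = inv\<^bsub>G\<^esub> (inv\<^bsub>G\<^esub> xx i \<cdot> sq n j \<cdot> xx i)"
      using assms by (simp add: G.inv_mult_group G.m_assoc)
    also have "\<dots> = sq n j" using assms gen_rel[OF assms False] by simp
    finally have "xx i \<cdot> sq n j \<cdot> inv\<^bsub>G\<^esub> xx i
        = xx i \<cdot> (inv\<^bsub>G\<^esub> xx i \<cdot> inv\<^bsub>G\<^esub> sq n j \<cdot> xx i) \<cdot> inv\<^bsub>G\<^esub> xx i" by simp
    also have "\<dots> = inv\<^bsub>G\<^esub> sq n j"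
      using assms by (simp only: G.m_assoc[symmetric] gen_closed sq_closed G.inv_closed
          G.m_closed G.r_inv G.l_one) (simp add: G.m_assoc)
    finally show ?thesis using assms False by (simp add: G.int_pow_neg)
  qed
qed

text \<open>The defining relations state this for the generators; as both sides are multiplicative in \<open>g\<close>, the
  exponent is the linear part of the affine representation.\<close>

lemma conj_sq:
  assumes "g \<in> carrier G" "j < n"
  shows "g \<cdot> sq n j \<cdot> inv\<^bsub>G\<^esub> g = sq n j [^]\<^bsub>G\<^esub> sgn_of g j"
  using assms(1)
proof (induction rule: G_induct)
  case one
  then show ?case using assms by simp
next
  case (gen i g)
  have "xx i \<cdot> sq n j [^]\<^bsub>G\<^esub> sgn_of g j \<cdot> inv\<^bsub>G\<^esub> xx i = (sq n j [^]\<^bsub>G\<^esub> sgn_of (xx i) j) [^]\<^bsub>G\<^esub> sgn_of g j"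
    using conj_pow[of "xx i" "sq n j" "sgn_of g j"] conj_gen_sq(1)[OF gen(1) assms(2)] gen(1) assms(2)
    by simp
  then show ?case
    unfolding conj_conj[OF gen_closed[OF gen(1)] gen(2) sq_closed[OF assms(2)]] gen(3)
    using gen assms(2) by (simp only: G.int_pow_pow sq_closed sgn_of_mult gen_closed)
next
  case (inv i g)
  have "inv\<^bsub>G\<^esub> xx i \<cdot> sq n j [^]\<^bsub>G\<^esub> sgn_of g j \<cdot> inv\<^bsub>G\<^esub> (inv\<^bsub>G\<^esub> xx i)
      = (inv\<^bsub>G\<^esub> xx i \<cdot> sq n j \<cdot> inv\<^bsub>G\<^esub> (inv\<^bsub>G\<^esub> xx i)) [^]\<^bsub>G\<^esub> sgn_of g j"
    using conj_pow[of "inv\<^bsub>G\<^esub> xx i" "sq n j" "sgn_of g j"] inv assms by simp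
  also have "\<dots> = (sq n j [^]\<^bsub>G\<^esub> sgn_of (xx i) j) [^]\<^bsub>G\<^esub> sgn_of g j"
    using conj_gen_sq(2)[OF inv(1) assms(2)] inv(1) by simp
  finally show ?case
    unfolding conj_conj[OF G.inv_closed[OF gen_closed[OF inv(1)]] inv(2) sq_closed[OF assms(2)]] inv(3)
    using inv assms(2) by (simp only: G.int_pow_pow sq_closed sgn_of_mult gen_closed sgn_of_inv G.inv_closed)
qed

lemma sq_mem [simp]: "i < n \<Longrightarrow> sq n i \<in> setA n"
  unfolding setA_def by (auto intro: generate.incl)

lemma subgroup_A: "subgroup (setA n) G"
  unfolding setA_def by (rule G.generate_is_subgroup) auto

sublocale A_sub: subgroup "setA n" G by (rule subgroup_A)

lemma A_closed: "a \<in> setA n \<Longrightarrow> a \<in> carrier G" by (rule A_sub.mem_carrier)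

lemma sq_pow_mem: "i < n \<Longrightarrow> sq n i [^]\<^bsub>G\<^esub> (k::int) \<in> setA n"
  using G.subgroup_int_pow_closed[OF subgroup_A] by simp

lemma A_induct [consumes 1, case_names one sq inv mult]:
  assumes "a \<in> setA n" "P \<one>\<^bsub>G\<^esub>" "\<And>i. i < n \<Longrightarrow> P (sq n i)" "\<And>i. i < n \<Longrightarrow> P (inv\<^bsub>G\<^esub> sq n i)"
    "\<And>a b. a \<in> setA n \<Longrightarrow> b \<in> setA n \<Longrightarrow> P a \<Longrightarrow> P b \<Longrightarrow> P (a \<cdot> b)"
  shows "P a"
  using assms(1) unfolding setA_def
proof (induction rule: generate.induct)
  case (eng h1 h2)
  then show ?case using assms(5) unfolding setA_def by blast
qed (use assms in auto)

lemma A_normal: "setA n \<lhd> G"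
  unfolding G.normal_inv_iff
proof (intro conjI ballI subgroup_A)
  fix g a assume g: "g \<in> carrier G" and "a \<in> setA n"
  from this(2) have c: "conj_auto G g a \<in> setA n"
  proof (induction rule: A_induct)
    case one
    then show ?case using g by simp
  next
    case (sq i)
    then show ?case using g by (simp add: conj_sq sq_pow_mem)
  next
    case (inv i)
    have "conj_auto G g (inv\<^bsub>G\<^esub> sq n i) = inv\<^bsub>G\<^esub> conj_auto G g (sq n i)"
      by (rule auto_inv[OF G.is_group G.conj_auto_auto[OF g] sq_closed[OF inv]])
    then show ?case using inv g by (simp add: conj_sq sq_pow_mem)
  next
    case (mult a b)
    have "conj_auto G g (a \<cdot> b) = conj_auto G g a \<cdot> conj_auto G g b"
      by (rule auto_mult[OF G.conj_auto_auto[OF g] A_closed[OF mult(1)] A_closed[OF mult(2)]])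
    then show ?case using mult by simp
  qed
  then show "g \<cdot> a \<cdot> inv\<^bsub>G\<^esub> g \<in> setA n" using A_closed[OF \<open>a \<in> setA n\<close>] by simp
qed

sublocale A_nor: normal "setA n" G by (rule A_normal)

lemma conj_mem: "g \<in> carrier G \<Longrightarrow> a \<in> setA n \<Longrightarrow> g \<cdot> a \<cdot> inv\<^bsub>G\<^esub> g \<in> setA n"
  using A_nor.inv_op_closed2 by blast

lemma sgn_of_A [simp]: "a \<in> setA n \<Longrightarrow> sgn_of a j = 1"
  by (induction rule: A_induct) (auto simp: sq_eq A_closed)

text \<open>Elements of \<open>A\<close> have trivial linear part, so by \<open>conj_sq\<close> they commute with the squares of the
  generators.\<close>

lemma A_commute:
  assumes "a \<in> setA n" "b \<in> setA n" shows "a \<cdot> b = b \<cdot> a"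
proof -
  note a = A_closed[OF assms(1)]
  have sq: "a \<cdot> sq n i = sq n i \<cdot> a" if "i < n" for i
    using conj_sq[OF a that] assms that a G.inv_solve_right'[of "sq n i" "a \<cdot> sq n i" a] by simp
  show ?thesis using assms(2)
  proof (induction rule: A_induct)
    case (inv i)
    have "sq n i \<cdot> (a \<cdot> inv\<^bsub>G\<^esub> sq n i) = a \<cdot> sq n i \<cdot> inv\<^bsub>G\<^esub> sq n i"
      using inv a by (simp add: G.m_assoc[symmetric] sq[OF inv])
    also have "\<dots> = a" using inv a by (simp add: G.m_assoc)
    finally have "inv\<^bsub>G\<^esub> sq n i \<cdot> a = a \<cdot> inv\<^bsub>G\<^esub> sq n i"
      using inv a G.inv_solve_left[of "a \<cdot> inv\<^bsub>G\<^esub> sq n i" "sq n i" a] by simp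
    then show ?case ..
  next
    case (mult b c)
    then show ?case using a A_closed by (metis G.m_assoc)
  qed (use a sq in auto)
qed

lemma carrier_A [simp]: "carrier A = setA n"
  and mult_A [simp]: "x \<otimes>\<^bsub>A\<^esub> y = x \<cdot> y"
  and one_A [simp]: "\<one>\<^bsub>A\<^esub> = \<one>\<^bsub>G\<^esub>"
  by (simp_all add: grpA_def)

lemma comm_group_A: "comm_group A"
proof (rule group.group_comm_groupI)
  show "group A" unfolding grpA_def by (rule A_sub.subgroup_is_group) (rule G.is_group)
qed (simp add: A_commute)

sublocale A: comm_group A by (rule comm_group_A)

lemma inv_A [simp]: "a \<in> setA n \<Longrightarrow> inv\<^bsub>A\<^esub> a = inv\<^bsub>G\<^esub> a"
  unfolding grpA_def by (rule G.m_inv_consistent[OF subgroup_A])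


section \<open>Coordinates on \<open>A\<close>\<close>

lemma A_elt_induct_set:
  assumes "Q {} \<one>\<^bsub>G\<^esub>"
    and "\<And>j S a. j < n \<Longrightarrow> a \<in> setA n \<Longrightarrow> j \<notin> S \<Longrightarrow> Q S a \<Longrightarrow> Q (insert j S) (sq n j [^]\<^bsub>G\<^esub> (e j :: int) \<cdot> a)"
  shows "Q {..<n} (A_elt n e)"
proof -
  have "finprod A (\<lambda>j. sq n j [^]\<^bsub>G\<^esub> e j) S \<in> setA n \<and> Q S (finprod A (\<lambda>j. sq n j [^]\<^bsub>G\<^esub> e j) S)"
    if "finite S" "S \<subseteq> {..<n}" for S using that
  proof (induction rule: finite_induct)
    case (insert j S)
    have "finprod A (\<lambda>j. sq n j [^]\<^bsub>G\<^esub> e j) (insert j S)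
      = sq n j [^]\<^bsub>G\<^esub> e j \<otimes>\<^bsub>A\<^esub> finprod A (\<lambda>j. sq n j [^]\<^bsub>G\<^esub> e j) S"
      using insert by (intro A.finprod_insert) (auto intro: sq_pow_mem)
    then show ?case using insert assms sq_pow_mem[of j "e j"] by auto
  qed (use assms in auto)
  then show ?thesis unfolding A_elt_def by simp
qed

lemma A_elt_mem [simp]: "A_elt n e \<in> setA n"
  unfolding A_elt_def using A.finprod_closed[of "\<lambda>j. sq n j [^]\<^bsub>G\<^esub> e j" "{..<n}"]
  by (auto intro: sq_pow_mem)

lemma A_elt_closed [simp]: "A_elt n e \<in> carrier G"
  by (rule A_closed) simp

lemma A_elt_cong: "(\<And>j. j < n \<Longrightarrow> e j = f j) \<Longrightarrow> A_elt n e = A_elt n f"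
  unfolding A_elt_def by (intro A.finprod_cong) (auto simp: simp_implies_def intro: sq_pow_mem)

lemma A_elt_add: "A_elt n e \<cdot> A_elt n f = A_elt n (\<lambda>j. e j + f j)"
proof -
  have "A_elt n e \<otimes>\<^bsub>A\<^esub> A_elt n f = finprod A (\<lambda>j. sq n j [^]\<^bsub>G\<^esub> e j \<otimes>\<^bsub>A\<^esub> sq n j [^]\<^bsub>G\<^esub> f j) {..<n}"
    unfolding A_elt_def by (intro A.finprod_multf[symmetric]) (auto intro: sq_pow_mem)
  also have "\<dots> = A_elt n (\<lambda>j. e j + f j)"
    unfolding A_elt_def by (intro A.finprod_cong) (auto simp: simp_implies_def G.int_pow_mult intro: sq_pow_mem)
  finally show ?thesis by simp
qed

lemma A_elt_zero [simp]: "A_elt n (\<lambda>_. 0) = \<one>\<^bsub>G\<^esub>"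
  using A_elt_add[of "\<lambda>_. 0" "\<lambda>_. 0"] by simp

lemma A_elt_inv: "inv\<^bsub>G\<^esub> A_elt n e = A_elt n (\<lambda>j. - e j)"
  using A_elt_add[of "\<lambda>j. - e j" e] by (intro G.inv_equality) auto

lemma A_elt_unit: "i < n \<Longrightarrow> A_elt n (\<lambda>j. if j = i then k else 0) = sq n i [^]\<^bsub>G\<^esub> k"
proof -
  assume i: "i < n"
  have "A_elt n (\<lambda>j. if j = i then k else 0) = finprod A (\<lambda>j. if i = j then sq n j [^]\<^bsub>G\<^esub> k else \<one>\<^bsub>A\<^esub>) {..<n}"
    unfolding A_elt_def using i
    by (intro A.finprod_cong) (auto simp: simp_implies_def intro: sq_pow_mem)
  also have "\<dots> = sq n i [^]\<^bsub>G\<^esub> k"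
    using i by (intro A.finprod_singleton) (auto intro: sq_pow_mem)
  finally show ?thesis .
qed

lemma A_elt_exists:
  assumes "a \<in> setA n" obtains e where "a = A_elt n e"
proof -
  have "\<exists>e. a = A_elt n e" using assms
  proof (induction rule: A_induct)
    case one
    show ?case using A_elt_zero by metis
  next
    case (sq i)
    then have "sq n i = A_elt n (\<lambda>j. if j = i then 1 else 0)" by (subst A_elt_unit) auto
    then show ?case by blast
  next
    case (inv i)
    then have "inv\<^bsub>G\<^esub> sq n i = A_elt n (\<lambda>j. if j = i then -1 else 0)"
      by (subst A_elt_unit) (auto simp: G.int_pow_neg)
    then show ?case by blast
  next
    case (mult a b)
    then show ?case using A_elt_add by metis
  qed
  then show ?thesis using that by blast
qed

lemma trans_of_sq: "i < n \<Longrightarrow> trans_of (sq n i) j = (if j = i then 2 else 0)"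
  by (simp add: sq_eq)

lemma sgn_of_sq_pow: "i < n \<Longrightarrow> sgn_of (sq n i [^]\<^bsub>G\<^esub> (m::nat)) j = 1"
  by (induction m) auto

lemma trans_of_sq_pow: "i < n \<Longrightarrow> trans_of (sq n i [^]\<^bsub>G\<^esub> (k::int)) j = (if j = i then 2 * k else 0)"
proof -
  assume i: "i < n"
  have nat: "trans_of (sq n i [^]\<^bsub>G\<^esub> (m::nat)) j = (if j = i then 2 * int m else 0)" for m
    using i by (induction m) (auto simp: sgn_of_sq_pow trans_of_sq)
  show ?thesis
  proof (cases "k \<ge> 0")
    case True
    then have "sq n i [^]\<^bsub>G\<^esub> k = sq n i [^]\<^bsub>G\<^esub> nat k" using int_pow_int[of G "sq n i" "nat k"] by simp
    then show ?thesis using nat[of "nat k"] True by simp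
  next
    case False
    then have "sq n i [^]\<^bsub>G\<^esub> k = inv\<^bsub>G\<^esub> (sq n i [^]\<^bsub>G\<^esub> nat (- k))"
      using G.int_pow_neg_int[of "sq n i" "nat (- k)"] i by simp
    then show ?thesis using nat[of "nat (- k)"] i False sgn_of_A[OF sq_pow_mem[of i "- k"]]
      by simp
  qed
qed

lemma trans_of_A_elt: "j < n \<Longrightarrow> trans_of (A_elt n e) j = 2 * e j"
proof -
  assume j: "j < n"
  have "trans_of (A_elt n e) j = (if j \<in> {..<n} then 2 * e j else 0)"
    by (rule A_elt_induct_set[where Q = "\<lambda>S a. trans_of a j = (if j \<in> S then 2 * e j else 0)"])
      (auto simp: trans_of_sq_pow A_closed sq_pow_mem)

  then show ?thesis using j by simp
qed

text \<open>The coordinates are recovered from the translation part, which is \<open>2 e\<close>.\<close>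

lemma A_elt_eq_iff: "A_elt n e = A_elt n f \<longleftrightarrow> (\<forall>j<n. e j = f j)"
  using trans_of_A_elt[of _ e] trans_of_A_elt[of _ f] A_elt_cong[of e f] by fastforce

lemma conj_A_elt:
  assumes "g \<in> carrier G"
  shows "g \<cdot> A_elt n e \<cdot> inv\<^bsub>G\<^esub> g = A_elt n (\<lambda>j. sgn_of g j * e j)"
proof -
  interpret c: group_hom G G "conj_auto G g"
    using auto_hom[OF G.conj_auto_auto[OF assms]] by unfold_locales
  have c: "conj_auto G g a \<in> setA n" if "a \<in> setA n" for a
    using conj_mem[OF assms that] A_closed[OF that] by simp
  have "conj_auto G g (finprod A (\<lambda>j. sq n j [^]\<^bsub>G\<^esub> e j) S) = finprod A (\<lambda>j. sq n j [^]\<^bsub>G\<^esub> (sgn_of g j * e j)) S"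
    if "finite S" "S \<subseteq> {..<n}" for S using that
  proof (induction rule: finite_induct)
    case empty
    then show ?case using c.hom_one by simp
  next
    case (insert j S)
    let ?p = "finprod A (\<lambda>j. sq n j [^]\<^bsub>G\<^esub> e j) S"
    have j: "j < n" using insert by auto
    have p: "?p \<in> setA n" using A.finprod_closed[of "\<lambda>j. sq n j [^]\<^bsub>G\<^esub> e j" S] insert by (auto intro: sq_pow_mem)
    have "conj_auto G g (sq n j [^]\<^bsub>G\<^esub> e j) = (g \<cdot> sq n j \<cdot> inv\<^bsub>G\<^esub> g) [^]\<^bsub>G\<^esub> e j"
      using conj_pow[OF assms sq_closed[OF j]] j by simp
    then have s: "conj_auto G g (sq n j [^]\<^bsub>G\<^esub> e j) = sq n j [^]\<^bsub>G\<^esub> (sgn_of g j * e j)"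
      using conj_sq[OF assms j] j G.int_pow_pow by simp
    have "finprod A (\<lambda>j. sq n j [^]\<^bsub>G\<^esub> e j) (insert j S) = sq n j [^]\<^bsub>G\<^esub> e j \<otimes>\<^bsub>A\<^esub> ?p"
      using insert by (intro A.finprod_insert) (auto intro: sq_pow_mem)
    moreover have "finprod A (\<lambda>j. sq n j [^]\<^bsub>G\<^esub> (sgn_of g j * e j)) (insert j S)
       = sq n j [^]\<^bsub>G\<^esub> (sgn_of g j * e j) \<otimes>\<^bsub>A\<^esub> finprod A (\<lambda>j. sq n j [^]\<^bsub>G\<^esub> (sgn_of g j * e j)) S"
      using insert by (intro A.finprod_insert) (auto intro: sq_pow_mem)
    ultimately show ?case
      using insert s j A_closed[OF p] c.hom_mult[of "sq n j [^]\<^bsub>G\<^esub> e j" ?p] by (simp del: conj_auto_app)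
  qed
  from this[of "{..<n}"] show ?thesis unfolding A_elt_def[symmetric] by simp
qed

end

section \<open>Reduced words in \<open>W\<close>\<close>

context square_inversion
begin

abbreviation "q \<equiv> G_to_W n"

definition wgen :: "nat \<Rightarrow> G_elt set" where "wgen i = q (xx i)"

sublocale W: group W
  unfolding grpW_def by (rule A_nor.factorgroup_is_group)

lemma q_hom: "q \<in> hom G W"
  unfolding grpW_def G_to_W_def by (rule A_nor.r_coset_hom_Mod)

sublocale q: group_hom G W q
  by unfold_locales (rule q_hom)

lemma carrier_W: "carrier W = q ` carrier G"
  by (simp add: grpW_def G_to_W_def carrier_FactGroup)

lemma W_lift: assumes "w \<in> carrier W" obtains g where "g \<in> carrier G" "w = q g"
  using assms carrier_W by auto

lemma q_eq_one_iff: "g \<in> carrier G \<Longrightarrow> q g = \<one>\<^bsub>W\<^esub> \<longleftrightarrow> g \<in> setA n"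
  unfolding G_to_W_def grpW_def using coset_eq_self_iff[OF G.is_group subgroup_A] by simp

lemma q_A [simp]: "a \<in> setA n \<Longrightarrow> q a = \<one>\<^bsub>W\<^esub>"
  using q_eq_one_iff A_closed by blast

lemma q_eqE:
  assumes "g \<in> carrier G" "h \<in> carrier G" "q g = q h"
  obtains a where "a \<in> setA n" "g = h \<cdot> a"
proof
  have "q (inv\<^bsub>G\<^esub> h \<cdot> g) = \<one>\<^bsub>W\<^esub>" using assms by simp
  then show "inv\<^bsub>G\<^esub> h \<cdot> g \<in> setA n" using q_eq_one_iff[of "inv\<^bsub>G\<^esub> h \<cdot> g"] assms(1,2) by blast
  show "g = h \<cdot> (inv\<^bsub>G\<^esub> h \<cdot> g)" using assms by (simp add: G.m_assoc[symmetric])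
qed

lemma wgen_closed [simp]: "i < n \<Longrightarrow> wgen i \<in> carrier W"
  by (simp add: wgen_def)

lemma wgen_square [simp]: "i < n \<Longrightarrow> wgen i \<star> wgen i = \<one>\<^bsub>W\<^esub>"
  unfolding wgen_def using q.hom_mult[of "xx i" "xx i"] by (simp add: sq_eq[symmetric])

lemma wgen_inv [simp]: "i < n \<Longrightarrow> inv\<^bsub>W\<^esub> wgen i = wgen i"
  by (rule W.inv_equality) auto

lemma wgen_cancel [simp]: "i < n \<Longrightarrow> w \<in> carrier W \<Longrightarrow> wgen i \<star> (wgen i \<star> w) = w"
  by (simp add: W.m_assoc[symmetric])

definition reduced :: "nat list \<Rightarrow> bool" where
  "reduced u \<longleftrightarrow> set u \<subseteq> {..<n} \<and> distinct_adj u"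

definition wprod :: "nat list \<Rightarrow> G_elt set" where
  "wprod u = foldr (\<lambda>i w. wgen i \<star> w) u \<one>\<^bsub>W\<^esub>"

lemma wprod_simps [simp]: "wprod [] = \<one>\<^bsub>W\<^esub>" "wprod (i # u) = wgen i \<star> wprod u"
  by (simp_all add: wprod_def)

lemma wprod_closed [simp]: "set u \<subseteq> {..<n} \<Longrightarrow> wprod u \<in> carrier W"
  by (induction u) auto

lemma wprod_append: "set u \<subseteq> {..<n} \<Longrightarrow> set v \<subseteq> {..<n} \<Longrightarrow> wprod (u @ v) = wprod u \<star> wprod v"
  by (induction u) (auto simp: W.m_assoc)

text \<open>Multiplication by \<open>x\<^sub>i\<close> on the left, as it acts on reduced words.\<close>

definition toggle :: "nat \<Rightarrow> nat list \<Rightarrow> nat list" where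
  "toggle i u = (if u \<noteq> [] \<and> hd u = i then tl u else i # u)"

lemma reduced_simps [simp]: "reduced []"
  "reduced (i # u) \<longleftrightarrow> i < n \<and> reduced u \<and> (u = [] \<or> hd u \<noteq> i)"
  unfolding reduced_def by (cases u; auto)+

lemma toggle_reduced: "i < n \<Longrightarrow> reduced u \<Longrightarrow> reduced (toggle i u)"
  unfolding toggle_def by (cases u) auto

lemma toggle_toggle: "reduced u \<Longrightarrow> toggle i (toggle i u) = u"
  unfolding toggle_def by (cases u) auto

lemma wprod_toggle: "i < n \<Longrightarrow> reduced u \<Longrightarrow> wprod (toggle i u) = wgen i \<star> wprod u"
  unfolding toggle_def by (cases u) (auto simp: reduced_def)

lemma W_reduced:
  assumes "w \<in> carrier W" obtains u where "reduced u" "w = wprod u"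
proof -
  obtain g where g: "g \<in> carrier G" "w = q g" using assms by (rule W_lift)
  have "\<exists>u. reduced u \<and> q g = wprod u" using g(1)
  proof (induction rule: G_induct)
    case one
    show ?case by (intro exI[of _ "[]"]) simp
  next
    case (gen i g)
    then obtain u where "reduced u" "q g = wprod u" by blast
    then show ?case using gen
      by (intro exI[of _ "toggle i u"]) (simp add: toggle_reduced wprod_toggle wgen_def)
  next
    case (inv i g)
    then obtain u where "reduced u" "q g = wprod u" by blast
    moreover have "inv\<^bsub>W\<^esub> q (xx i) = wgen i" using wgen_inv[OF inv(1)] by (simp add: wgen_def)
    ultimately show ?case using inv
      by (intro exI[of _ "toggle i u"]) (simp add: toggle_reduced wprod_toggle)
  qed
  then show ?thesis using that g by blast
qed

lemma toggle_action:
  obtains \<tau> where "\<tau> \<in> hom G (BijGroup (Collect reduced))"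
    "\<And>i u. i < n \<Longrightarrow> reduced u \<Longrightarrow> \<tau> (xx i) u = toggle i u"
proof -
  let ?R = "Collect reduced" and ?T = "\<lambda>i. \<lambda>u\<in>Collect reduced. toggle i u"
  interpret B: group "BijGroup ?R" by (rule group_BijGroup)
  have T: "?T i \<in> Bij ?R" if "i < n" for i
    using that unfolding Bij_def
    by (auto intro!: bij_betw_byWitness[where f' = "toggle i"] simp: toggle_reduced toggle_toggle)
  have sq: "?T i \<otimes>\<^bsub>BijGroup ?R\<^esub> ?T i = \<one>\<^bsub>BijGroup ?R\<^esub>" if "i < n" for i
  proof -
    have "?T i \<otimes>\<^bsub>BijGroup ?R\<^esub> ?T i = compose ?R (?T i) (?T i)"
      using T[OF that] by (simp add: BijGroup_def)
    then show ?thesis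
      using that by (auto simp: BijGroup_def compose_def toggle_reduced toggle_toggle intro!: restrict_ext)
  qed
  have Tc: "?T i \<in> carrier (BijGroup ?R)" if "i < n" for i
    using T[OF that] by (simp add: BijGroup_def)
  have "\<exists>\<phi>\<in>hom G (BijGroup ?R). \<forall>i<n. \<phi> (xx i) = ?T i"
  proof (rule G_hom_exists[OF B.is_group Tc])
    fix i j assume ij: "i < n" "j < n"
    show "inv\<^bsub>BijGroup ?R\<^esub> ?T i \<otimes>\<^bsub>BijGroup ?R\<^esub> (?T j \<otimes>\<^bsub>BijGroup ?R\<^esub> ?T j) \<otimes>\<^bsub>BijGroup ?R\<^esub> ?T i
      = inv\<^bsub>BijGroup ?R\<^esub> (?T j \<otimes>\<^bsub>BijGroup ?R\<^esub> ?T j)"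
      unfolding sq[OF ij(2)] using Tc[OF ij(1)] by simp
  qed
  then obtain \<phi> where "\<phi> \<in> hom G (BijGroup ?R)" "\<forall>i<n. \<phi> (xx i) = ?T i" by blast
  then show ?thesis using that by simp
qed

text \<open>In the action of \<open>G\<close> by \<open>toggle\<close>, the subgroup \<open>A\<close> acts trivially and a product of generators
  spelling the reduced word \<open>u\<close> maps the empty word to \<open>u\<close>.\<close>

lemma wprod_inj:
  assumes "reduced u" "reduced v" "wprod u = wprod v"
  shows "u = v"
proof -
  let ?R = "Collect reduced"
  obtain \<tau> where \<tau>: "\<tau> \<in> hom G (BijGroup ?R)" and x: "\<And>i u. i < n \<Longrightarrow> reduced u \<Longrightarrow> \<tau> (xx i) u = toggle i u"
    using toggle_action by blast
  interpret B: group "BijGroup ?R" by (rule group_BijGroup)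
  interpret t: group_hom G "BijGroup ?R" \<tau> by unfold_locales (rule \<tau>)
  have car: "\<tau> g \<in> Bij ?R" if "g \<in> carrier G" for g
    using t.hom_closed[OF that] by (simp add: BijGroup_def)
  have tau_mult: "\<tau> (g \<cdot> h) w = \<tau> g (\<tau> h w)" if "g \<in> carrier G" "h \<in> carrier G" "reduced w" for g h w
    using that car[OF that(1)] car[OF that(2)] by (simp add: BijGroup_def compose_def)
  have red: "reduced (\<tau> g w)" if "g \<in> carrier G" "reduced w" for g w
    using Bij_imp_funcset[OF car[OF that(1)]] that(2) by auto
  have one: "\<tau> \<one>\<^bsub>G\<^esub> w = w" if "reduced w" for w
    using that by (simp add: BijGroup_def)
  have tau_inv: "\<tau> (inv\<^bsub>G\<^esub> g) w = w" if "g \<in> carrier G" "\<tau> g w = w" "reduced w" for g w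
    using tau_mult[of "inv\<^bsub>G\<^esub> g" g w] that one by simp
  have A: "\<tau> a w = w" if "a \<in> setA n" "reduced w" for a w
    using that
  proof (induction rule: A_induct)
    case (sq i)
    then show ?case using tau_mult[of "xx i" "xx i" w] x red[of "xx i" w]
      by (simp add: sq_eq toggle_toggle toggle_reduced)
  next
    case (inv i)
    then show ?case using tau_inv[of "sq n i" w] tau_mult[of "xx i" "xx i" w] x
      by (simp add: sq_eq toggle_toggle toggle_reduced)
  next
    case (mult a b)
    then show ?case using tau_mult[of a b w] A_closed by simp
  qed (use one in simp)
  define gp where "gp = foldr (\<lambda>i g. xx i \<cdot> g)"
  have gp: "gp u \<one>\<^bsub>G\<^esub> \<in> carrier G \<and> q (gp u \<one>\<^bsub>G\<^esub>) = wprod u \<and> \<tau> (gp u \<one>\<^bsub>G\<^esub>) [] = u" if "reduced u" for u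
    using that
  proof (induction u)
    case (Cons i u)
    then show ?case using tau_mult[of "xx i" "gp u \<one>\<^bsub>G\<^esub>" "[]"] x[of i u]
      by (auto simp: gp_def wgen_def toggle_def)
  qed (use one in \<open>auto simp del: t.hom_one simp: gp_def\<close>)
  obtain a where a: "a \<in> setA n" "gp u \<one>\<^bsub>G\<^esub> = gp v \<one>\<^bsub>G\<^esub> \<cdot> a"
    using q_eqE[of "gp u \<one>\<^bsub>G\<^esub>" "gp v \<one>\<^bsub>G\<^esub>"] gp assms by metis
  then have "\<tau> (gp u \<one>\<^bsub>G\<^esub>) [] = \<tau> (gp v \<one>\<^bsub>G\<^esub>) []"
    using tau_mult[of "gp v \<one>\<^bsub>G\<^esub>" a "[]"] A[OF a(1), of "[]"] gp[OF assms(2)] A_closed[OF a(1)] by simp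
  then show ?thesis using gp assms by simp
qed

lemma reduced_set: "reduced u \<Longrightarrow> set u \<subseteq> {..<n}" by (simp add: reduced_def)

lemma reduced_append:
  "reduced (u @ v) \<longleftrightarrow> reduced u \<and> reduced v \<and> (u = [] \<or> v = [] \<or> last u \<noteq> hd v)"
  by (auto simp: reduced_def distinct_adj_append_iff)

text \<open>Multiplication by \<open>k\<close> on the left puts \<open>k\<close> in front of \<open>u\<close>.  On the right it leaves the first
  letter as it is, or it cancels the last letter, and then the lengths differ.\<close>

lemma wprod_commute_wgen:
  assumes u: "reduced u" "u = [] \<or> hd u \<noteq> k" and k: "k < n" and c: "wprod u \<star> wgen k = wgen k \<star> wprod u"
  shows "u = []"
proof (rule ccontr)
  assume ne: "u \<noteq> []"
  have eq: "wprod (u @ [k]) = wprod (k # u)"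
    using c u(1) k by (simp add: wprod_append reduced_set)
  have ku: "reduced (k # u)" using u k by auto
  show False
  proof (cases "last u = k")
    case False
    then have "u @ [k] = k # u" using wprod_inj[OF _ ku eq] u k by (simp add: reduced_append)
    then show False using ne u(2) by (cases u) auto
  next
    case True
    then obtain v where v: "u = v @ [k]" using ne by (metis append_butlast_last_id)
    then have "reduced v" using u(1) by (simp add: reduced_append)
    moreover have "wprod v = wprod (k # u)"
      using eq k reduced_set[OF u(1)] unfolding v by (simp add: wprod_append)
    ultimately have "v = k # u" using wprod_inj ku by blast
    then have "length v = Suc (Suc (length v))" using v by (metis length_Cons length_append_singleton)
    then show False by simp
  qed
qed

text \<open>If the reduced word of \<open>w\<close> begins with \<open>k\<close>, then the rest of it still commutes with \<open>k\<close> and does not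
  begin with \<open>k\<close>.\<close>

lemma centralizer_wgen:
  assumes "w \<in> carrier W" "k < n" "w \<star> wgen k = wgen k \<star> w"
  shows "w = \<one>\<^bsub>W\<^esub> \<or> w = wgen k"
proof -
  obtain u where u: "reduced u" "w = wprod u" using W_reduced[OF assms(1)] .
  show ?thesis
  proof (cases "u \<noteq> [] \<and> hd u = k")
    case False
    then show ?thesis using wprod_commute_wgen[OF u(1) _ assms(2)] assms u by auto
  next
    case True
    then obtain v where v: "u = k # v" by (cases u) auto
    have red: "reduced v" "v = [] \<or> hd v \<noteq> k" using u v by auto
    have "wprod v = wgen k \<star> w" using u v assms(2) red(1) by (simp add: reduced_set)
    then have "wprod v \<star> wgen k = wgen k \<star> wprod v"
      using assms by (simp add: W.m_assoc)
    then have "v = []" by (rule wprod_commute_wgen[OF red assms(2)])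
    then show ?thesis using u v assms(2) by simp
  qed
qed

lemma wgen_inj: "i < n \<Longrightarrow> j < n \<Longrightarrow> wgen i = wgen j \<Longrightarrow> i = j"
  using wprod_inj[of "[i]" "[j]"] by simp

lemma wgen_not_one: "i < n \<Longrightarrow> wgen i \<noteq> \<one>\<^bsub>W\<^esub>"
  using wprod_inj[of "[i]" "[]"] by auto

text \<open>A reduced word representing an involution has equal first and last letters, since otherwise its
  square is reduced; stripping both off leads by induction to a single letter.\<close>

lemma involution_conjugate:
  assumes "w \<in> carrier W" "w \<star> w = \<one>\<^bsub>W\<^esub>" "w \<noteq> \<one>\<^bsub>W\<^esub>"
  obtains v k where "v \<in> carrier W" "k < n" "w = v \<star> wgen k \<star> inv\<^bsub>W\<^esub> v"
proof -
  have "\<exists>v\<in>carrier W. \<exists>k<n. wprod u = v \<star> wgen k \<star> inv\<^bsub>W\<^esub> v"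
    if "reduced u" "wprod u \<star> wprod u = \<one>\<^bsub>W\<^esub>" "u \<noteq> []" for u
    using that
  proof (induction u rule: length_induct)
    case (1 u)
    note red = reduced_set[OF 1(2)]
    obtain i u' where i: "u = i # u'" using 1(4) by (cases u) auto
    then have "i < n" using 1(2) by simp
    have "wprod (u @ u) = wprod []" using 1(3) red by (simp add: wprod_append)
    then have "\<not> reduced (u @ u)" using wprod_inj[of "u @ u" "[]"] 1(4) by auto
    then have last: "last u = i" using 1(2,4) i unfolding reduced_append by auto
    show ?case
    proof (cases "u' = []")
      case True
      then show ?thesis using i \<open>i < n\<close> by (intro bexI[of _ "\<one>\<^bsub>W\<^esub>"] exI[of _ i]) auto
    next
      case False
      then obtain v where v: "u = i # v @ [i]"
        using i last by (metis append_butlast_last_id last_ConsR)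
      have rv: "reduced v" and vn: "v \<noteq> []" using 1(2) unfolding v by (auto simp: reduced_append)
      have vc: "wprod v \<in> carrier W" using rv by (simp add: reduced_set)
      have u: "wprod u = wgen i \<star> wprod v \<star> wgen i"
        using v rv \<open>i < n\<close> by (simp add: wprod_append reduced_set W.m_assoc)
      have "wprod v \<star> wprod v = wgen i \<star> (wprod u \<star> wprod u) \<star> wgen i"
        using u vc \<open>i < n\<close> by (simp add: W.m_assoc)
      then have "wprod v \<star> wprod v = \<one>\<^bsub>W\<^esub>" using 1(3) \<open>i < n\<close> by simp
      moreover have "length v < length u" using v by simp
      ultimately obtain t k where t: "t \<in> carrier W" "k < n" "wprod v = t \<star> wgen k \<star> inv\<^bsub>W\<^esub> t"
        using 1(1) rv vn by blast
      have "wprod u = (wgen i \<star> t) \<star> wgen k \<star> inv\<^bsub>W\<^esub> (wgen i \<star> t)"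
        unfolding u t(3) using t(1,2) \<open>i < n\<close> by (simp add: W.m_assoc W.inv_mult_group)
      moreover have "wgen i \<star> t \<in> carrier W" using t \<open>i < n\<close> by simp
      ultimately show ?thesis using t(2) by (metis (no_types))
    qed
  qed
  moreover obtain u where "reduced u" "w = wprod u" using W_reduced[OF assms(1)] .
  moreover have "u \<noteq> []" using assms calculation by auto
  ultimately show ?thesis using that assms(2) by metis
qed

end

locale square_inversion3 = square_inversion +
  assumes n3: "n \<ge> 3"
begin

definition other :: "nat \<Rightarrow> nat" where "other j = (if j = 0 then 1 else 0)"

lemma other: "other j < n" "other j \<noteq> j"
  using n3 by (auto simp: other_def)

text \<open>The centralizers of two different generators have trivial intersection.\<close>

lemma centre_W:
  assumes "w \<in> carrier W" "\<And>v. v \<in> carrier W \<Longrightarrow> w \<star> v = v \<star> w"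
  shows "w = \<one>\<^bsub>W\<^esub>"
  using centralizer_wgen[OF assms(1), of 0] centralizer_wgen[OF assms(1), of 1]
    assms(2)[of "wgen 0"] assms(2)[of "wgen 1"] wgen_inj[of 0 1] n3 by auto

text \<open>With at least three letters, one can conjugate a nonempty reduced word by a letter that is neither
  its first nor its last one; word and conjugate do not commute.\<close>

lemma abelian_normal_trivial:
  assumes N: "N \<subseteq> carrier W" and conj: "\<And>w v. w \<in> carrier W \<Longrightarrow> v \<in> N \<Longrightarrow> w \<star> v \<star> inv\<^bsub>W\<^esub> w \<in> N"
    and comm: "\<And>v w. v \<in> N \<Longrightarrow> w \<in> N \<Longrightarrow> v \<star> w = w \<star> v"
    and w: "w \<in> N"
  shows "w = \<one>\<^bsub>W\<^esub>"
proof (rule ccontr)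
  assume ne: "w \<noteq> \<one>\<^bsub>W\<^esub>"
  obtain u where u: "reduced u" "w = wprod u" using W_reduced w N by blast
  then have un: "u \<noteq> []" using ne by auto
  obtain k where k: "k < n" "k \<noteq> hd u" "k \<noteq> last u"
  proof -
    obtain k :: nat where "k \<in> {0, 1, 2}" "k \<noteq> hd u" "k \<noteq> last u"
      by (metis insertI1 insertI2 numeral_eq_one_iff semiring_norm(85) zero_neq_numeral zero_neq_one)
    then show ?thesis using that[of k] n3 by auto
  qed
  have "wgen k \<star> w \<star> wgen k \<in> N" using conj[OF wgen_closed[OF k(1)] w] k by simp
  then have "w \<star> (wgen k \<star> w \<star> wgen k) = (wgen k \<star> w \<star> wgen k) \<star> w" using comm w by blast
  then have "wprod (u @ k # u @ [k]) = wprod (k # u @ k # u)"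
    using u k reduced_set[OF u(1)] by (simp add: wprod_append W.m_assoc)
  moreover have "reduced (u @ k # u @ [k])" "reduced (k # u @ k # u)"
    using u(1) un k by (auto simp: reduced_append)
  ultimately have "u @ k # u @ [k] = k # u @ k # u" using wprod_inj by blast
  then show False using un k(2) by (cases u) auto
qed

text \<open>A central element maps to the centre of \<open>W\<close> and so lies in \<open>A\<close>; conjugation by \<open>x\<^sub>i\<close> negates all of
  its coordinates except the \<open>i\<close>-th.\<close>

lemma centre_G:
  assumes z: "z \<in> carrier G" "\<And>g. g \<in> carrier G \<Longrightarrow> z \<cdot> g = g \<cdot> z"
  shows "z = \<one>\<^bsub>G\<^esub>"
proof -
  have "q z \<star> v = v \<star> q z" if v: "v \<in> carrier W" for v
  proof -
    obtain g where "g \<in> carrier G" "v = q g" using v by (rule W_lift)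
    then show ?thesis using z q.hom_mult[of z g] q.hom_mult[of g z] by simp
  qed
  then have "q z = \<one>\<^bsub>W\<^esub>" by (intro centre_W) (use z in auto)
  then have "z \<in> setA n" using q_eq_one_iff z by blast
  then obtain e where e: "z = A_elt n e" by (rule A_elt_exists)
  have "e j = 0" if j: "j < n" for j
  proof -
    obtain i where i: "i < n" "i \<noteq> j" using other by blast
    have "A_elt n e = xx i \<cdot> A_elt n e \<cdot> inv\<^bsub>G\<^esub> xx i"
      using z(2)[of "xx i"] i e by (metis A_elt_closed G.inv_solve_right G.m_closed gen_closed)
    then have "A_elt n e = A_elt n (\<lambda>j. sgn_of (xx i) j * e j)" using conj_A_elt i by simp
    then show ?thesis using i j unfolding A_elt_eq_iff by fastforce
  qed
  then show ?thesis using e A_elt_cong[of e "\<lambda>_. 0"] by simp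
qed

text \<open>The image of \<open>\<phi>(A)\<close> in \<open>W\<close> is an abelian normal subgroup.\<close>

lemma A_characteristic_le:
  assumes \<phi>: "\<phi> \<in> auto G" and a: "a \<in> setA n"
  shows "\<phi> a \<in> setA n"
proof -
  let ?N = "(\<lambda>a. q (\<phi> a)) ` setA n"
  have "q (\<phi> a) = \<one>\<^bsub>W\<^esub>"
  proof (rule abelian_normal_trivial[of ?N])
    show "?N \<subseteq> carrier W" using \<phi> A_closed by auto
    fix w v assume w: "w \<in> carrier W" and "v \<in> ?N"
    then obtain b where b: "b \<in> setA n" "v = q (\<phi> b)" by blast
    obtain h where h: "h \<in> carrier G" "w = q h" using w by (rule W_lift)
    have "h \<in> \<phi> ` carrier G" using auto_bij[OF \<phi>] h by (simp add: bij_betw_def)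
    then obtain g where g: "g \<in> carrier G" "h = \<phi> g" by blast
    have "w \<star> v \<star> inv\<^bsub>W\<^esub> w = q (\<phi> (g \<cdot> b \<cdot> inv\<^bsub>G\<^esub> g))"
      using \<phi> g b h A_closed[OF b(1)] by (simp add: auto_mult auto_inv[OF G.is_group])
    then show "w \<star> v \<star> inv\<^bsub>W\<^esub> w \<in> ?N" using conj_mem[OF g(1) b(1)] by blast
  next
    fix v w assume "v \<in> ?N" "w \<in> ?N"
    then obtain b c where b: "b \<in> setA n" "v = q (\<phi> b)" and c: "c \<in> setA n" "w = q (\<phi> c)" by blast
    have "v \<star> w = q (\<phi> (b \<cdot> c))" "w \<star> v = q (\<phi> (c \<cdot> b))"
      using \<phi> b c A_closed[OF b(1)] A_closed[OF c(1)] by (simp_all add: auto_mult)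
    then show "v \<star> w = w \<star> v" using A_commute[OF b(1) c(1)] by simp
  qed (use a in blast)
  then show ?thesis using q_eq_one_iff \<phi> A_closed[OF a] by simp
qed

lemma A_characteristic:
  assumes \<phi>: "\<phi> \<in> auto G"
  shows "\<phi> ` setA n = setA n"
proof (intro equalityI subsetI)
  fix a assume a: "a \<in> setA n"
  have "inv\<^bsub>AutoGroup G\<^esub> \<phi> \<in> auto G"
    using group.inv_closed[OF G.AutoGroup, of \<phi>] \<phi> by simp
  then have "(inv\<^bsub>AutoGroup G\<^esub> \<phi>) a \<in> setA n" using a by (rule A_characteristic_le)
  then show "a \<in> \<phi> ` setA n"
    using AutoGroup_app_inv[OF G.is_group \<phi> A_closed[OF a]] by (metis image_eqI)
qed (use A_characteristic_le[OF \<phi>] in blast)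

end

section \<open>Semi-linear automorphisms\<close>

lemma semilin_mem:
  "p \<in> carrier (semilin_Aut W A act) \<longleftrightarrow> fst p \<in> auto A \<and> snd p \<in> auto W \<and>
    (\<forall>w\<in>carrier W. \<forall>a\<in>carrier A. fst p (act w a) = act (snd p w) (fst p a))"
  by (cases p) (simp add: semilin_Aut_def)

lemma semilin_mult:
  "p \<otimes>\<^bsub>semilin_Aut W A act\<^esub> p' = (fst p \<otimes>\<^bsub>AutoGroup A\<^esub> fst p', snd p \<otimes>\<^bsub>AutoGroup W\<^esub> snd p')"
  by (cases p; cases p') (simp add: semilin_Aut_def)

lemma semilin_one: "\<one>\<^bsub>semilin_Aut W A act\<^esub> = (\<lambda>a\<in>carrier A. a, \<lambda>w\<in>carrier W. w)"
  by (simp add: semilin_Aut_def)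

lemma group_semilin_Aut:
  assumes "group W" "group A" and act: "\<And>w a. w \<in> carrier W \<Longrightarrow> a \<in> carrier A \<Longrightarrow> act w a \<in> carrier A"
  shows "group (semilin_Aut W A act)"
proof -
  interpret W: group W by fact
  interpret A: group A by fact
  interpret WA: group "AutoGroup W" by (rule W.AutoGroup)
  interpret AA: group "AutoGroup A" by (rule A.AutoGroup)
  interpret D: group "AutoGroup A \<times>\<times> AutoGroup W" by (rule DirProd_group[OF A.AutoGroup W.AutoGroup])
  have "subgroup (carrier (semilin_Aut W A act)) (AutoGroup A \<times>\<times> AutoGroup W)"
  proof (rule D.subgroupI)
    show "carrier (semilin_Aut W A act) \<subseteq> carrier (AutoGroup A \<times>\<times> AutoGroup W)"
      by (auto simp: semilin_Aut_def)
    have "(\<lambda>a\<in>carrier A. a, \<lambda>w\<in>carrier W. w) \<in> carrier (semilin_Aut W A act)"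
      using act AA.one_closed WA.one_closed by (simp add: semilin_mem)
    then show "carrier (semilin_Aut W A act) \<noteq> {}" by blast
  next
    fix p assume "p \<in> carrier (semilin_Aut W A act)"
    then obtain f F where p: "p = (f, F)" "f \<in> auto A" "F \<in> auto W"
      and l: "\<And>w a. w \<in> carrier W \<Longrightarrow> a \<in> carrier A \<Longrightarrow> f (act w a) = act (F w) (f a)"
      by (cases p) (auto simp: semilin_mem)
    let ?f = "inv\<^bsub>AutoGroup A\<^esub> f" and ?F = "inv\<^bsub>AutoGroup W\<^esub> F"
    have i: "?f \<in> auto A" "?F \<in> auto W" using AA.inv_closed[of f] WA.inv_closed[of F] p by auto
    have "?f (act w a) = act (?F w) (?f a)" if w: "w \<in> carrier W" and a: "a \<in> carrier A" for w a
    proof -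
      have "act w a = f (act (?F w) (?f a))"
        using l[of "?F w" "?f a"] i w a AutoGroup_app_inv[OF A.is_group p(2) a]
          AutoGroup_app_inv[OF W.is_group p(3) w] by simp
      then show ?thesis
        using AutoGroup_inv_app[OF A.is_group p(2), of "act (?F w) (?f a)"] act i w a by simp
    qed
    then show "inv\<^bsub>AutoGroup A \<times>\<times> AutoGroup W\<^esub> p \<in> carrier (semilin_Aut W A act)"
      using p i by (simp add: inv_DirProd[OF A.AutoGroup W.AutoGroup] semilin_mem)
  next
    fix p p' assume pp: "p \<in> carrier (semilin_Aut W A act)" "p' \<in> carrier (semilin_Aut W A act)"
    then have c: "fst p \<in> auto A" "fst p' \<in> auto A" "snd p \<in> auto W" "snd p' \<in> auto W"
      by (auto simp: semilin_mem)
    have "compose (carrier A) (fst p) (fst p') \<in> auto A" "compose (carrier W) (snd p) (snd p') \<in> auto W"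
      using AA.m_closed[of "fst p" "fst p'"] WA.m_closed[of "snd p" "snd p'"] c by auto
    then show "p \<otimes>\<^bsub>AutoGroup A \<times>\<times> AutoGroup W\<^esub> p' \<in> carrier (semilin_Aut W A act)"
      using pp c act by (auto simp: mult_DirProd' semilin_mem compose_def)
  qed
  then show ?thesis
    using D.subgroup_imp_group[of "carrier (semilin_Aut W A act)"] by (simp add: semilin_Aut_def)
qed

lemma mod_Aut_mem:
  assumes "group W" "f \<in> auto A"
  shows "f \<in> carrier (mod_Aut W A act) \<longleftrightarrow> (f, \<lambda>w\<in>carrier W. w) \<in> carrier (semilin_Aut W A act)"
  using assms group.id_in_auto[of W] by (simp add: mod_Aut_def semilin_mem)

lemma mod_Aut_carrier:
  "f \<in> carrier (mod_Aut W A act) \<longleftrightarrow> f \<in> auto A \<and> (\<forall>w\<in>carrier W. \<forall>a\<in>carrier A. f (act w a) = act w (f a))"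
  by (simp add: mod_Aut_def)

lemma mod_Aut_mult: "f \<otimes>\<^bsub>mod_Aut W A act\<^esub> f' = f \<otimes>\<^bsub>AutoGroup A\<^esub> f'"
  by (simp add: mod_Aut_def)

lemma mod_Aut_one: "\<one>\<^bsub>mod_Aut W A act\<^esub> = (\<lambda>a\<in>carrier A. a)"
  by (simp add: mod_Aut_def)

lemma group_mod_Aut:
  assumes "group W" "group A" and act: "\<And>w a. w \<in> carrier W \<Longrightarrow> a \<in> carrier A \<Longrightarrow> act w a \<in> carrier A"
  shows "group (mod_Aut W A act)"
proof -
  interpret A: group A by fact
  interpret AA: group "AutoGroup A" by (rule A.AutoGroup)
  have "subgroup (carrier (mod_Aut W A act)) (AutoGroup A)"
  proof (rule AA.subgroupI)
    show "carrier (mod_Aut W A act) \<subseteq> carrier (AutoGroup A)" by (auto simp: mod_Aut_carrier)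
    have "(\<lambda>a\<in>carrier A. a) \<in> carrier (mod_Aut W A act)"
      using act AA.one_closed by (simp add: mod_Aut_carrier)
    then show "carrier (mod_Aut W A act) \<noteq> {}" by blast
  next
    fix f assume "f \<in> carrier (mod_Aut W A act)"
    then have f: "f \<in> auto A" and l: "\<And>w a. w \<in> carrier W \<Longrightarrow> a \<in> carrier A \<Longrightarrow> f (act w a) = act w (f a)"
      by (auto simp: mod_Aut_carrier)
    let ?f = "inv\<^bsub>AutoGroup A\<^esub> f"
    have i: "?f \<in> auto A" using AA.inv_closed[of f] f by auto
    have "?f (act w a) = act w (?f a)" if w: "w \<in> carrier W" and a: "a \<in> carrier A" for w a
    proof -
      have "act w a = f (act w (?f a))"
        using l[of w "?f a"] i w a AutoGroup_app_inv[OF A.is_group f a] by simp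
      then show ?thesis
        using AutoGroup_inv_app[OF A.is_group f, of "act w (?f a)"] act i w a by simp
    qed
    then show "?f \<in> carrier (mod_Aut W A act)" using i by (simp add: mod_Aut_carrier)
  next
    fix f f' assume ff: "f \<in> carrier (mod_Aut W A act)" "f' \<in> carrier (mod_Aut W A act)"
    then have "f \<in> auto A" "f' \<in> auto A" by (auto simp: mod_Aut_carrier)
    then show "f \<otimes>\<^bsub>AutoGroup A\<^esub> f' \<in> carrier (mod_Aut W A act)"
      using ff act AA.m_closed[of f f'] by (auto simp: mod_Aut_carrier compose_def)
  qed
  then show ?thesis
    using AA.subgroup_imp_group[of "carrier (mod_Aut W A act)"] by (simp add: mod_Aut_def)
qed


section \<open>Endomorphisms of \<open>G\<close> and the automorphisms \<open>t\<^sub>\<aa>\<close>\<close>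

context square_inversion
begin

text \<open>The choice of the representative \<open>g\<close> does not matter, since \<open>A\<close> is commutative.\<close>

lemma actW_q:
  assumes g: "g \<in> carrier G" and a: "a \<in> setA n"
  shows "actW n (q g) a = g \<cdot> a \<cdot> inv\<^bsub>G\<^esub> g"
proof -
  have "k \<cdot> g \<cdot> a \<cdot> inv\<^bsub>G\<^esub> (k \<cdot> g) = g \<cdot> a \<cdot> inv\<^bsub>G\<^esub> g" if k: "k \<in> setA n" for k
  proof -
    note c = conj_mem[OF g a]
    have "k \<cdot> g \<cdot> a \<cdot> inv\<^bsub>G\<^esub> (k \<cdot> g) = k \<cdot> (g \<cdot> a \<cdot> inv\<^bsub>G\<^esub> g) \<cdot> inv\<^bsub>G\<^esub> k"
      using A_closed[OF k] g A_closed[OF a] by (rule conj_conj)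
    also have "\<dots> = g \<cdot> a \<cdot> inv\<^bsub>G\<^esub> g \<cdot> k \<cdot> inv\<^bsub>G\<^esub> k"
      using A_commute[OF k c] by simp
    also have "\<dots> = g \<cdot> a \<cdot> inv\<^bsub>G\<^esub> g"
      using A_closed[OF c] A_closed[OF k] by (simp add: G.m_assoc del: G.inv_mult_group)
    finally show ?thesis .
  qed
  then show ?thesis
    unfolding actW_def G_to_W_def by (rule the_elem_coset[OF G.is_group subgroup_A g])
qed

lemma actW_closed [simp]:
  assumes "w \<in> carrier W" "a \<in> setA n" shows "actW n w a \<in> setA n"
proof -
  obtain g where "g \<in> carrier G" "w = q g" using assms(1) by (rule W_lift)
  then show ?thesis using assms actW_q conj_mem by simp
qed

lemma actW_A_elt: "g \<in> carrier G \<Longrightarrow> actW n (q g) (A_elt n e) = A_elt n (\<lambda>j. sgn_of g j * e j)"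
  by (simp add: actW_q conj_A_elt)

lemma group_AutSA: "group (AutSA n)"
  by (rule group_semilin_Aut) auto

lemma group_AutWA: "group (AutWA n)"
  by (rule group_mod_Aut) auto

lemma A_hom_eqI:
  assumes "group H" "\<phi> \<in> hom A H" "\<psi> \<in> hom A H" "\<And>i. i < n \<Longrightarrow> \<phi> (sq n i) = \<psi> (sq n i)" "a \<in> setA n"
  shows "\<phi> a = \<psi> a"
proof -
  interpret p: group_hom A H \<phi> using assms by (simp add: group_hom_def group_hom_axioms_def A.is_group)
  interpret s: group_hom A H \<psi> using assms by (simp add: group_hom_def group_hom_axioms_def A.is_group)
  show ?thesis using assms(5)
  proof (induction rule: A_induct)
    case one
    show ?case using p.hom_one s.hom_one by simp
  next
    case (inv i)
    then show ?case using p.hom_inv[of "sq n i"] s.hom_inv[of "sq n i"] assms(4) by simp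
  next
    case (mult a b)
    then show ?case using p.hom_mult[of a b] s.hom_mult[of a b] by simp
  qed (rule assms(4))
qed

lemma hom_restrict_A:
  assumes "\<phi> \<in> hom G H" shows "\<phi> \<in> hom A H"
  using hom_mult[OF assms] hom_in_carrier[OF assms] A_closed by (intro homI) auto

text \<open>The five lemma for the extension of \<open>W\<close> by \<open>A\<close>.\<close>

lemma auto_of_hom:
  assumes \<phi>: "\<phi> \<in> hom G G" and bij: "bij_betw \<phi> (setA n) (setA n)"
    and inj: "\<And>g. g \<in> carrier G \<Longrightarrow> q (\<phi> g) = \<one>\<^bsub>W\<^esub> \<Longrightarrow> q g = \<one>\<^bsub>W\<^esub>"
    and surj: "\<And>w. w \<in> carrier W \<Longrightarrow> \<exists>g\<in>carrier G. q (\<phi> g) = w"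
  shows "restrict \<phi> (carrier G) \<in> auto G"
proof (rule restrict_auto[OF \<phi> _ G.is_group])
  interpret p: group_hom G G \<phi> by unfold_locales (rule \<phi>)
  show "bij_betw \<phi> (carrier G) (carrier G)"
    unfolding bij_betw_def
  proof
    have "g = \<one>\<^bsub>G\<^esub>" if g: "g \<in> carrier G" "\<phi> g = \<one>\<^bsub>G\<^esub>" for g
    proof -
      have "q g = \<one>\<^bsub>W\<^esub>" using inj g by simp
      then have "g \<in> setA n" using q_eq_one_iff g by blast
      then show ?thesis
        using bij g p.hom_one A_sub.one_closed unfolding bij_betw_def inj_on_def by metis
    qed
    then have "\<phi> \<in> mon G G" unfolding mon_iff_hom_one[OF G.is_group G.is_group] using \<phi> by blast
    then show "inj_on \<phi> (carrier G)" by (simp add: mon_def)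
    show "\<phi> ` carrier G = carrier G"
    proof (intro equalityI subsetI)
      fix h assume h: "h \<in> carrier G"
      obtain g where g: "g \<in> carrier G" "q (\<phi> g) = q h" using surj[of "q h"] h by auto
      obtain a where a: "a \<in> setA n" "h = \<phi> g \<cdot> a" using q_eqE[of h "\<phi> g"] g h by auto
      have "a \<in> \<phi> ` setA n" using a bij by (simp add: bij_betw_def)
      then obtain b where b: "b \<in> setA n" "a = \<phi> b" by blast
      have "h = \<phi> (g \<cdot> b)" using a b g A_closed[OF b(1)] by simp
      then show "h \<in> \<phi> ` carrier G" using g A_closed[OF b(1)] by blast
    qed auto
  qed
qed

text \<open>Moving the first factor from \<open>A\<close> past \<open>g\<close> changes the signs of its coordinates.\<close>

lemma square_mult_A_elt:
  assumes g: "g \<in> carrier G"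
  shows "(g \<cdot> A_elt n e) \<cdot> (g \<cdot> A_elt n e)
    = g \<cdot> g \<cdot> A_elt n (\<lambda>j. sgn_of g j * e j + e j)"
proof -
  have "(g \<cdot> A_elt n e) \<cdot> (g \<cdot> A_elt n e)
    = g \<cdot> g \<cdot> (inv\<^bsub>G\<^esub> g \<cdot> A_elt n e \<cdot> inv\<^bsub>G\<^esub> (inv\<^bsub>G\<^esub> g)) \<cdot> A_elt n e"
    using g by (simp add: G.m_assoc) (simp add: G.m_assoc[symmetric])
  also have "\<dots> = g \<cdot> g \<cdot> (A_elt n (\<lambda>j. sgn_of g j * e j) \<cdot> A_elt n e)"
    using g conj_A_elt[of "inv\<^bsub>G\<^esub> g" e] by (simp add: G.m_assoc)
  finally show ?thesis by (simp add: A_elt_add)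
qed

text \<open>All coordinates except the \<open>i\<close>-th are negated by \<open>x\<^sub>i\<close>.\<close>

lemma fixed_by_gen:
  assumes "a \<in> setA n" "i < n" "actW n (wgen i) a = a"
  obtains c where "a = sq n i [^]\<^bsub>G\<^esub> (c::int)"
proof -
  obtain e where e: "a = A_elt n e" using assms(1) by (rule A_elt_exists)
  then have "A_elt n (\<lambda>j. sgn_of (xx i) j * e j) = A_elt n e"
    using assms actW_A_elt[of "xx i" e] by (simp add: wgen_def)
  then have "e j = 0" if "j < n" "j \<noteq> i" for j using that assms(2) unfolding A_elt_eq_iff by fastforce
  then have "a = A_elt n (\<lambda>j. if j = i then e i else 0)" unfolding e A_elt_eq_iff by auto
  then show ?thesis using A_elt_unit[OF assms(2)] that by metis
qed

lemma sq_pow_eq_iff: "i < n \<Longrightarrow> sq n i [^]\<^bsub>G\<^esub> (c::int) = sq n i [^]\<^bsub>G\<^esub> d \<longleftrightarrow> c = d"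
  using A_elt_eq_iff[of "\<lambda>j. if j = i then c else 0" "\<lambda>j. if j = i then d else 0"]
  by (auto simp: A_elt_unit)

lemma M0_simps [simp]:
  "carrier (M0 n) = {M \<in> carrier_mat n n. \<forall>i<n. M $$ (i, i) = 0}"
  "M \<otimes>\<^bsub>M0 n\<^esub> N = M + N" "\<one>\<^bsub>M0 n\<^esub> = 0\<^sub>m n n"
  by (simp_all add: M0_def monoid_mat_def)

lemma group_M0: "group (M0 n)"
proof (rule groupI)
  fix M assume "M \<in> carrier (M0 n)"
  then show "\<exists>N\<in>carrier (M0 n). N \<otimes>\<^bsub>M0 n\<^esub> M = \<one>\<^bsub>M0 n\<^esub>"
    by (intro bexI[of _ "- M"]) auto
qed (auto simp: assoc_add_mat)

text \<open>As the \<open>i\<close>-th coordinate of \<open>e i\<close> vanishes, \<open>x\<^sub>i\<close> inverts \<open>A_elt n (e i)\<close>.  So the elements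
  \<open>x\<^sub>i A_elt n (e i)\<close> have the same squares as the \<open>x\<^sub>i\<close>, and they act on \<open>A\<close> in the same way; the relations
  persist.\<close>

lemma twist_hom_exists:
  assumes "\<And>i. i < n \<Longrightarrow> e i i = 0"
  obtains \<phi> where "\<phi> \<in> hom G G" "\<And>i. i < n \<Longrightarrow> \<phi> (xx i) = xx i \<cdot> A_elt n (e i)"
    "\<And>a. a \<in> setA n \<Longrightarrow> \<phi> a = a" "\<And>g. g \<in> carrier G \<Longrightarrow> q (\<phi> g) = q g"
proof -
  let ?y = "\<lambda>i. xx i \<cdot> A_elt n (e i)"
  have sq: "?y j \<cdot> ?y j = sq n j" if j: "j < n" for j
  proof -
    have "A_elt n (\<lambda>k. sgn_of (xx j) k * e j k + e j k) = A_elt n (\<lambda>_. 0)"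
      unfolding A_elt_eq_iff using assms j by auto
    then show ?thesis using j square_mult_A_elt[of "xx j" "e j"] by (simp add: sq_eq)
  qed
  have "\<exists>\<phi>\<in>hom G G. \<forall>i<n. \<phi> (xx i) = ?y i"
  proof (rule G_hom_exists[OF G.is_group])
    fix i j assume ij: "i < n" "j < n" "i \<noteq> j"
    have "inv\<^bsub>G\<^esub> ?y i \<cdot> sq n j \<cdot> inv\<^bsub>G\<^esub> (inv\<^bsub>G\<^esub> ?y i) = inv\<^bsub>G\<^esub> sq n j"
      using ij conj_sq[of "inv\<^bsub>G\<^esub> ?y i" j] by (simp add: G.int_pow_neg del: G.inv_inv)
    then show "inv\<^bsub>G\<^esub> ?y i \<cdot> (?y j \<cdot> ?y j) \<cdot> ?y i = inv\<^bsub>G\<^esub> (?y j \<cdot> ?y j)"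
      using ij unfolding sq[OF ij(2)] by simp
  qed simp
  then obtain \<phi> where \<phi>: "\<phi> \<in> hom G G" and x: "\<And>i. i < n \<Longrightarrow> \<phi> (xx i) = ?y i" by blast
  have "\<phi> a = a" if "a \<in> setA n" for a
  proof (rule A_hom_eqI[OF G.is_group hom_restrict_A[OF \<phi>] _ _ that])
    show "(\<lambda>a. a) \<in> hom A G" using A_closed by (intro homI) auto
    show "\<phi> (sq n i) = sq n i" if "i < n" for i
      using that hom_mult[OF \<phi>, of "xx i" "xx i"] x sq by (simp add: sq_eq)
  qed
  moreover have "q (\<phi> g) = q g" if "g \<in> carrier G" for g
  proof -
    have "(q \<circ> \<phi>) g = q g"
      by (rule hom_eqI[OF W.is_group hom_compose[OF \<phi> q_hom] q_hom _ that]) (simp add: x)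
    then show ?thesis by simp
  qed
  ultimately show ?thesis using that \<phi> x by blast
qed

lemma tmap_ex1:
  assumes M: "M \<in> carrier (M0 n)"
  shows "\<exists>!\<phi>. \<phi> \<in> auto G \<and> (\<forall>i<n. \<phi> (xx i) = xx i \<cdot> A_elt n (\<lambda>j. M $$ (i, j)))"
proof (rule ex_ex1I)
  obtain \<phi> where \<phi>: "\<phi> \<in> hom G G" "\<And>i. i < n \<Longrightarrow> \<phi> (xx i) = xx i \<cdot> A_elt n (\<lambda>j. M $$ (i, j))"
    "\<And>a. a \<in> setA n \<Longrightarrow> \<phi> a = a" "\<And>g. g \<in> carrier G \<Longrightarrow> q (\<phi> g) = q g"
    using twist_hom_exists[of "\<lambda>i j. M $$ (i, j)"] M by auto
  have "restrict \<phi> (carrier G) \<in> auto G"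
  proof (rule auto_of_hom[OF \<phi>(1)])
    show "bij_betw \<phi> (setA n) (setA n)" using bij_betw_cong[of "setA n" \<phi> id] \<phi>(3) by simp
    show "\<exists>g\<in>carrier G. q (\<phi> g) = w" if "w \<in> carrier W" for w
      using that carrier_W \<phi>(4) by auto
  qed (use \<phi>(4) in auto)
  then show "\<exists>\<phi>. \<phi> \<in> auto G \<and> (\<forall>i<n. \<phi> (xx i) = xx i \<cdot> A_elt n (\<lambda>j. M $$ (i, j)))"
    using \<phi>(2) by (intro exI[of _ "restrict \<phi> (carrier G)"]) auto
next
  fix \<phi> \<psi>
  assume *: "\<phi> \<in> auto G \<and> (\<forall>i<n. \<phi> (xx i) = xx i \<cdot> A_elt n (\<lambda>j. M $$ (i, j)))"
    "\<psi> \<in> auto G \<and> (\<forall>i<n. \<psi> (xx i) = xx i \<cdot> A_elt n (\<lambda>j. M $$ (i, j)))"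
  show "\<phi> = \<psi>"
  proof (rule auto_eqI[of _ G])
    show "\<phi> g = \<psi> g" if "g \<in> carrier G" for g
      by (rule hom_eqI[OF G.is_group auto_hom auto_hom _ that]) (use * in auto)
  qed (use * in auto)
qed

lemma tmap_auto: "M \<in> carrier (M0 n) \<Longrightarrow> tmap n M \<in> auto G"
  and tmap_gen: "M \<in> carrier (M0 n) \<Longrightarrow> i < n \<Longrightarrow> tmap n M (xx i) = xx i \<cdot> A_elt n (\<lambda>j. M $$ (i, j))"
  using theI'[OF tmap_ex1] unfolding tmap_def by blast+

lemma tmap_eqI:
  assumes "M \<in> carrier (M0 n)" "\<phi> \<in> auto G" "\<And>i. i < n \<Longrightarrow> \<phi> (xx i) = xx i \<cdot> A_elt n (\<lambda>j. M $$ (i, j))"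
  shows "tmap n M = \<phi>"
  unfolding tmap_def using the1_equality[OF tmap_ex1[OF assms(1)]] assms(2,3) by blast

lemma tmap_A: "tmap n M a = a" and tmap_q: "q (tmap n M g) = q g"
  if M: "M \<in> carrier (M0 n)" and "a \<in> setA n" and "g \<in> carrier G"
proof -
  obtain \<phi> where \<phi>: "\<phi> \<in> hom G G" "\<And>i. i < n \<Longrightarrow> \<phi> (xx i) = xx i \<cdot> A_elt n (\<lambda>j. M $$ (i, j))"
    "\<And>a. a \<in> setA n \<Longrightarrow> \<phi> a = a" "\<And>g. g \<in> carrier G \<Longrightarrow> q (\<phi> g) = q g"
    using twist_hom_exists[of "\<lambda>i j. M $$ (i, j)"] M by auto
  have "tmap n M g = \<phi> g" if "g \<in> carrier G" for g
    by (rule hom_eqI[OF G.is_group auto_hom[OF tmap_auto[OF M]] \<phi>(1) _ that])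
      (simp add: \<phi>(2) tmap_gen[OF M])
  then show "tmap n M a = a" "q (tmap n M g) = q g" using \<phi>(3,4) that A_closed by auto
qed

lemma tmap_hom: "tmap n \<in> hom (M0 n) (AutG n)"
proof (rule homI)
  fix M N assume MN: "M \<in> carrier (M0 n)" "N \<in> carrier (M0 n)"
  note a = tmap_auto[OF MN(1)] tmap_auto[OF MN(2)]
  have MNc: "M + N \<in> carrier (M0 n)" using MN by auto
  have "tmap n (M + N) = tmap n M \<otimes>\<^bsub>AutG n\<^esub> tmap n N"
  proof (rule tmap_eqI[OF MNc])
    show "tmap n M \<otimes>\<^bsub>AutG n\<^esub> tmap n N \<in> auto G"
      using group.is_monoid[THEN monoid.m_closed, OF G.AutoGroup, of "tmap n M" "tmap n N"] a by simp
    fix i assume i: "i < n"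
    have "tmap n M (xx i \<cdot> A_elt n (\<lambda>j. N $$ (i, j)))
      = xx i \<cdot> (A_elt n (\<lambda>j. M $$ (i, j)) \<cdot> A_elt n (\<lambda>j. N $$ (i, j)))"
      using i tmap_gen[OF MN(1) i] tmap_A[OF MN(1) A_elt_mem G.one_closed] by (simp add: auto_mult[OF a(1)] G.m_assoc)
    also have "\<dots> = xx i \<cdot> A_elt n (\<lambda>j. (M + N) $$ (i, j))"
      unfolding A_elt_add using MN i by (intro arg_cong2[where f = "monoid.mult G"] A_elt_cong) auto
    finally show "(tmap n M \<otimes>\<^bsub>AutG n\<^esub> tmap n N) (xx i) = xx i \<cdot> A_elt n (\<lambda>j. (M + N) $$ (i, j))"
      using a i tmap_gen[OF MN(2) i] by (simp add: compose_def)
  qed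
  then show "tmap n (M \<otimes>\<^bsub>M0 n\<^esub> N) = tmap n M \<otimes>\<^bsub>AutG n\<^esub> tmap n N" by simp
qed (simp add: tmap_auto del: M0_simps)

lemma tmap_inj: "tmap n \<in> mon (M0 n) (AutG n)"
  unfolding mon_iff_hom_one[OF group_M0 G.AutoGroup]
proof (intro conjI tmap_hom allI impI, elim conjE)
  fix M assume M: "M \<in> carrier (M0 n)" "tmap n M = \<one>\<^bsub>AutG n\<^esub>"
  have "M $$ (i, j) = 0" if ij: "i < n" "j < n" for i j
  proof -
    have "xx i \<cdot> A_elt n (\<lambda>j. M $$ (i, j)) = xx i" using M ij tmap_gen[OF M(1) ij(1)] by simp
    then have "A_elt n (\<lambda>j. M $$ (i, j)) = A_elt n (\<lambda>_. 0)" using ij by simp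
    then show ?thesis unfolding A_elt_eq_iff using ij by blast
  qed
  then show "M = \<one>\<^bsub>M0 n\<^esub>" using M(1) by (auto intro!: eq_matI)
qed

text \<open>An automorphism acting trivially on \<open>A\<close> and on \<open>W\<close> moves each \<open>x\<^sub>i\<close> by an element of \<open>A\<close>, whose
  \<open>i\<close>-th coordinate vanishes because \<open>x\<^sub>i\<^sup>2\<close> is fixed.\<close>

lemma tmap_range:
  assumes \<phi>: "\<phi> \<in> auto G" and A: "\<And>a. a \<in> setA n \<Longrightarrow> \<phi> a = a" and Q: "\<And>g. g \<in> carrier G \<Longrightarrow> q (\<phi> g) = q g"
  shows "\<exists>M\<in>carrier (M0 n). tmap n M = \<phi>"
proof -
  have "\<exists>e. \<phi> (xx i) = xx i \<cdot> A_elt n e" if i: "i < n" for i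
  proof -
    obtain a where "a \<in> setA n" "\<phi> (xx i) = xx i \<cdot> a"
      using q_eqE[of "\<phi> (xx i)" "xx i"] Q \<phi> i by auto
    then show ?thesis using A_elt_exists by metis
  qed
  then obtain e where e: "\<And>i. i < n \<Longrightarrow> \<phi> (xx i) = xx i \<cdot> A_elt n (e i)" by metis
  have diag: "e i i = 0" if i: "i < n" for i
  proof -
    have "sq n i = \<phi> (xx i \<cdot> xx i)" using A[OF sq_mem[OF i]] i by (simp add: sq_eq)
    also have "\<dots> = sq n i \<cdot> A_elt n (\<lambda>j. sgn_of (xx i) j * e i j + e i j)"
      using e[OF i] i square_mult_A_elt[of "xx i" "e i"] by (simp add: auto_mult[OF \<phi>] sq_eq)
    finally have "A_elt n (\<lambda>j. sgn_of (xx i) j * e i j + e i j) = A_elt n (\<lambda>_. 0)" using i by simp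
    then show ?thesis unfolding A_elt_eq_iff using i by auto
  qed
  let ?M = "mat n n (\<lambda>(i, j). e i j)"
  have M: "?M \<in> carrier (M0 n)" using diag by simp
  moreover have "tmap n ?M = \<phi>"
  proof (rule tmap_eqI[OF M \<phi>])
    fix i assume i: "i < n"
    have "A_elt n (e i) = A_elt n (\<lambda>j. ?M $$ (i, j))" using i by (intro A_elt_cong) auto
    then show "\<phi> (xx i) = xx i \<cdot> A_elt n (\<lambda>j. ?M $$ (i, j))" using e[OF i] by simp
  qed
  ultimately show ?thesis by blast
qed

end


section \<open>The homomorphism from \<open>Aut(G)\<close> to the semi-linear automorphisms\<close>

context square_inversion3
begin

abbreviation "r \<equiv> AutG_to_AutSA n"

lemma r_fst: "a \<in> setA n \<Longrightarrow> fst (r \<phi>) a = \<phi> a"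
  by (simp add: AutG_to_AutSA_def)

lemma r_snd:
  assumes \<phi>: "\<phi> \<in> auto G" and g: "g \<in> carrier G"
  shows "snd (r \<phi>) (q g) = q (\<phi> g)"
proof -
  have "q (\<phi> (k \<cdot> g)) = q (\<phi> g)" if "k \<in> setA n" for k
    using that \<phi> g A_closed[OF that] A_characteristic_le[OF \<phi> that] by (simp add: auto_mult)
  then have "the_elem ((\<lambda>g. q (\<phi> g)) ` q g) = q (\<phi> g)"
    unfolding G_to_W_def[of n g] by (rule the_elem_coset[OF G.is_group subgroup_A g])
  then show ?thesis using g by (simp add: AutG_to_AutSA_def)
qed

text \<open>Both components are well defined and bijective because \<open>A\<close> is characteristic.\<close>

lemma r_mem:
  assumes \<phi>: "\<phi> \<in> auto G"
  shows "r \<phi> \<in> carrier (AutSA n)"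
proof -
  interpret p: group_hom G G \<phi> by unfold_locales (rule auto_hom[OF \<phi>])
  have bij: "bij_betw \<phi> (setA n) (setA n)"
    using A_characteristic[OF \<phi>] auto_bij[OF \<phi>] A_sub.subset
    unfolding bij_betw_def by (auto intro: inj_on_subset)
  have "\<phi> \<in> hom A A"
    using A_characteristic_le[OF \<phi>] p.hom_mult[OF A_closed A_closed] by (intro homI) auto
  then have f: "fst (r \<phi>) \<in> auto A"
    using restrict_auto[of \<phi> A] bij by (simp add: AutG_to_AutSA_def)
  have F: "snd (r \<phi>) \<in> hom W W"
  proof (rule homI)
    fix v w assume v: "v \<in> carrier W" and w: "w \<in> carrier W"
    obtain g where g: "g \<in> carrier G" "v = q g" using v by (rule W_lift)
    obtain h where h: "h \<in> carrier G" "w = q h" using w by (rule W_lift)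
    show "snd (r \<phi>) v \<in> carrier W" using g r_snd[OF \<phi> g(1)] by simp
    show "snd (r \<phi>) (v \<star> w) = snd (r \<phi>) v \<star> snd (r \<phi>) w"
      using g h r_snd[OF \<phi>, of "g \<cdot> h"] r_snd[OF \<phi> g(1)] r_snd[OF \<phi> h(1)] by simp
  qed
  have "snd (r \<phi>) \<in> mon W W"
    unfolding mon_iff_hom_one[OF W.is_group W.is_group]
  proof (intro conjI F allI impI, elim conjE)
    fix w assume w: "w \<in> carrier W" "snd (r \<phi>) w = \<one>\<^bsub>W\<^esub>"
    obtain g where g: "g \<in> carrier G" "w = q g" using w(1) by (rule W_lift)
    have "\<phi> g \<in> setA n" using w g r_snd[OF \<phi> g(1)] q_eq_one_iff[of "\<phi> g"] by simp
    then have "\<phi> g \<in> \<phi> ` setA n" using A_characteristic[OF \<phi>] by simp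
    then obtain a where "a \<in> setA n" "\<phi> g = \<phi> a" by blast
    then have "g \<in> setA n" using auto_bij[OF \<phi>] g A_closed unfolding bij_betw_def inj_on_def by metis
    then show "w = \<one>\<^bsub>W\<^esub>" using g by simp
  qed
  moreover have "snd (r \<phi>) ` carrier W = carrier W"
  proof (intro equalityI subsetI)
    fix w assume "w \<in> carrier W"
    then obtain h where h: "h \<in> carrier G" "w = q h" by (rule W_lift)
    have "h \<in> \<phi> ` carrier G" using auto_bij[OF \<phi>] h by (simp add: bij_betw_def)
    then obtain g where g: "g \<in> carrier G" "h = \<phi> g" by blast
    have "w = snd (r \<phi>) (q g)" using r_snd[OF \<phi> g(1)] g h by simp
    then show "w \<in> snd (r \<phi>) ` carrier W" by (rule image_eqI) (use g in simp)
  qed (use hom_in_carrier[OF F] in auto)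
  ultimately have F': "snd (r \<phi>) \<in> auto W"
    by (auto simp: auto_def Bij_def bij_betw_def mon_def) (simp add: AutG_to_AutSA_def)
  have "fst (r \<phi>) (actW n w a) = actW n (snd (r \<phi>) w) (fst (r \<phi>) a)"
    if w: "w \<in> carrier W" and a: "a \<in> setA n" for w a
  proof -
    obtain g where g: "g \<in> carrier G" "w = q g" using w by (rule W_lift)
    show ?thesis
      using g a r_snd[OF \<phi> g(1)] A_closed[OF a] conj_mem[OF g(1) a] A_characteristic_le[OF \<phi> a]
      by (simp add: r_fst actW_q)
  qed
  then show ?thesis using f F' by (simp add: semilin_mem)
qed

lemma r_hom: "r \<in> hom (AutG n) (AutSA n)"
proof (rule homI)
  fix \<phi> \<psi> assume "\<phi> \<in> carrier (AutG n)" "\<psi> \<in> carrier (AutG n)"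
  then have a: "\<phi> \<in> auto G" "\<psi> \<in> auto G" by auto
  have c: "compose (carrier G) \<phi> \<psi> \<in> auto G"
    using group.is_monoid[THEN monoid.m_closed, OF G.AutoGroup, of \<phi> \<psi>] a by simp
  have m: "fst (r \<phi>) \<in> auto A" "fst (r \<psi>) \<in> auto A" "snd (r \<phi>) \<in> auto W" "snd (r \<psi>) \<in> auto W"
    "fst (r (compose (carrier G) \<phi> \<psi>)) \<in> auto A" "snd (r (compose (carrier G) \<phi> \<psi>)) \<in> auto W"
    using r_mem[OF a(1)] r_mem[OF a(2)] r_mem[OF c] by (auto simp: semilin_mem)
  have m': "fst (r \<phi>) \<otimes>\<^bsub>AutoGroup A\<^esub> fst (r \<psi>) \<in> auto A" "snd (r \<phi>) \<otimes>\<^bsub>AutoGroup W\<^esub> snd (r \<psi>) \<in> auto W"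
    using group.is_monoid[THEN monoid.m_closed, OF A.AutoGroup, of "fst (r \<phi>)" "fst (r \<psi>)"]
      group.is_monoid[THEN monoid.m_closed, OF W.AutoGroup, of "snd (r \<phi>)" "snd (r \<psi>)"] m by simp_all
  have "fst (r (compose (carrier G) \<phi> \<psi>)) = fst (r \<phi>) \<otimes>\<^bsub>AutoGroup A\<^esub> fst (r \<psi>)"
    using m A_characteristic_le[OF a(2)] A_closed
    by (intro auto_eqI[OF m(5) m'(1)]) (simp add: r_fst compose_def)
  moreover have "snd (r (compose (carrier G) \<phi> \<psi>)) = snd (r \<phi>) \<otimes>\<^bsub>AutoGroup W\<^esub> snd (r \<psi>)"
  proof (rule auto_eqI[OF m(6) m'(2)])
    fix w assume w: "w \<in> carrier W"
    then obtain g where g: "g \<in> carrier G" "w = q g" by (rule W_lift)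
    then show "snd (r (compose (carrier G) \<phi> \<psi>)) w = (snd (r \<phi>) \<otimes>\<^bsub>AutoGroup W\<^esub> snd (r \<psi>)) w"
      using m a w r_snd[OF c g(1)] r_snd[OF a(2) g(1)] r_snd[OF a(1), of "\<psi> g"] by (simp add: compose_def)
  qed
  ultimately show "r (\<phi> \<otimes>\<^bsub>AutG n\<^esub> \<psi>) = r \<phi> \<otimes>\<^bsub>AutSA n\<^esub> r \<psi>"
    using a by (simp add: semilin_mult prod_eq_iff del: mult_AutoGroup) (simp add: a)
qed (simp add: r_mem)

lemma r_eq_iff:
  assumes \<phi>: "\<phi> \<in> auto G" and p: "p \<in> carrier (AutSA n)"
  shows "r \<phi> = p \<longleftrightarrow> (\<forall>a\<in>setA n. \<phi> a = fst p a) \<and> (\<forall>g\<in>carrier G. q (\<phi> g) = snd p (q g))"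
proof
  assume "r \<phi> = p"
  then show "(\<forall>a\<in>setA n. \<phi> a = fst p a) \<and> (\<forall>g\<in>carrier G. q (\<phi> g) = snd p (q g))"
    using r_fst r_snd[OF \<phi>] by metis
next
  assume *: "(\<forall>a\<in>setA n. \<phi> a = fst p a) \<and> (\<forall>g\<in>carrier G. q (\<phi> g) = snd p (q g))"
  have m: "fst (r \<phi>) \<in> auto A" "snd (r \<phi>) \<in> auto W" "fst p \<in> auto A" "snd p \<in> auto W"
    using r_mem[OF \<phi>] p by (auto simp: semilin_mem)
  have "fst (r \<phi>) = fst p" using * by (intro auto_eqI[OF m(1,3)]) (simp add: r_fst)
  moreover have "snd (r \<phi>) = snd p"
  proof (rule auto_eqI[OF m(2,4)])
    fix w assume "w \<in> carrier W"
    then obtain g where "g \<in> carrier G" "w = q g" by (rule W_lift)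
    then show "snd (r \<phi>) w = snd p w" using * r_snd[OF \<phi>] by simp
  qed
  ultimately show "r \<phi> = p" by (simp add: prod_eq_iff)
qed

lemma r_conj:
  assumes g: "g \<in> carrier G"
  shows "r (conj_auto G g) = W_to_AutSA n (q g)"
proof -
  let ?c = "conj_auto G g"
  have c: "?c \<in> auto G" using g by simp
  have "fst (r ?c) = fst (W_to_AutSA n (q g))"
    using g A_closed by (auto simp: AutG_to_AutSA_def W_to_AutSA_def actW_q intro!: restrict_ext)
  moreover have "snd (r ?c) = conj_auto W (q g)"
  proof (rule auto_eqI[of _ W])
    show "snd (r ?c) \<in> auto W" using r_mem[OF c] by (simp add: semilin_mem)
    show "conj_auto W (q g) \<in> auto W" using g by simp
    fix w assume "w \<in> carrier W"
    then obtain h where "h \<in> carrier G" "w = q h" by (rule W_lift)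
    then show "snd (r ?c) w = conj_auto W (q g) w" using r_snd[OF c, of h] g by simp
  qed
  ultimately show ?thesis by (simp add: prod_eq_iff W_to_AutSA_def)
qed

end

section \<open>Lifting automorphisms of \<open>W\<close> to \<open>G\<close>\<close>

context square_inversion
begin

text \<open>Modulo 2 the signs in the affine representation disappear and the translation part is
  additive.\<close>

lemma even_trans_mult:
  "g \<in> carrier G \<Longrightarrow> h \<in> carrier G \<Longrightarrow>
    even (trans_of (g \<cdot> h) j) \<longleftrightarrow> (even (trans_of g j) \<longleftrightarrow> even (trans_of h j))"
  using sgn_of_cases[of g j] by auto

lemma even_trans_inv: "g \<in> carrier G \<Longrightarrow> even (trans_of (inv\<^bsub>G\<^esub> g) j) \<longleftrightarrow> even (trans_of g j)"
  using sgn_of_cases[of g j] by auto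

lemma even_trans_A: "a \<in> setA n \<Longrightarrow> j < n \<Longrightarrow> even (trans_of a j)"
  by (metis A_elt_exists trans_of_A_elt dvd_triv_left)

text \<open>Modulo \<open>A\<close>, a generator and its inverse coincide.  Admitting only conjugates of generators, and not
  of their inverses, fixes the sign of the square of a lift.\<close>

definition positive :: "G_elt set" where
  "positive = {g \<cdot> xx k \<cdot> inv\<^bsub>G\<^esub> g | g k. g \<in> carrier G \<and> k < n}"

lemma positive_closed: "p \<in> positive \<Longrightarrow> p \<in> carrier G"
  unfolding positive_def by auto

lemma gen_positive: "i < n \<Longrightarrow> xx i \<in> positive"
  unfolding positive_def by (intro CollectI exI[of _ "\<one>\<^bsub>G\<^esub>"] exI[of _ i]) auto

lemma conj_positive:
  assumes "h \<in> carrier G" "p \<in> positive" shows "h \<cdot> p \<cdot> inv\<^bsub>G\<^esub> h \<in> positive"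
proof -
  obtain g k where p: "p = g \<cdot> xx k \<cdot> inv\<^bsub>G\<^esub> g" "g \<in> carrier G" "k < n"
    using assms(2) unfolding positive_def by blast
  have "h \<cdot> p \<cdot> inv\<^bsub>G\<^esub> h = (h \<cdot> g) \<cdot> xx k \<cdot> inv\<^bsub>G\<^esub> (h \<cdot> g)"
    unfolding p(1) using assms(1) p(2,3) by (simp add: conj_conj)
  then show ?thesis using assms(1) p unfolding positive_def by blast
qed

lemma conj_gen_square:
  assumes "g \<in> carrier G" "k < n" "p = g \<cdot> xx k \<cdot> inv\<^bsub>G\<^esub> g"
  shows "p \<cdot> p = sq n k [^]\<^bsub>G\<^esub> sgn_of g k"
  unfolding assms(3) using assms(1,2) by (simp add: G.conj_mult sq_eq[symmetric] conj_sq)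

text \<open>The square of a positive element depends only on its image in \<open>W\<close>: that image determines the
  generator \<open>x\<^sub>k\<close> by the parity of the translation part, and it determines the conjugating element
  up to the centralizer of the image of \<open>x\<^sub>k\<close>, which acts trivially on \<open>x\<^sub>k\<^sup>2\<close>.\<close>

lemma positive_square_unique:
  assumes "p \<in> positive" "p' \<in> positive" and eq: "q p = q p'"
  shows "p \<cdot> p = p' \<cdot> p'"
proof -
  obtain g k where p: "p = g \<cdot> xx k \<cdot> inv\<^bsub>G\<^esub> g" "g \<in> carrier G" "k < n"
    using assms(1) unfolding positive_def by blast
  obtain h l where p': "p' = h \<cdot> xx l \<cdot> inv\<^bsub>G\<^esub> h" "h \<in> carrier G" "l < n"
    using assms(2) unfolding positive_def by blast
  \<comment> \<open>The parity of the translation part of a conjugate of \<open>x\<^sub>k\<close> is the \<open>k\<close>-th unit vector.\<close>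
  have par: "odd (trans_of (g \<cdot> xx k \<cdot> inv\<^bsub>G\<^esub> g) j) \<longleftrightarrow> j = k" if "g \<in> carrier G" "k < n" for g j k
    using that even_trans_mult[of "g \<cdot> xx k" "inv\<^bsub>G\<^esub> g" j] even_trans_mult[of g "xx k" j]
      even_trans_inv[of g j] by (auto simp del: trans_of_mult trans_of_inv)
  obtain a where a: "a \<in> setA n" "p = p' \<cdot> a"
    using q_eqE[OF _ _ eq] positive_closed assms by metis
  have "odd (trans_of p k)" using par[OF p(2,3)] p(1) by simp
  then have "odd (trans_of p' k)"
    unfolding a(2) using even_trans_mult[of p' a k] positive_closed[OF assms(2)] A_closed[OF a(1)]
      even_trans_A[OF a(1) p(3)] by simp
  then have kl: "k = l" using par[OF p'(2,3)] p'(1) by simp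
  let ?t = "inv\<^bsub>G\<^esub> h \<cdot> g"
  have t: "?t \<in> carrier G" using p p' by simp
  have "q ?t \<star> wgen k = wgen k \<star> q ?t"
  proof -
    have 1: "p \<cdot> g = g \<cdot> xx k" "p' \<cdot> h = h \<cdot> xx k"
      unfolding p(1) p'(1) using p(2,3) p'(2,3) kl by (simp_all add: G.m_assoc)
    have "q g \<star> wgen k = q p \<star> q g"
      unfolding wgen_def using p(2,3) positive_closed[OF assms(1)] 1(1) by (simp flip: q.hom_mult)
    also have "q p \<star> q g = q (p' \<cdot> h) \<star> q ?t"
      unfolding eq using p(2) p'(2) positive_closed[OF assms(2)]
      by (simp add: W.m_assoc W.cancel_left)
    also have "\<dots> = q h \<star> (wgen k \<star> q ?t)"
      unfolding 1 wgen_def using p p' t by (simp add: W.m_assoc)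
    finally have "inv\<^bsub>W\<^esub> q h \<star> (q g \<star> wgen k) = wgen k \<star> q ?t"
      using p p' t by (simp add: W.cancel_left)
    then show ?thesis using p p' by (simp add: W.m_assoc)
  qed
  then have "q ?t = \<one>\<^bsub>W\<^esub> \<or> q ?t = wgen k" using t p by (intro centralizer_wgen) auto
  then have st: "sgn_of ?t k = 1"
  proof
    assume "q ?t = \<one>\<^bsub>W\<^esub>"
    then have "?t \<in> setA n" using q_eq_one_iff[OF t] by blast
    then show ?thesis by (rule sgn_of_A)
  next
    assume "q ?t = wgen k"
    then obtain b where b: "b \<in> setA n" "?t = xx k \<cdot> b"
      using q_eqE[OF t, of "xx k"] p by (auto simp: wgen_def)
    show ?thesis unfolding b(2) using p A_closed[OF b(1)] b(1) by simp
  qed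
  have "sgn_of g k = sgn_of (h \<cdot> ?t) k" using p p' by (simp add: G.cancel_left del: sgn_of_mult)
  also have "\<dots> = sgn_of h k" unfolding sgn_of_mult[OF p'(2) t] st by simp
  finally have "sgn_of g k = sgn_of h k" .
  then show ?thesis
    unfolding conj_gen_square[OF p(2,3,1)] conj_gen_square[OF p'(2,3,1)] kl by simp
qed

definition positive_hom :: "(G_elt \<Rightarrow> G_elt) \<Rightarrow> bool" where
  "positive_hom \<phi> \<longleftrightarrow> \<phi> \<in> hom G G \<and> (\<forall>i<n. \<phi> (xx i) \<in> positive)"

lemma positive_hom_positive:
  assumes \<phi>: "positive_hom \<phi>" and p: "p \<in> positive"
  shows "\<phi> p \<in> positive"
proof -
  interpret p: group_hom G G \<phi> using \<phi> by unfold_locales (simp add: positive_hom_def)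
  obtain g k where g: "p = g \<cdot> xx k \<cdot> inv\<^bsub>G\<^esub> g" "g \<in> carrier G" "k < n"
    using p unfolding positive_def by blast
  then show ?thesis using \<phi> conj_positive[of "\<phi> g" "\<phi> (xx k)"] by (simp add: positive_hom_def)
qed

lemma positive_hom_compose:
  "positive_hom \<phi> \<Longrightarrow> positive_hom \<psi> \<Longrightarrow> positive_hom (\<phi> \<circ> \<psi>)"
  unfolding positive_hom_def[of "\<phi> \<circ> \<psi>"]
  by (auto simp: positive_hom_positive) (auto simp: positive_hom_def intro: hom_compose positive_hom_positive)

lemma positive_hom_conj: "g \<in> carrier G \<Longrightarrow> positive_hom (conj_auto G g)"
  unfolding positive_hom_def using auto_hom[OF G.conj_auto_auto] conj_positive gen_positive by simp

lemma positive_hom_agree: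
  assumes \<phi>: "positive_hom \<phi>" and \<psi>: "positive_hom \<psi>"
    and eq: "\<And>g. g \<in> carrier G \<Longrightarrow> q (\<phi> g) = q (\<psi> g)" and a: "a \<in> setA n"
  shows "\<phi> a = \<psi> a"
proof (rule A_hom_eqI[OF G.is_group hom_restrict_A hom_restrict_A _ a])
  show h: "\<phi> \<in> hom G G" "\<psi> \<in> hom G G" using \<phi> \<psi> by (auto simp: positive_hom_def)
  fix i assume i: "i < n"
  have "\<phi> (xx i) \<cdot> \<phi> (xx i) = \<psi> (xx i) \<cdot> \<psi> (xx i)"
    by (rule positive_square_unique) (use i \<phi> \<psi> eq in \<open>auto simp: positive_hom_def\<close>)
  then show "\<phi> (sq n i) = \<psi> (sq n i)"
    using hom_mult[OF h(1), of "xx i" "xx i"] hom_mult[OF h(2), of "xx i" "xx i"] i by (simp add: sq_eq)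
qed

text \<open>An automorphism \<open>F\<close> of \<open>W\<close> maps each generator to a conjugate of a generator.  The induced map of
  indices is onto: if \<open>m\<close> were missed, the parity of the \<open>m\<close>-th translation component would vanish on
  the image of \<open>F\<close>.\<close>

lemma positive_hom_exists:
  assumes F: "F \<in> auto W"
  obtains \<phi> where "positive_hom \<phi>" "\<And>g. g \<in> carrier G \<Longrightarrow> q (\<phi> g) = F (q g)"
proof -
  interpret F: group_hom W W F by unfold_locales (rule auto_hom[OF F])
  have "\<exists>g k. g \<in> carrier G \<and> k < n \<and> q (g \<cdot> xx k \<cdot> inv\<^bsub>G\<^esub> g) = F (wgen i)" if i: "i < n" for i
  proof -
    have "F (wgen i) \<star> F (wgen i) = \<one>\<^bsub>W\<^esub>" using i F.hom_mult[of "wgen i" "wgen i"] by simp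
    moreover have "F (wgen i) \<noteq> \<one>\<^bsub>W\<^esub>"
      using auto_bij[OF F] wgen_not_one[OF i] F.hom_one wgen_closed[OF i] W.one_closed
      unfolding bij_betw_def inj_on_def by metis
    ultimately obtain v k where v: "v \<in> carrier W" "k < n" "F (wgen i) = v \<star> wgen k \<star> inv\<^bsub>W\<^esub> v"
      using involution_conjugate[of "F (wgen i)"] i by auto
    obtain g where g: "g \<in> carrier G" "v = q g" using v(1) by (rule W_lift)
    have "q (g \<cdot> xx k \<cdot> inv\<^bsub>G\<^esub> g) = F (wgen i)"
      using g v(2,3) by (simp add: wgen_def)
    then show ?thesis using g v by blast
  qed
  then obtain g k where gk: "\<And>i. i < n \<Longrightarrow> g i \<in> carrier G \<and> k i < n \<and>
      q (g i \<cdot> xx (k i) \<cdot> inv\<^bsub>G\<^esub> (g i)) = F (wgen i)"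
    by metis
  define p where "p i = g i \<cdot> xx (k i) \<cdot> inv\<^bsub>G\<^esub> (g i)" for i
  have k: "k i < n" and g: "g i \<in> carrier G" and qp: "q (p i) = F (wgen i)" if "i < n" for i
    using gk[OF that] by (auto simp: p_def)
  have pos: "p i \<in> positive" if "i < n" for i
    using k[OF that] g[OF that] unfolding positive_def p_def by blast
  note pc = positive_closed[OF pos]
  have "{..<n} \<subseteq> k ` {..<n}"
  proof (rule ccontr)
    assume "\<not> {..<n} \<subseteq> k ` {..<n}"
    then obtain m where m: "m < n" "\<And>i. i < n \<Longrightarrow> k i \<noteq> m" by blast
    have pm: "even (trans_of (p i) m)" if i: "i < n" for i
      unfolding p_def using i k[OF i] g[OF i] m even_trans_mult[of "g i \<cdot> xx (k i)" "inv\<^bsub>G\<^esub> g i" m]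
        even_trans_mult[of "g i" "xx (k i)" m] even_trans_inv[of "g i" m]
      by (auto simp del: trans_of_mult trans_of_inv)
    have step: "\<exists>h\<in>carrier G. q h = F (q y) \<and> even (trans_of h m)" if "y \<in> carrier G" for y
      using that
    proof (induction rule: G_induct)
      case one
      then show ?case by (intro bexI[of _ "\<one>\<^bsub>G\<^esub>"]) auto
    next
      case (gen i y)
      then obtain h where "h \<in> carrier G" "q h = F (q y)" "even (trans_of h m)" by blast
      then show ?case using gen pc[OF gen(1)] pm[OF gen(1)] qp[OF gen(1)]
        by (intro bexI[of _ "p i \<cdot> h"]) (auto simp: even_trans_mult wgen_def simp del: trans_of_mult)
    next
      case (inv i y)
      then obtain h where "h \<in> carrier G" "q h = F (q y)" "even (trans_of h m)" by blast
      then show ?case using inv pc[OF inv(1)] pm[OF inv(1)] qp[OF inv(1)]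
        by (intro bexI[of _ "inv\<^bsub>G\<^esub> p i \<cdot> h"])
          (auto simp: even_trans_mult even_trans_inv wgen_def simp del: trans_of_mult trans_of_inv)
    qed
    have "wgen m \<in> F ` carrier W" using auto_bij[OF F] m by (simp add: bij_betw_def)
    then obtain w where w: "w \<in> carrier W" "F w = wgen m" by force
    obtain y where y: "y \<in> carrier G" "w = q y" using w(1) by (rule W_lift)
    obtain h where h: "h \<in> carrier G" "q h = F (q y)" "even (trans_of h m)" using step[OF y(1)] by blast
    have "q h = q (xx m)" using h y w by (simp add: wgen_def)
    then obtain a where a: "a \<in> setA n" "h = xx m \<cdot> a" using q_eqE[of h "xx m"] h m by auto
    show False
      using h(3) even_trans_mult[of "xx m" a m] even_trans_A[OF a(1) m(1)] A_closed[OF a(1)] m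
      unfolding a(2) by (simp del: trans_of_mult)
  qed
  then have inj: "inj_on k {..<n}" by (intro finite_surj_inj) auto
  have "\<exists>\<phi>\<in>hom G G. \<forall>i<n. \<phi> (xx i) = p i"
  proof (rule G_hom_exists[OF G.is_group pc])
    fix i j assume ij: "i < n" "j < n" "i \<noteq> j"
    have kij: "k i \<noteq> k j" using inj ij by (auto simp: inj_on_def)
    let ?s = "sq n (k j) [^]\<^bsub>G\<^esub> sgn_of (g j) (k j)"
    have s: "p j \<cdot> p j = ?s" by (rule conj_gen_square) (use g[OF ij(2)] k[OF ij(2)] p_def in auto)
    have "sgn_of (g i) (k j) * sgn_of (g i) (k j) = 1" using sgn_of_square g[OF ij(1)] by blast
    then have sg: "sgn_of (p i) (k j) = -1"
      unfolding p_def using g[OF ij(1)] k[OF ij(1)] kij by simp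
    have "inv\<^bsub>G\<^esub> p i \<cdot> ?s \<cdot> inv\<^bsub>G\<^esub> (inv\<^bsub>G\<^esub> p i)
      = (sq n (k j) [^]\<^bsub>G\<^esub> sgn_of (p i) (k j)) [^]\<^bsub>G\<^esub> sgn_of (g j) (k j)"
      using conj_pow[of "inv\<^bsub>G\<^esub> p i" "sq n (k j)"] conj_sq[of "inv\<^bsub>G\<^esub> p i" "k j"] pc[OF ij(1)] k[OF ij(2)]
      by (simp del: G.inv_inv)
    also have "\<dots> = inv\<^bsub>G\<^esub> ?s"
      unfolding sg using k[OF ij(2)] by (simp add: G.int_pow_pow G.int_pow_neg[symmetric])
    finally show "inv\<^bsub>G\<^esub> p i \<cdot> (p j \<cdot> p j) \<cdot> p i = inv\<^bsub>G\<^esub> (p j \<cdot> p j)"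
      unfolding s using pc[OF ij(1)] by simp
  qed
  then obtain \<phi> where \<phi>: "\<phi> \<in> hom G G" "\<And>i. i < n \<Longrightarrow> \<phi> (xx i) = p i" by blast
  have "q (\<phi> y) = F (q y)" if "y \<in> carrier G" for y
  proof -
    have "(q \<circ> \<phi>) y = (F \<circ> q) y"
      by (rule hom_eqI[OF W.is_group hom_compose[OF \<phi>(1) q_hom] hom_compose[OF q_hom auto_hom[OF F]] _ that])
        (simp add: \<phi>(2) qp wgen_def)
    then show ?thesis by simp
  qed
  moreover have "positive_hom \<phi>" using \<phi> pos by (simp add: positive_hom_def)
  ultimately show ?thesis using that by blast
qed

text \<open>The composites of the lifts of \<open>F\<close> and of its inverse are positive lifts of the identity of \<open>W\<close>, so by
  \<open>positive_hom_agree\<close> they are the identity on \<open>A\<close>; the five lemma applies.\<close>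

lemma positive_auto_exists:
  assumes F: "F \<in> auto W"
  obtains \<phi> where "\<phi> \<in> auto G" "positive_hom \<phi>" "\<forall>g\<in>carrier G. q (\<phi> g) = F (q g)"
proof -
  let ?F = "inv\<^bsub>AutoGroup W\<^esub> F"
  have F': "?F \<in> auto W" using group.inv_closed[OF W.AutoGroup, of F] F by simp
  obtain \<phi> where \<phi>: "positive_hom \<phi>" "\<And>g. g \<in> carrier G \<Longrightarrow> q (\<phi> g) = F (q g)"
    using positive_hom_exists[OF F] by blast
  obtain \<psi> where \<psi>: "positive_hom \<psi>" "\<And>g. g \<in> carrier G \<Longrightarrow> q (\<psi> g) = ?F (q g)"
    using positive_hom_exists[OF F'] by blast
  have h: "\<phi> \<in> hom G G" "\<psi> \<in> hom G G" using \<phi> \<psi> by (auto simp: positive_hom_def)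
  have id: "positive_hom (\<lambda>g. g)" using gen_positive by (auto simp: positive_hom_def intro: homI)
  have A: "\<phi> a \<in> setA n" "\<psi> a \<in> setA n" if "a \<in> setA n" for a
    using that A_closed[OF that] \<phi>(2)[of a] \<psi>(2)[of a] q_eq_one_iff[of "\<phi> a"] q_eq_one_iff[of "\<psi> a"]
      hom_in_carrier[OF h(1)] hom_in_carrier[OF h(2)]
      hom_one[OF auto_hom[OF F] W.is_group W.is_group] hom_one[OF auto_hom[OF F'] W.is_group W.is_group]
    by simp_all
  have c: "\<phi> (\<psi> a) = a" "\<psi> (\<phi> a) = a" if a: "a \<in> setA n" for a
  proof -
    have "(\<phi> \<circ> \<psi>) a = a" "(\<psi> \<circ> \<phi>) a = a"
      by (rule positive_hom_agree[OF positive_hom_compose[OF \<phi>(1) \<psi>(1)] id _ a],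
          simp add: \<phi> \<psi> hom_in_carrier[OF h(2)] AutoGroup_app_inv[OF W.is_group F],
          rule positive_hom_agree[OF positive_hom_compose[OF \<psi>(1) \<phi>(1)] id _ a],
          simp add: \<phi> \<psi> hom_in_carrier[OF h(1)] AutoGroup_inv_app[OF W.is_group F])
    then show "\<phi> (\<psi> a) = a" "\<psi> (\<phi> a) = a" by auto
  qed
  have "restrict \<phi> (carrier G) \<in> auto G"
  proof (rule auto_of_hom[OF h(1)])
    show "bij_betw \<phi> (setA n) (setA n)"
      by (rule bij_betw_byWitness[where f' = \<psi>]) (use A c in auto)
    show "q g = \<one>\<^bsub>W\<^esub>" if "g \<in> carrier G" "q (\<phi> g) = \<one>\<^bsub>W\<^esub>" for g
    proof -
      have "F (q g) = F \<one>\<^bsub>W\<^esub>"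
        using \<phi>(2)[OF that(1)] that(2) hom_one[OF auto_hom[OF F] W.is_group W.is_group] by simp
      then show ?thesis
        using auto_bij[OF F] that(1) inj_onD[of F "carrier W" "q g" "\<one>\<^bsub>W\<^esub>"] by (simp add: bij_betw_def)
    qed
    show "\<exists>g\<in>carrier G. q (\<phi> g) = w" if w: "w \<in> carrier W" for w
    proof -
      have "w \<in> F ` carrier W" using auto_bij[OF F] w by (simp add: bij_betw_def)
      then obtain v where v: "v \<in> carrier W" "F v = w" by force
      obtain g where "g \<in> carrier G" "v = q g" using v(1) by (rule W_lift)
      then show ?thesis using \<phi>(2) v by blast
    qed
  qed
  moreover have "positive_hom (restrict \<phi> (carrier G))"
    using \<phi>(1) auto_hom[OF calculation] by (simp add: positive_hom_def)
  ultimately show ?thesis using that[of "restrict \<phi> (carrier G)"] \<phi>(2) by simp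
qed


section \<open>Module automorphisms of \<open>A\<close>\<close>

text \<open>The automorphism maps \<open>x\<^sub>i\<close> to itself or to its inverse.  Both act on \<open>A\<close> in the same way, which
  preserves the relations.\<close>

lemma sign_auto_exists:
  obtains \<phi> where "\<phi> \<in> auto G" "\<And>g. g \<in> carrier G \<Longrightarrow> q (\<phi> g) = q g"
    "\<And>i. i < n \<Longrightarrow> \<phi> (sq n i) = (if c i then inv\<^bsub>G\<^esub> sq n i else sq n i)"
proof -
  let ?y = "\<lambda>i. if c i then inv\<^bsub>G\<^esub> xx i else xx i"
  have sq: "?y j \<cdot> ?y j = (if c j then inv\<^bsub>G\<^esub> sq n j else sq n j)" if "j < n" for j
    using that by (simp add: sq_eq G.inv_mult_group)
  have yc: "?y i \<in> carrier G" if "i < n" for i using that by simp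
  have "\<exists>\<phi>\<in>hom G G. \<forall>i<n. \<phi> (xx i) = ?y i"
  proof (rule G_hom_exists[OF G.is_group yc])
    fix i j assume ij: "i < n" "j < n" "i \<noteq> j"
    define y where "y = inv\<^bsub>G\<^esub> ?y i"
    have y: "y \<in> carrier G" "inv\<^bsub>G\<^esub> y = ?y i" "sgn_of y j = -1" using ij by (auto simp: y_def)
    have 1: "y \<cdot> sq n j \<cdot> inv\<^bsub>G\<^esub> y = inv\<^bsub>G\<^esub> sq n j"
      using conj_sq[OF y(1) ij(2)] y(3) ij by (simp add: G.int_pow_neg)
    have 2: "y \<cdot> inv\<^bsub>G\<^esub> sq n j \<cdot> inv\<^bsub>G\<^esub> y = sq n j"
      using conj_pow[OF y(1) sq_closed[OF ij(2)], of "-1"] 1 ij by (simp add: G.int_pow_neg)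
    have "y \<cdot> (?y j \<cdot> ?y j) \<cdot> inv\<^bsub>G\<^esub> y = inv\<^bsub>G\<^esub> (?y j \<cdot> ?y j)"
      unfolding sq[OF ij(2)] using 1 2 ij by simp
    then show "inv\<^bsub>G\<^esub> ?y i \<cdot> (?y j \<cdot> ?y j) \<cdot> ?y i = inv\<^bsub>G\<^esub> (?y j \<cdot> ?y j)"
      unfolding y(2) unfolding y_def .
  qed
  then obtain \<phi> where \<phi>: "\<phi> \<in> hom G G" "\<And>i. i < n \<Longrightarrow> \<phi> (xx i) = ?y i" by blast
  have s: "\<phi> (sq n i) = (if c i then inv\<^bsub>G\<^esub> sq n i else sq n i)" if "i < n" for i
    using that hom_mult[OF \<phi>(1), of "xx i" "xx i"] \<phi>(2)[OF that] sq[OF that] by (simp add: sq_eq)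
  have Q: "q (\<phi> g) = q g" if "g \<in> carrier G" for g
  proof -
    have "(q \<circ> \<phi>) g = q g"
      by (rule hom_eqI[OF W.is_group hom_compose[OF \<phi>(1) q_hom] q_hom _ that])
        (use wgen_inv in \<open>simp add: \<phi>(2) wgen_def\<close>)
    then show ?thesis by simp
  qed
  interpret p: group_hom G G \<phi> by unfold_locales (rule \<phi>(1))
  have A: "\<phi> a \<in> setA n" if "a \<in> setA n" for a
    using Q[of a] q_eq_one_iff[of "\<phi> a"] A_closed[OF that] that by simp
  have AA: "\<phi> (\<phi> a) = a" if "a \<in> setA n" for a
  proof -
    have "(\<phi> \<circ> \<phi>) a = a"
    proof (rule A_hom_eqI[OF G.is_group hom_restrict_A[OF hom_compose[OF \<phi>(1) \<phi>(1)]] _ _ that])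
      show "(\<lambda>a. a) \<in> hom A G" using A_closed by (intro homI) auto
      show "(\<phi> \<circ> \<phi>) (sq n i) = sq n i" if "i < n" for i using that by (simp add: s)
    qed
    then show ?thesis by simp
  qed
  have "restrict \<phi> (carrier G) \<in> auto G"
  proof (rule auto_of_hom[OF \<phi>(1)])
    show "bij_betw \<phi> (setA n) (setA n)"
      by (rule bij_betw_byWitness[where f' = \<phi>]) (use A AA in auto)
    show "\<exists>g\<in>carrier G. q (\<phi> g) = w" if "w \<in> carrier W" for w
      using that carrier_W Q by auto
  qed (use Q in auto)
  then show ?thesis using that[of "restrict \<phi> (carrier G)"] Q s by simp
qed

text \<open>A module automorphism preserves the fixed points of \<open>x\<^sub>i\<close>, which are the powers of \<open>x\<^sub>i\<^sup>2\<close>.  So does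
  its inverse, and the two exponents multiply to 1.\<close>

lemma AutWA_sq:
  assumes f: "f \<in> carrier (AutWA n)" and i: "i < n"
  shows "f (sq n i) = sq n i \<or> f (sq n i) = inv\<^bsub>G\<^esub> sq n i"
proof -
  interpret M: group "AutWA n" by (rule group_AutWA)
  have pow: "\<exists>c. f (sq n i) = sq n i [^]\<^bsub>G\<^esub> (c::int)" if f: "f \<in> carrier (AutWA n)" for f
  proof -
    have "f \<in> auto A" using f by (simp add: mod_Aut_carrier)
    then have m: "f (sq n i) \<in> setA n" using auto_closed[of f A "sq n i"] i by simp
    have "actW n (wgen i) (sq n i) = sq n i"
      unfolding wgen_def using i by (simp add: actW_q conj_sq)
    then have "actW n (wgen i) (f (sq n i)) = f (sq n i)"
      using f i by (metis mod_Aut_carrier carrier_A sq_mem wgen_closed)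
    then show ?thesis using fixed_by_gen[OF m i] by metis
  qed
  obtain c where c: "f (sq n i) = sq n i [^]\<^bsub>G\<^esub> (c::int)" using pow[OF f] by blast
  let ?g = "inv\<^bsub>AutWA n\<^esub> f"
  have g: "?g \<in> carrier (AutWA n)" using f by simp
  obtain d where d: "?g (sq n i) = sq n i [^]\<^bsub>G\<^esub> (d::int)" using pow[OF g] by blast
  have fa: "f \<in> auto A" "?g \<in> auto A" using f g by (auto simp: mod_Aut_carrier)
  interpret f: group_hom A A f by unfold_locales (rule auto_hom[OF fa(1)])
  have pw: "a [^]\<^bsub>A\<^esub> (m::int) = a [^]\<^bsub>G\<^esub> m" if "a \<in> setA n" for a m
    unfolding grpA_def by (rule G.int_pow_consistent[OF subgroup_A that, symmetric])
  have "f (?g (sq n i)) = sq n i"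
    using M.r_inv[OF f] fa i by (simp add: mod_Aut_mult mod_Aut_one compose_def fun_eq_iff) (metis sq_mem)
  moreover have "f (sq n i [^]\<^bsub>G\<^esub> d) = sq n i [^]\<^bsub>G\<^esub> (c * d)"
    using f.hom_int_pow[of "sq n i" d] c i sq_pow_mem[OF i]
    by (simp add: pw G.int_pow_pow)
  ultimately have "c * d = 1"
    using d sq_pow_eq_iff[OF i, of "c * d" 1] i by simp
  then have "c = 1 \<or> c = -1" by (auto simp: zmult_eq_1_iff)
  then have "sq n i [^]\<^bsub>G\<^esub> c = sq n i \<or> sq n i [^]\<^bsub>G\<^esub> c = inv\<^bsub>G\<^esub> sq n i"
    using i by (elim disjE) (simp_all add: G.int_pow_neg)
  then show ?thesis unfolding c .
qed

end

context square_inversion3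
begin

section \<open>The exact row of \<open>Aut(G)\<close>\<close>

lemma one_AutSA: "\<one>\<^bsub>AutSA n\<^esub> = (\<lambda>a\<in>setA n. a, \<lambda>w\<in>carrier W. w)"
  by (simp add: semilin_one)

lemma AutSA_snd_hom: "snd \<in> hom (AutSA n) (AutoGroup W)"
  by (intro homI) (auto simp: semilin_mem semilin_mult simp del: mult_AutoGroup)

sublocale SA: group "AutSA n" by (rule group_AutSA)

sublocale WA: group "AutWA n" by (rule group_AutWA)

sublocale AG: group "AutG n" by (rule G.AutoGroup)

sublocale AW: group "AutoGroup W" by (rule W.AutoGroup)

sublocale r: group_hom "AutG n" "AutSA n" r
  by unfold_locales (rule r_hom)

sublocale snd: group_hom "AutSA n" "AutoGroup W" snd
  by unfold_locales (rule AutSA_snd_hom)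

lemma AutWA_fst:
  assumes "p \<in> carrier (AutSA n)" "snd p = (\<lambda>w\<in>carrier W. w)"
  shows "fst p \<in> carrier (AutWA n)" "p = (fst p, \<lambda>w\<in>carrier W. w)"
  using assms by (auto simp: mod_Aut_carrier semilin_mem prod_eq_iff)

lemma AutWA_pair: "f \<in> carrier (AutWA n) \<Longrightarrow> (f, \<lambda>w\<in>carrier W. w) \<in> carrier (AutSA n)"
  using mod_Aut_mem[OF W.is_group, of f A "actW n"] by (simp add: mod_Aut_carrier)

lemma AutWA_eqI:
  assumes "f \<in> carrier (AutWA n)" "g \<in> carrier (AutWA n)" "\<And>i. i < n \<Longrightarrow> f (sq n i) = g (sq n i)"
  shows "f = g"
proof (rule auto_eqI[of _ A])
  show f: "f \<in> auto A" "g \<in> auto A" using assms by (auto simp: mod_Aut_carrier)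
  show "f a = g a" if "a \<in> carrier A" for a
    by (rule A_hom_eqI[OF A.is_group auto_hom[OF f(1)] auto_hom[OF f(2)] assms(3)]) (use that in simp_all)
qed

lemma AutWA_lift:
  assumes f: "f \<in> carrier (AutWA n)"
  shows "\<exists>\<phi>\<in>auto G. r \<phi> = (f, \<lambda>w\<in>carrier W. w)"
proof -
  obtain \<phi> where \<phi>: "\<phi> \<in> auto G" "\<And>g. g \<in> carrier G \<Longrightarrow> q (\<phi> g) = q g"
    "\<And>i. i < n \<Longrightarrow> \<phi> (sq n i) = (if f (sq n i) \<noteq> sq n i then inv\<^bsub>G\<^esub> sq n i else sq n i)"
    using sign_auto_exists[of "\<lambda>i. f (sq n i) \<noteq> sq n i"] by blast
  have fa: "f \<in> auto A" using f by (simp add: mod_Aut_carrier)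
  have "\<phi> a = f a" if "a \<in> setA n" for a
  proof (rule A_hom_eqI[OF G.is_group hom_restrict_A[OF auto_hom[OF \<phi>(1)]] _ _ that])
    show "f \<in> hom A G"
      using hom_in_carrier[OF auto_hom[OF fa]] hom_mult[OF auto_hom[OF fa]] A_closed
      by (intro homI) auto
    show "\<phi> (sq n i) = f (sq n i)" if "i < n" for i using AutWA_sq[OF f that] \<phi>(3)[OF that] by auto
  qed
  then have "r \<phi> = (f, \<lambda>w\<in>carrier W. w)"
    using r_eq_iff[OF \<phi>(1) AutWA_pair[OF f]] \<phi>(2) by simp
  then show ?thesis using \<phi>(1) by blast
qed

lemma positive_lift:
  assumes F: "F \<in> auto W"
  obtains \<phi> where "\<phi> \<in> auto G" "positive_hom \<phi>" "snd (r \<phi>) = F"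
proof -
  obtain \<phi> where \<phi>: "\<phi> \<in> auto G" "positive_hom \<phi>" "\<forall>g\<in>carrier G. q (\<phi> g) = F (q g)"
    by (rule positive_auto_exists[OF F])
  have "snd (r \<phi>) = F"
  proof (rule auto_eqI[of _ W])
    show "snd (r \<phi>) \<in> auto W" using r_mem[OF \<phi>(1)] by (simp add: semilin_mem)
    fix w assume "w \<in> carrier W"
    then obtain g where "g \<in> carrier G" "w = q g" by (rule W_lift)
    then show "snd (r \<phi>) w = F w" using r_snd[OF \<phi>(1)] \<phi>(3) by simp
  qed (rule F)
  then show ?thesis using \<phi>(1,2) that by simp
qed

text \<open>After division by the positive lift of \<open>snd p\<close>, the component on \<open>W\<close> is the identity and
  the other one is a module automorphism.\<close>

lemma r_surj:
  assumes p: "p \<in> carrier (AutSA n)"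
  shows "\<exists>\<phi>\<in>auto G. r \<phi> = p"
proof -
  have F: "snd p \<in> auto W" using p by (simp add: semilin_mem)
  obtain \<psi> where \<psi>: "\<psi> \<in> auto G" and "positive_hom \<psi>" and s: "snd (r \<psi>) = snd p"
    by (rule positive_lift[OF F])
  let ?p = "p \<otimes>\<^bsub>AutSA n\<^esub> inv\<^bsub>AutSA n\<^esub> r \<psi>"
  have pc: "?p \<in> carrier (AutSA n)" using p r_mem[OF \<psi>] by simp
  have "snd ?p = \<one>\<^bsub>AutoGroup W\<^esub>"
    using p r_mem[OF \<psi>] s F AW.r_inv[of "snd p"] by (simp del: one_AutoGroup mult_AutoGroup)
  then have sp: "snd ?p = (\<lambda>w\<in>carrier W. w)" by simp
  obtain \<phi> where \<phi>: "\<phi> \<in> auto G" "r \<phi> = ?p"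
    using AutWA_lift[OF AutWA_fst(1)[OF pc sp]] AutWA_fst(2)[OF pc sp] by metis
  have "r (\<phi> \<otimes>\<^bsub>AutG n\<^esub> \<psi>) = ?p \<otimes>\<^bsub>AutSA n\<^esub> r \<psi>" using \<phi> \<psi> by (simp del: mult_AutoGroup)
  also have "\<dots> = p" using p r_mem[OF \<psi>] by (simp add: SA.m_assoc)
  finally have "r (\<phi> \<otimes>\<^bsub>AutG n\<^esub> \<psi>) = p" .
  moreover have "\<phi> \<otimes>\<^bsub>AutG n\<^esub> \<psi> \<in> auto G" using AG.m_closed[of \<phi> \<psi>] \<phi> \<psi> by simp
  ultimately show ?thesis by blast
qed

lemma ses_AutG: "ses (M0 n) (tmap n) (AutG n) r (AutSA n)"
proof (rule sesI[OF group_M0 AG.is_group SA.is_group tmap_hom r_hom])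
  fix M assume M: "M \<in> carrier (M0 n)"
  show "tmap n M = \<one>\<^bsub>AutG n\<^esub> \<Longrightarrow> M = \<one>\<^bsub>M0 n\<^esub>"
    using tmap_inj M unfolding mon_iff_hom_one[OF group_M0 AG.is_group] by blast
  show "r (tmap n M) = \<one>\<^bsub>AutSA n\<^esub>"
    using r_eq_iff[OF tmap_auto[OF M] SA.one_closed] tmap_A[OF M _ G.one_closed]
      tmap_q[OF M A_sub.one_closed] by (simp add: one_AutSA)
next
  fix p assume "p \<in> carrier (AutSA n)"
  then show "\<exists>\<phi>\<in>carrier (AutG n). r \<phi> = p" using r_surj by simp
next
  fix \<phi> assume \<phi>: "\<phi> \<in> carrier (AutG n)" "r \<phi> = \<one>\<^bsub>AutSA n\<^esub>"
  then have "\<phi> a = a" if "a \<in> setA n" for a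
    using that r_eq_iff[of \<phi>, OF _ SA.one_closed] by (simp add: one_AutSA)
  moreover have "q (\<phi> g) = q g" if "g \<in> carrier G" for g
    using that \<phi> r_eq_iff[of \<phi>, OF _ SA.one_closed] by (simp add: one_AutSA)
  ultimately show "\<exists>M\<in>carrier (M0 n). tmap n M = \<phi>" using tmap_range \<phi>(1) by (metis carrier_AutoGroup)
qed


section \<open>The columns of \<open>A\<close>, \<open>G\<close> and \<open>W\<close>\<close>

lemma ses_G: "ses A (\<lambda>a. a) G q W"
proof (rule sesI[OF A.is_group G.is_group W.is_group _ q_hom])
  show "(\<lambda>a. a) \<in> hom A G" using A_closed by (intro homI) auto
  show "\<exists>x\<in>carrier A. x = y" if "y \<in> carrier G" "q y = \<one>\<^bsub>W\<^esub>" for y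
    using that q_eq_one_iff by simp
qed (auto simp: carrier_W)

lemma W_to_AutSA_mem: "w \<in> carrier W \<Longrightarrow> W_to_AutSA n w \<in> carrier (AutSA n)"
  by (metis W_lift r_conj r_mem G.conj_auto_auto)

lemma W_to_AutSA_mon: "W_to_AutSA n \<in> mon W (AutSA n)"
  unfolding mon_iff_hom_one[OF W.is_group SA.is_group]
proof (intro conjI allI impI)
  show "W_to_AutSA n \<in> hom W (AutSA n)"
  proof (rule homI)
    fix v w assume v: "v \<in> carrier W" and w: "w \<in> carrier W"
    obtain g where g: "g \<in> carrier G" "v = q g" using v by (rule W_lift)
    obtain h where h: "h \<in> carrier G" "w = q h" using w by (rule W_lift)
    have "W_to_AutSA n (v \<star> w) = r (conj_auto G (g \<cdot> h))" using g h by (simp add: r_conj)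
    also have "\<dots> = r (conj_auto G g) \<otimes>\<^bsub>AutSA n\<^esub> r (conj_auto G h)"
      using g h by (subst hom_mult[OF G.conj_auto_hom]) (simp_all del: mult_AutoGroup)
    finally show "W_to_AutSA n (v \<star> w) = W_to_AutSA n v \<otimes>\<^bsub>AutSA n\<^esub> W_to_AutSA n w"
      using g h by (simp add: r_conj)
  qed (rule W_to_AutSA_mem)
  fix w assume "w \<in> carrier W \<and> W_to_AutSA n w = \<one>\<^bsub>AutSA n\<^esub>"
  then have w: "w \<in> carrier W" "W_to_AutSA n w = \<one>\<^bsub>AutSA n\<^esub>" by auto
  show "w = \<one>\<^bsub>W\<^esub>"
  proof (rule centre_W[OF w(1)])
    fix v assume v: "v \<in> carrier W"
    have "conj_auto W w v = v" using w(2) v by (simp add: one_AutSA W_to_AutSA_def del: conj_auto_app)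
    then show "w \<star> v = v \<star> w"
      using v w(1) W.inv_solve_right'[of v "w \<star> v" w] by auto
  qed
qed

text \<open>The subgroup is the image of the inner automorphisms of \<open>G\<close> under a surjective homomorphism.\<close>

lemma W_to_AutSA_normal: "W_to_AutSA n ` carrier W \<lhd> AutSA n"
proof -
  have "W_to_AutSA n ` carrier W = r ` Inn G"
    unfolding carrier_W Inn_def image_image using r_conj by (intro image_cong) auto
  moreover have "r ` carrier (AutG n) = carrier (AutSA n)"
    using r_surj r_mem by (auto simp: image_iff Bex_def) metis
  ultimately show ?thesis
    using hom_image_normal[OF AG.is_group SA.is_group r_hom _ G.Inn_normal] by simp
qed

lemma ses_AutSA_class:
  "ses W (W_to_AutSA n) (AutSA n) (AutSA_class n) (AutSA_mod_W n)"
  unfolding AutSA_class_def AutSA_mod_W_def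
  by (rule ses_Mod[OF W.is_group SA.is_group W_to_AutSA_mon W_to_AutSA_normal])

sublocale QS: group "AutSA_mod_W n"
  using sesD(3)[OF ses_AutSA_class] .

sublocale cl: group_hom "AutSA n" "AutSA_mod_W n" "AutSA_class n"
  by unfold_locales (rule sesD(5)[OF ses_AutSA_class])

sublocale OW: group "OutW n" by (rule W.group_Out)

sublocale ow: group_hom "AutoGroup W" "OutW n" "out_class W"
  by unfold_locales (rule W.out_class_hom)

lemma AutSA_class_W:
  assumes "w \<in> carrier W" "p \<in> carrier (AutSA n)"
  shows "AutSA_class n (W_to_AutSA n w \<otimes>\<^bsub>AutSA n\<^esub> p) = AutSA_class n p"
  using assms sesD(10)[OF ses_AutSA_class assms(1)] W_to_AutSA_mem by simp

lemma carrier_AutSA_mod_W: "carrier (AutSA_mod_W n) = AutSA_class n ` carrier (AutSA n)"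
  by (simp add: AutSA_mod_W_def AutSA_class_def carrier_FactGroup)

lemma out_class_conj:
  assumes "w \<in> carrier W" "F \<in> auto W"
  shows "out_class W (conj_auto W w \<otimes>\<^bsub>AutoGroup W\<^esub> F) = out_class W F"
  using assms AW.m_closed[of "conj_auto W w" F] by (subst W.out_class_eq_iff) auto

lemma ext_proj_class:
  assumes p: "p \<in> carrier (AutSA n)"
  shows "ext_proj n (AutSA_class n p) = out_class W (snd p)"
proof -
  have "subgroup (W_to_AutSA n ` carrier W) (AutSA n)"
    using W_to_AutSA_normal normal_imp_subgroup by blast
  then have "the_elem ((\<lambda>x. out_class W (snd x)) ` AutSA_class n p) = out_class W (snd p)"
    unfolding AutSA_class_def
  proof (rule the_elem_coset[OF SA.is_group _ p])
    fix k assume "k \<in> W_to_AutSA n ` carrier W"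
    then obtain w where w: "w \<in> carrier W" "k = W_to_AutSA n w" by blast
    then show "out_class W (snd (k \<otimes>\<^bsub>AutSA n\<^esub> p)) = out_class W (snd p)"
      using p out_class_conj[OF w(1), of "snd p"]
      by (simp add: semilin_mult semilin_mem W_to_AutSA_def del: mult_AutoGroup)
  qed
  then show ?thesis by (simp add: ext_proj_def case_prod_unfold)
qed


section \<open>The extension of \<open>Out(W)\<close> and its splitting\<close>

text \<open>If the component on \<open>W\<close> of a semi-linear automorphism is conjugation by \<open>w\<close>, then dividing by the image
  of \<open>w\<close> leaves a module automorphism without changing the class.\<close>

lemma ses_ext: "ses (AutWA n) (ext_incl n) (AutSA_mod_W n) (ext_proj n) (OutW n)"
proof (rule sesI[OF WA.is_group QS.is_group OW.is_group])
  show "ext_incl n \<in> hom (AutWA n) (AutSA_mod_W n)"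
  proof (rule homI)
    fix f g assume fg: "f \<in> carrier (AutWA n)" "g \<in> carrier (AutWA n)"
    have "(f \<otimes>\<^bsub>AutWA n\<^esub> g, \<lambda>w\<in>carrier W. w)
      = (f, \<lambda>w\<in>carrier W. w) \<otimes>\<^bsub>AutSA n\<^esub> (g, \<lambda>w\<in>carrier W. w)"
      using AW.l_one[OF AW.one_closed] by (simp add: semilin_mult mod_Aut_mult)
    then show "ext_incl n (f \<otimes>\<^bsub>AutWA n\<^esub> g) = ext_incl n f \<otimes>\<^bsub>AutSA_mod_W n\<^esub> ext_incl n g"
      unfolding ext_incl_def using fg by (simp add: AutWA_pair)
  qed (simp add: ext_incl_def AutWA_pair)
  show "ext_proj n \<in> hom (AutSA_mod_W n) (OutW n)"
  proof (rule homI)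
    fix P assume "P \<in> carrier (AutSA_mod_W n)"
    then obtain p where p: "p \<in> carrier (AutSA n)" "P = AutSA_class n p" using carrier_AutSA_mod_W by auto
    have ps: "snd p \<in> auto W" using p by (simp add: semilin_mem)
    show "ext_proj n P \<in> carrier (OutW n)" using p ps by (simp add: ext_proj_class W.carrier_Out)
    fix Q assume "Q \<in> carrier (AutSA_mod_W n)"
    then obtain p' where p': "p' \<in> carrier (AutSA n)" "Q = AutSA_class n p'" using carrier_AutSA_mod_W by auto
    have ps': "snd p' \<in> auto W" using p' by (simp add: semilin_mem)
    show "ext_proj n (P \<otimes>\<^bsub>AutSA_mod_W n\<^esub> Q) = ext_proj n P \<otimes>\<^bsub>OutW n\<^esub> ext_proj n Q"
      using p p' ps ps' ext_proj_class[of "p \<otimes>\<^bsub>AutSA n\<^esub> p'"] by (simp add: ext_proj_class del: mult_AutoGroup)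
  qed
  show "f = \<one>\<^bsub>AutWA n\<^esub>" if f: "f \<in> carrier (AutWA n)" "ext_incl n f = \<one>\<^bsub>AutSA_mod_W n\<^esub>" for f
  proof -
    obtain w where w: "w \<in> carrier W" "W_to_AutSA n w = (f, \<lambda>w\<in>carrier W. w)"
      using sesD(11)[OF ses_AutSA_class AutWA_pair[OF f(1)]] f(2) by (auto simp: ext_incl_def)
    have "w = \<one>\<^bsub>W\<^esub>"
    proof (rule centre_W[OF w(1)])
      fix v assume v: "v \<in> carrier W"
      have "snd (W_to_AutSA n w) v = v" using w(2) v by simp
      then have "w \<star> v \<star> inv\<^bsub>W\<^esub> w = v" using v by (simp add: W_to_AutSA_def)
      then show "w \<star> v = v \<star> w" using v w(1) W.inv_solve_right'[of v "w \<star> v" w] by auto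
    qed
    then have "W_to_AutSA n w = \<one>\<^bsub>AutSA n\<^esub>"
      using hom_one[OF sesD(4)[OF ses_AutSA_class] W.is_group SA.is_group] by simp
    then show ?thesis using w(2) by (simp add: one_AutSA mod_Aut_one)
  qed
  show "\<exists>P\<in>carrier (AutSA_mod_W n). ext_proj n P = x" if x: "x \<in> carrier (OutW n)" for x
  proof -
    obtain F where F: "F \<in> auto W" "x = out_class W F" using x W.carrier_Out by auto
    obtain \<phi> where \<phi>: "\<phi> \<in> auto G" and "positive_hom \<phi>" and "snd (r \<phi>) = F"
      by (rule positive_lift[OF F(1)])
    then show ?thesis using ext_proj_class[OF r_mem[OF \<phi>]] F r_mem[OF \<phi>]
      by (intro bexI[of _ "AutSA_class n (r \<phi>)"]) auto
  qed
  show "ext_proj n (ext_incl n f) = \<one>\<^bsub>OutW n\<^esub>" if "f \<in> carrier (AutWA n)" for f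
    unfolding ext_incl_def using ext_proj_class[OF AutWA_pair[OF that]] ow.hom_one by simp
  show "\<exists>f\<in>carrier (AutWA n). ext_incl n f = P"
    if P: "P \<in> carrier (AutSA_mod_W n)" and one: "ext_proj n P = \<one>\<^bsub>OutW n\<^esub>" for P
  proof -
    obtain p where p: "p \<in> carrier (AutSA n)" "P = AutSA_class n p"
      using P carrier_AutSA_mod_W by blast
    have F: "snd p \<in> auto W" using p by (simp add: semilin_mem)
    have "out_class W (snd p) = out_class W \<one>\<^bsub>AutoGroup W\<^esub>"
      using one ext_proj_class[OF p(1)] p(2) ow.hom_one by simp
    then obtain w where w: "w \<in> carrier W" "snd p = conj_auto W w \<otimes>\<^bsub>AutoGroup W\<^esub> \<one>\<^bsub>AutoGroup W\<^esub>"
      using W.out_class_eq_iff[OF F, of "\<one>\<^bsub>AutoGroup W\<^esub>"] AW.one_closed by (auto simp del: one_AutoGroup mult_AutoGroup)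
    then have sp: "snd p = conj_auto W w" using AW.r_one[of "conj_auto W w"] by (simp del: one_AutoGroup mult_AutoGroup)
    let ?p = "inv\<^bsub>AutSA n\<^esub> W_to_AutSA n w \<otimes>\<^bsub>AutSA n\<^esub> p"
    note wc = W_to_AutSA_mem[OF w(1)]
    have pc: "?p \<in> carrier (AutSA n)" using p wc by simp
    have "snd ?p = \<one>\<^bsub>AutoGroup W\<^esub>"
      using p(1) wc F sp AW.l_inv[of "snd p"] W_to_AutSA_def[of n w] by (simp del: one_AutoGroup mult_AutoGroup)
    then have sp: "snd ?p = (\<lambda>w\<in>carrier W. w)" by simp
    have "P = AutSA_class n (W_to_AutSA n w \<otimes>\<^bsub>AutSA n\<^esub> ?p)"
      using p wc by (simp add: SA.cancel_left del: cl.hom_mult)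
    also have "\<dots> = ext_incl n (fst ?p)"
      unfolding AutSA_class_W[OF w(1) pc] ext_incl_def using AutWA_fst(2)[OF pc sp] by simp
    finally show ?thesis using AutWA_fst(1)[OF pc sp] by auto
  qed
qed

text \<open>The splitting maps the class of \<open>F\<close> to the class of the semi-linear automorphism induced by a lift of
  \<open>F\<close> to \<open>G\<close> that maps generators to conjugates of generators.  Such lifts agree on \<open>A\<close>, which makes the
  construction compatible with composition; an inner automorphism of \<open>W\<close> has an inner lift, and this
  induces an element of the image of \<open>W\<close>.\<close>

lemma splitting_exists: "\<exists>s. splitting n s"
proof -
  define L where "L F = (SOME \<phi>. \<phi> \<in> auto G \<and> positive_hom \<phi> \<and> snd (r \<phi>) = F)" for F
  have L: "L F \<in> auto G" "positive_hom (L F)" "snd (r (L F)) = F" if F: "F \<in> auto W" for F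
  proof -
    have "\<exists>\<phi>. \<phi> \<in> auto G \<and> positive_hom \<phi> \<and> snd (r \<phi>) = F" using positive_lift[OF F] by metis
    from someI_ex[OF this] show "L F \<in> auto G" "positive_hom (L F)" "snd (r (L F)) = F"
      unfolding L_def by blast+
  qed
  have uniq: "r \<phi> = r \<psi>"
    if "\<phi> \<in> auto G" "positive_hom \<phi>" "\<psi> \<in> auto G" "positive_hom \<psi>" "snd (r \<phi>) = snd (r \<psi>)" for \<phi> \<psi>
  proof -
    have e: "q (\<phi> g) = q (\<psi> g)" if "g \<in> carrier G" for g
      using that r_snd[of \<phi> g] r_snd[of \<psi> g] \<open>\<phi> \<in> auto G\<close> \<open>\<psi> \<in> auto G\<close> \<open>snd (r \<phi>) = snd (r \<psi>)\<close> by simp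
    have "\<phi> a = \<psi> a" if "a \<in> setA n" for a
      using positive_hom_agree[OF \<open>positive_hom \<phi>\<close> \<open>positive_hom \<psi>\<close> e that] .
    then show ?thesis
      using e r_eq_iff[OF that(1) r_mem[OF that(3)]] r_fst r_snd[OF that(3)] by simp
  qed
  let ?S = "\<lambda>F. AutSA_class n (r (L F))"
  have Sc: "?S F \<in> carrier (AutSA_mod_W n)" if "F \<in> auto W" for F
    using L[OF that] r_mem by simp
  have Lm: "r (L (F \<otimes>\<^bsub>AutoGroup W\<^esub> F')) = r (L F) \<otimes>\<^bsub>AutSA n\<^esub> r (L F')"
    if F: "F \<in> auto W" and F': "F' \<in> auto W" for F F'
  proof -
    have FF: "F \<otimes>\<^bsub>AutoGroup W\<^esub> F' \<in> auto W" using AW.m_closed[of F F'] F F' by simp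
    have LL: "L F \<otimes>\<^bsub>AutG n\<^esub> L F' \<in> auto G"
      using AG.m_closed[of "L F" "L F'"] L[OF F] L[OF F'] by simp
    have rr: "r (L F \<otimes>\<^bsub>AutG n\<^esub> L F') = r (L F) \<otimes>\<^bsub>AutSA n\<^esub> r (L F')"
      using L(1)[OF F] L(1)[OF F'] by (simp del: mult_AutoGroup)
    have "positive_hom (L F \<otimes>\<^bsub>AutG n\<^esub> L F')"
      using L[OF F] L[OF F'] auto_hom[OF LL]
      by (simp add: positive_hom_def compose_def) (metis positive_hom_def positive_hom_positive)
    moreover have "snd (r (L F \<otimes>\<^bsub>AutG n\<^esub> L F')) = F \<otimes>\<^bsub>AutoGroup W\<^esub> F'"
      unfolding rr using L[OF F] L[OF F'] r_mem by (simp del: mult_AutoGroup)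
    ultimately show ?thesis
      using uniq[OF L(1,2)[OF FF] LL] L(3)[OF FF] rr by simp
  qed
  have conj: "r (L (conj_auto W w)) = W_to_AutSA n w" if "w \<in> carrier W" for w
  proof -
    obtain g where g: "g \<in> carrier G" "w = q g" using \<open>w \<in> carrier W\<close> by (rule W_lift)
    have c: "conj_auto W w \<in> auto W" using that by simp
    have "snd (r (L (conj_auto W w))) = snd (r (conj_auto G g))"
      using L(3)[OF c] g by (simp add: r_conj W_to_AutSA_def)
    then have "r (L (conj_auto W w)) = r (conj_auto G g)"
      using g L[OF c] by (intro uniq) (auto simp: positive_hom_conj)
    then show ?thesis using g r_conj by simp
  qed
  define s where "s P = the_elem (?S ` P)" for P
  have s: "s (out_class W F) = ?S F" if F: "F \<in> auto W" for F
    unfolding s_def out_class_def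
  proof (rule the_elem_coset[OF AW.is_group normal_imp_subgroup[OF W.Inn_normal]])
    show "F \<in> carrier (AutoGroup W)" using F by simp
    fix k assume "k \<in> Inn W"
    then obtain w where w: "w \<in> carrier W" "k = conj_auto W w" unfolding Inn_def by blast
    then show "?S (k \<otimes>\<^bsub>AutoGroup W\<^esub> F) = ?S F"
      using Lm[of k F] F conj[OF w(1)] AutSA_class_W[OF w(1)] L[OF F] r_mem by simp
  qed
  have "s \<in> hom (OutW n) (AutSA_mod_W n)"
  proof (rule homI)
    fix x assume "x \<in> carrier (OutW n)"
    then obtain F where F: "F \<in> auto W" "x = out_class W F" using W.carrier_Out by auto
    show "s x \<in> carrier (AutSA_mod_W n)" using F s Sc by simp
    fix y assume "y \<in> carrier (OutW n)"
    then obtain F' where F': "F' \<in> auto W" "y = out_class W F'" using W.carrier_Out by auto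
    have FF: "F \<otimes>\<^bsub>AutoGroup W\<^esub> F' \<in> auto W" using AW.m_closed[of F F'] F F' by simp
    have "s (x \<otimes>\<^bsub>OutW n\<^esub> y) = s (out_class W (F \<otimes>\<^bsub>AutoGroup W\<^esub> F'))"
      using F F' by (simp del: mult_AutoGroup)
    then show "s (x \<otimes>\<^bsub>OutW n\<^esub> y) = s x \<otimes>\<^bsub>AutSA_mod_W n\<^esub> s y"
      unfolding s[OF FF] Lm[OF F(1) F'(1)] using F F' s L r_mem by simp
  qed
  moreover have "ext_proj n (s x) = x" if x: "x \<in> carrier (OutW n)" for x
  proof -
    obtain F where F: "F \<in> auto W" "x = out_class W F" using x W.carrier_Out by auto
    then show ?thesis using s[OF F(1)] ext_proj_class[OF r_mem[OF L(1)[OF F(1)]]] L(3)[OF F(1)] by simp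
  qed
  ultimately show ?thesis unfolding splitting_def by blast
qed


section \<open>The embedding \<open>\<iota>\<close> and the first cohomology of \<open>W\<close>\<close>

lemma comm_group_M0: "comm_group (M0 n)"
proof (rule group.group_comm_groupI[OF group_M0])
  fix M N assume "M \<in> carrier (M0 n)" "N \<in> carrier (M0 n)"
  then show "M \<otimes>\<^bsub>M0 n\<^esub> N = N \<otimes>\<^bsub>M0 n\<^esub> M" using comm_add_mat[of M n n N] by simp
qed

lemma iota_A_elt: "iota n (A_elt n e) = mat n n (\<lambda>(i, j). if i = j then 0 else - 2 * e j)"
  unfolding iota_def
proof (rule the_equality)
  fix M assume "\<exists>e'. A_elt n e = A_elt n e' \<and> M = mat n n (\<lambda>(i, j). if i = j then 0 else - 2 * e' j)"
  then show "M = mat n n (\<lambda>(i, j). if i = j then 0 else - 2 * e j)"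
    unfolding A_elt_eq_iff by (auto intro!: eq_matI)
qed blast

lemma iota_mem: "a \<in> setA n \<Longrightarrow> iota n a \<in> carrier (M0 n)"
  by (elim A_elt_exists) (simp add: iota_A_elt)

lemma iota_hom: "iota n \<in> hom A (M0 n)"
proof (rule homI)
  fix a b assume "a \<in> carrier A" "b \<in> carrier A"
  then have "a \<in> setA n" "b \<in> setA n" by auto
  then obtain e f where "a = A_elt n e" "b = A_elt n f" using A_elt_exists by metis
  then show "iota n (a \<otimes>\<^bsub>A\<^esub> b) = iota n a \<otimes>\<^bsub>M0 n\<^esub> iota n b"
    by (auto simp: A_elt_add iota_A_elt intro!: eq_matI)
qed (use iota_mem in simp)

text \<open>Conjugation by \<open>a\<close> multiplies \<open>x\<^sub>i\<close> from the right by \<open>x\<^sub>i\<^sup>-\<^sup>1 a x\<^sub>i a\<^sup>-\<^sup>1\<close>, and \<open>x\<^sub>i\<close> negates all coordinates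
  of \<open>a\<close> but the \<open>i\<close>-th.\<close>

lemma tmap_iota:
  assumes "a \<in> setA n" shows "tmap n (iota n a) = conj_auto G a"
proof (rule tmap_eqI[OF iota_mem[OF assms]])
  note a = A_closed[OF assms]
  show "conj_auto G a \<in> auto G" using a by simp
  fix i assume i: "i < n"
  obtain e where e: "a = A_elt n e" using assms by (rule A_elt_exists)
  have "a \<cdot> xx i \<cdot> inv\<^bsub>G\<^esub> a = xx i \<cdot> (inv\<^bsub>G\<^esub> xx i \<cdot> a \<cdot> inv\<^bsub>G\<^esub> (inv\<^bsub>G\<^esub> xx i) \<cdot> inv\<^bsub>G\<^esub> a)"
    using a i by (simp add: G.m_assoc G.cancel_left)
  also have "inv\<^bsub>G\<^esub> xx i \<cdot> a \<cdot> inv\<^bsub>G\<^esub> (inv\<^bsub>G\<^esub> xx i) \<cdot> inv\<^bsub>G\<^esub> a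
      = A_elt n (\<lambda>j. sgn_of (inv\<^bsub>G\<^esub> xx i) j * e j + - e j)"
    unfolding e using i conj_A_elt[of "inv\<^bsub>G\<^esub> xx i" e] by (simp add: A_elt_inv A_elt_add del: G.inv_inv)
  also have "\<dots> = A_elt n (\<lambda>j. iota n a $$ (i, j))"
    unfolding A_elt_eq_iff e iota_A_elt using i by auto
  finally show "conj_auto G a (xx i) = xx i \<cdot> A_elt n (\<lambda>j. iota n a $$ (i, j))" using i by simp
qed

definition cocycle_of :: "int mat \<Rightarrow> G_elt set \<Rightarrow> G_elt" where
  "cocycle_of M = (\<lambda>w\<in>carrier W. the_elem ((\<lambda>g. tmap n M g \<cdot> inv\<^bsub>G\<^esub> g) ` w))"

lemma cocycle_of_q:
  assumes M: "M \<in> carrier (M0 n)" and g: "g \<in> carrier G"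
  shows "cocycle_of M (q g) = tmap n M g \<cdot> inv\<^bsub>G\<^esub> g"
    and "tmap n M g \<cdot> inv\<^bsub>G\<^esub> g \<in> setA n"
proof -
  note t = tmap_auto[OF M]
  have tg: "tmap n M g \<in> carrier G" using t g by simp
  have "q (tmap n M g \<cdot> inv\<^bsub>G\<^esub> g) = \<one>\<^bsub>W\<^esub>" using tmap_q[OF M A_sub.one_closed g] tg g by simp
  then show m: "tmap n M g \<cdot> inv\<^bsub>G\<^esub> g \<in> setA n"
    using q_eq_one_iff[of "tmap n M g \<cdot> inv\<^bsub>G\<^esub> g"] tg g by simp
  have "tmap n M (k \<cdot> g) \<cdot> inv\<^bsub>G\<^esub> (k \<cdot> g) = tmap n M g \<cdot> inv\<^bsub>G\<^esub> g" if k: "k \<in> setA n" for k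
  proof -
    note kc = A_closed[OF k]
    have "tmap n M (k \<cdot> g) \<cdot> inv\<^bsub>G\<^esub> (k \<cdot> g) = k \<cdot> (tmap n M g \<cdot> inv\<^bsub>G\<^esub> g) \<cdot> inv\<^bsub>G\<^esub> k"
      using kc g tg tmap_A[OF M k g] by (simp add: auto_mult[OF t] G.inv_mult_group G.m_assoc)
    also have "\<dots> = tmap n M g \<cdot> inv\<^bsub>G\<^esub> g \<cdot> k \<cdot> inv\<^bsub>G\<^esub> k" using A_commute[OF k m] by simp
    also have "\<dots> = tmap n M g \<cdot> inv\<^bsub>G\<^esub> g" using kc g tg by (simp add: G.m_assoc)
    finally show ?thesis .
  qed
  then have "the_elem ((\<lambda>g. tmap n M g \<cdot> inv\<^bsub>G\<^esub> g) ` q g) = tmap n M g \<cdot> inv\<^bsub>G\<^esub> g"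
    unfolding G_to_W_def by (rule the_elem_coset[OF G.is_group subgroup_A g])
  then show "cocycle_of M (q g) = tmap n M g \<cdot> inv\<^bsub>G\<^esub> g" using g by (simp add: cocycle_of_def)
qed

lemma tmap_cocycle_of:
  assumes "M \<in> carrier (M0 n)" "g \<in> carrier G"
  shows "tmap n M g = cocycle_of M (q g) \<cdot> g"
  using cocycle_of_q[OF assms] assms(2) tmap_auto[OF assms(1)] by (simp add: G.m_assoc)

lemma Z1_mem: "c \<in> carrier (Z1WA n) \<longleftrightarrow> c \<in> carrier W \<rightarrow>\<^sub>E setA n \<and>
    (\<forall>v\<in>carrier W. \<forall>w\<in>carrier W. c (v \<star> w) = c v \<cdot> actW n v (c w))"
  by (simp add: cocycles_def)

lemma Z1_mult: "c \<otimes>\<^bsub>Z1WA n\<^esub> d = (\<lambda>w\<in>carrier W. c w \<cdot> d w)"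
  by (simp add: cocycles_def)

lemma Z1_one: "\<one>\<^bsub>Z1WA n\<^esub> = (\<lambda>w\<in>carrier W. \<one>\<^bsub>G\<^esub>)"
  by (simp add: cocycles_def)

lemma cocycle_of_Z1:
  assumes M: "M \<in> carrier (M0 n)"
  shows "cocycle_of M \<in> carrier (Z1WA n)"
  unfolding Z1_mem
proof (intro conjI ballI PiE_I)
  note t = tmap_auto[OF M]
  show "cocycle_of M w \<in> setA n" if w: "w \<in> carrier W" for w
  proof -
    obtain g where "g \<in> carrier G" "w = q g" using w by (rule W_lift)
    then show ?thesis using cocycle_of_q[OF M] by simp
  qed
  show "cocycle_of M w = undefined" if "w \<notin> carrier W" for w using that by (simp add: cocycle_of_def)
  fix v w assume v: "v \<in> carrier W" and w: "w \<in> carrier W"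
  obtain g where g: "g \<in> carrier G" "v = q g" using v by (rule W_lift)
  obtain h where h: "h \<in> carrier G" "w = q h" using w by (rule W_lift)
  note c = tmap_cocycle_of[OF M g(1)] tmap_cocycle_of[OF M h(1)]
  have cc: "cocycle_of M (q g) \<in> setA n" "cocycle_of M (q h) \<in> setA n" using cocycle_of_q[OF M] g h by simp_all
  have "cocycle_of M (v \<star> w) = cocycle_of M (q (g \<cdot> h))" using g h by simp
  also have "\<dots> = tmap n M g \<cdot> tmap n M h \<cdot> inv\<^bsub>G\<^esub> (g \<cdot> h)"
    using cocycle_of_q[OF M, of "g \<cdot> h"] g h by (simp add: auto_mult[OF t])
  also have "\<dots> = cocycle_of M v \<cdot> (g \<cdot> cocycle_of M w \<cdot> inv\<^bsub>G\<^esub> g)"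
    unfolding c g(2)[symmetric] h(2)[symmetric]
    using g h cc A_closed by (simp add: G.m_assoc G.inv_mult_group G.cancel_left)
  finally show "cocycle_of M (v \<star> w) = cocycle_of M v \<cdot> actW n v (cocycle_of M w)"
    using g h cc by (simp add: actW_q)
qed

text \<open>Every cocycle \<open>c\<close> arises from a matrix, because \<open>g \<mapsto> c(g) g\<close> is an automorphism that is trivial
  on \<open>A\<close> and on \<open>W\<close>.\<close>

lemma cocycle_of_surj:
  assumes c: "c \<in> carrier (Z1WA n)"
  shows "\<exists>M\<in>carrier (M0 n). cocycle_of M = c"
proof -
  have cA: "c w \<in> setA n" if "w \<in> carrier W" for w using c that by (auto simp: Z1_mem)
  have cm: "c (v \<star> w) = c v \<cdot> actW n v (c w)" if "v \<in> carrier W" "w \<in> carrier W" for v w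
    using c that by (simp add: Z1_mem)
  let ?\<phi> = "\<lambda>g. c (q g) \<cdot> g"
  have cc: "c (q g) \<in> carrier G" if "g \<in> carrier G" for g using cA[of "q g"] A_closed that by simp
  have hom: "?\<phi> \<in> hom G G"
  proof (rule homI)
    fix g h assume g: "g \<in> carrier G" and h: "h \<in> carrier G"
    have "c (q (g \<cdot> h)) = c (q g) \<cdot> (g \<cdot> c (q h) \<cdot> inv\<^bsub>G\<^esub> g)"
      using g h cm[of "q g" "q h"] cA[of "q h"] by (simp add: actW_q)
    then show "?\<phi> (g \<cdot> h) = ?\<phi> g \<cdot> ?\<phi> h"
      using g h cc by (simp add: G.m_assoc G.cancel_left del: q.hom_mult)
  qed (simp add: cc)
  have "c \<one>\<^bsub>W\<^esub> = c \<one>\<^bsub>W\<^esub> \<cdot> c \<one>\<^bsub>W\<^esub>"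
    using cm[of "\<one>\<^bsub>W\<^esub>" "\<one>\<^bsub>W\<^esub>"] actW_q[of "\<one>\<^bsub>G\<^esub>" "c \<one>\<^bsub>W\<^esub>"] cA[of "\<one>\<^bsub>W\<^esub>"] A_closed by simp
  then have c1: "c \<one>\<^bsub>W\<^esub> = \<one>\<^bsub>G\<^esub>" using cc[of "\<one>\<^bsub>G\<^esub>"] by (simp add: G.r_cancel_one')
  have A: "?\<phi> a = a" if "a \<in> setA n" for a using that c1 A_closed by simp
  have Q: "q (?\<phi> g) = q g" if "g \<in> carrier G" for g using that cA[of "q g"] cc by simp
  have aut: "restrict ?\<phi> (carrier G) \<in> auto G"
  proof (rule auto_of_hom[OF hom])
    show "bij_betw ?\<phi> (setA n) (setA n)" using bij_betw_cong[of "setA n" ?\<phi> id] A by simp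
    show "\<exists>g\<in>carrier G. q (?\<phi> g) = w" if w: "w \<in> carrier W" for w
      using w carrier_W Q by auto
  qed (use Q in simp)
  obtain M where M: "M \<in> carrier (M0 n)" "tmap n M = restrict ?\<phi> (carrier G)"
    using tmap_range[OF aut] A Q A_closed by auto
  have "cocycle_of M w = c w" if w: "w \<in> carrier W" for w
  proof -
    obtain g where g: "g \<in> carrier G" "w = q g" using w by (rule W_lift)
    then show ?thesis using cocycle_of_q(1)[OF M(1) g(1)] M(2) cc[OF g(1)] by (simp add: G.m_assoc)
  qed
  then have "cocycle_of M = c"
    using c cocycle_of_Z1[OF M(1)] unfolding Z1_mem by (auto intro: PiE_ext)
  then show ?thesis using M(1) by blast
qed

lemma cocycle_of_mult:
  assumes M: "M \<in> carrier (M0 n)" and N: "N \<in> carrier (M0 n)"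
  shows "cocycle_of (M \<otimes>\<^bsub>M0 n\<^esub> N) = cocycle_of M \<otimes>\<^bsub>Z1WA n\<^esub> cocycle_of N"
proof -
  have MN: "M \<otimes>\<^bsub>M0 n\<^esub> N \<in> carrier (M0 n)" using M N group_M0 by (meson group.is_monoid monoid.m_closed)
  show ?thesis
    unfolding Z1_mult
  proof (rule extensionalityI[of _ "carrier W"])
    show "cocycle_of (M \<otimes>\<^bsub>M0 n\<^esub> N) \<in> extensional (carrier W)"
      "(\<lambda>w\<in>carrier W. cocycle_of M w \<cdot> cocycle_of N w) \<in> extensional (carrier W)"
      by (simp_all add: cocycle_of_def)
    fix w assume w: "w \<in> carrier W"
    obtain g where g: "g \<in> carrier G" "w = q g" using w by (rule W_lift)
    have cc: "cocycle_of M (q g) \<in> setA n" "cocycle_of N (q g) \<in> setA n" using cocycle_of_q[OF M] cocycle_of_q[OF N] g by simp_all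
    have tN: "tmap n N g \<in> carrier G" using tmap_auto[OF N] g by simp
    have "tmap n (M \<otimes>\<^bsub>M0 n\<^esub> N) g = tmap n M (tmap n N g)"
      using hom_mult[OF tmap_hom M N] tmap_auto[OF M] tmap_auto[OF N] g by (simp add: compose_def)
    also have "\<dots> = cocycle_of M (q g) \<cdot> (cocycle_of N (q g) \<cdot> g)"
      using tmap_cocycle_of[OF M tN] tmap_q[OF N A_sub.one_closed g(1)] tmap_cocycle_of[OF N g(1)] by simp
    finally show "cocycle_of (M \<otimes>\<^bsub>M0 n\<^esub> N) w = (\<lambda>w\<in>carrier W. cocycle_of M w \<cdot> cocycle_of N w) w"
      using cocycle_of_q(1)[OF MN g(1)] g cc A_closed by (simp add: G.m_assoc del: M0_simps)
  qed
qed

lemma cocycle_of_hom: "cocycle_of \<in> hom (M0 n) (Z1WA n)"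
  by (rule homI[OF cocycle_of_Z1 cocycle_of_mult])

text \<open>The group axioms are transported from \<open>M\<^sub>0\<close> along the multiplicative bijection \<open>cocycle_of\<close>.\<close>

lemma comm_group_Z1: "comm_group (Z1WA n)"
proof -
  interpret M: comm_group "M0 n" by (rule comm_group_M0)
  have img: "cocycle_of ` carrier (M0 n) = carrier (Z1WA n)" using cocycle_of_Z1 cocycle_of_surj by (auto simp del: M0_simps)
  have "cocycle_of \<one>\<^bsub>M0 n\<^esub> = (\<lambda>w\<in>carrier W. \<one>\<^bsub>G\<^esub>)"
  proof -
    have t1: "tmap n \<one>\<^bsub>M0 n\<^esub> = \<one>\<^bsub>AutG n\<^esub>" using hom_one[OF tmap_hom group_M0 AG.is_group] .
    have "cocycle_of \<one>\<^bsub>M0 n\<^esub> w = \<one>\<^bsub>G\<^esub>" if w: "w \<in> carrier W" for w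
    proof -
      obtain g where g: "g \<in> carrier G" "w = q g" using w by (rule W_lift)
      then show ?thesis using cocycle_of_q(1)[OF M.one_closed g(1)] t1 by (simp del: M0_simps)
    qed
    then show ?thesis unfolding cocycle_of_def by (simp cong: restrict_cong)
  qed
  then have "(Z1WA n)\<lparr>carrier := cocycle_of ` carrier (M0 n), one := cocycle_of \<one>\<^bsub>M0 n\<^esub>\<rparr> = Z1WA n"
    unfolding img using Z1_one by simp
  then show ?thesis using M.hom_imp_img_comm_group[OF cocycle_of_hom] by simp
qed

sublocale Z: comm_group "Z1WA n" by (rule comm_group_Z1)

lemma cocycle_of_iso: "cocycle_of \<in> iso (M0 n) (Z1WA n)"
proof -
  have "cocycle_of \<in> mon (M0 n) (Z1WA n)"
    unfolding mon_iff_hom_one[OF group_M0 Z.is_group]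
  proof (intro conjI cocycle_of_hom allI impI, elim conjE)
    fix M assume M: "M \<in> carrier (M0 n)" "cocycle_of M = \<one>\<^bsub>Z1WA n\<^esub>"
    have "tmap n M = \<one>\<^bsub>AutG n\<^esub>"
    proof (rule auto_eqI[OF tmap_auto[OF M(1)]])
      show "\<one>\<^bsub>AutG n\<^esub> \<in> auto G" using AG.one_closed by simp
      show "tmap n M g = \<one>\<^bsub>AutG n\<^esub> g" if "g \<in> carrier G" for g
        using tmap_cocycle_of[OF M(1) that] M(2) that by (simp add: Z1_one)
    qed
    then show "M = \<one>\<^bsub>M0 n\<^esub>"
      using tmap_inj M(1) unfolding mon_iff_hom_one[OF group_M0 AG.is_group] by blast
  qed
  moreover have "cocycle_of \<in> epi (M0 n) (Z1WA n)"
    using cocycle_of_hom cocycle_of_surj unfolding epi_iff_subset by (auto simp del: M0_simps)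
  ultimately show ?thesis unfolding iso_iff_mon_epi by simp
qed

abbreviation "coboundary_of a \<equiv> (\<lambda>w\<in>carrier W. actW n w a \<otimes>\<^bsub>A\<^esub> inv\<^bsub>A\<^esub> a)"

lemma coboundary_of_app: "a \<in> setA n \<Longrightarrow> g \<in> carrier G \<Longrightarrow> coboundary_of a (q g) = g \<cdot> a \<cdot> inv\<^bsub>G\<^esub> g \<cdot> inv\<^bsub>G\<^esub> a"
  by (simp add: actW_q)

text \<open>Conjugation by \<open>a\<close> maps \<open>g\<close> to \<open>(a g a\<^sup>-\<^sup>1 g\<^sup>-\<^sup>1) g\<close>, and in the commutative group \<open>A\<close> the first factor is
  the product of \<open>g a\<^sup>-\<^sup>1 g\<^sup>-\<^sup>1\<close> and \<open>a\<close>.\<close>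

lemma cocycle_of_iota:
  assumes a: "a \<in> setA n"
  shows "cocycle_of (iota n a) = coboundary_of (inv\<^bsub>G\<^esub> a)"
proof -
  have ia: "inv\<^bsub>G\<^esub> a \<in> setA n" using a by simp
  show ?thesis
  proof (rule extensionalityI[of _ "carrier W"])
    show "cocycle_of (iota n a) \<in> extensional (carrier W)" "coboundary_of (inv\<^bsub>G\<^esub> a) \<in> extensional (carrier W)"
      by (simp_all add: cocycle_of_def)
    fix w assume w: "w \<in> carrier W"
    obtain g where g: "g \<in> carrier G" "w = q g" using w by (rule W_lift)
    have "coboundary_of (inv\<^bsub>G\<^esub> a) w = g \<cdot> inv\<^bsub>G\<^esub> a \<cdot> inv\<^bsub>G\<^esub> g \<cdot> a"
      unfolding g(2) using coboundary_of_app[OF ia g(1)] A_closed[OF a] by simp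
    also have "\<dots> = a \<cdot> (g \<cdot> inv\<^bsub>G\<^esub> a \<cdot> inv\<^bsub>G\<^esub> g)"
      by (rule A_commute[OF conj_mem[OF g(1) ia] a])
    also have "\<dots> = cocycle_of (iota n a) w"
      using cocycle_of_q(1)[OF iota_mem[OF a] g(1)] tmap_iota[OF a] g A_closed[OF a] by (simp add: G.m_assoc)
    finally show "cocycle_of (iota n a) w = coboundary_of (inv\<^bsub>G\<^esub> a) w" ..
  qed
qed

lemma B1_eq: "B1WA n = (cocycle_of \<circ> iota n) ` carrier A"
proof -
  have "coboundary_of a \<in> (cocycle_of \<circ> iota n) ` setA n" if "a \<in> setA n" for a
    using that cocycle_of_iota[of "inv\<^bsub>G\<^esub> a"] A_closed[OF that] by (intro image_eqI[of _ _ "inv\<^bsub>G\<^esub> a"]) auto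
  moreover have "(cocycle_of \<circ> iota n) a \<in> coboundary_of ` setA n" if "a \<in> setA n" for a
    using that cocycle_of_iota[OF that] by (intro image_eqI[of _ _ "inv\<^bsub>G\<^esub> a"]) auto
  ultimately show ?thesis unfolding coboundaries_def carrier_A by blast
qed

lemma iota_mon: "iota n \<in> mon A (M0 n)"
  unfolding mon_iff_hom_one[OF A.is_group group_M0]
proof (intro conjI iota_hom allI impI, elim conjE)
  fix a assume a: "a \<in> carrier A" "iota n a = \<one>\<^bsub>M0 n\<^esub>"
  then have "a \<in> setA n" by simp
  then obtain e where e: "a = A_elt n e" by (rule A_elt_exists)
  have "e j = 0" if j: "j < n" for j
  proof -
    obtain i where i: "i < n" "i \<noteq> j" using other by blast
    then have "iota n a $$ (i, j) = - 2 * e j" using j by (simp add: e iota_A_elt)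
    then show ?thesis using a i j by simp
  qed
  then show "a = \<one>\<^bsub>A\<^esub>" using e A_elt_cong[of e "\<lambda>_. 0"] by simp
qed

lemma cocycle_of_iota_mon: "cocycle_of \<circ> iota n \<in> mon A (Z1WA n)"
  using iota_mon cocycle_of_iso unfolding iso_iff_mon_epi by (auto intro: mon_compose)

lemma B1_normal: "B1WA n \<lhd> Z1WA n"
proof -
  interpret c: group_hom A "Z1WA n" "cocycle_of \<circ> iota n"
    using cocycle_of_iota_mon by unfold_locales (simp add: mon_def)
  show ?thesis unfolding B1_eq using c.img_is_subgroup by (rule Z.subgroup_imp_normal)
qed

lemma M0_to_H1_eq: "M0_to_H1 n M = B1WA n #>\<^bsub>Z1WA n\<^esub> cocycle_of M"
  by (simp add: M0_to_H1_def cocycle_of_def)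

lemma ses_M0: "ses A (iota n) (M0 n) (M0_to_H1 n) (H1WA n)"
proof -
  have "ses A (cocycle_of \<circ> iota n) (Z1WA n) (\<lambda>c. B1WA n #>\<^bsub>Z1WA n\<^esub> c) (H1WA n)"
    using ses_Mod[OF A.is_group Z.is_group cocycle_of_iota_mon] B1_normal unfolding H1_def B1_eq by simp
  from ses_iso_middle[OF this cocycle_of_iso group_M0 iota_hom]
  have "ses A (iota n) (M0 n) ((\<lambda>c. B1WA n #>\<^bsub>Z1WA n\<^esub> c) \<circ> cocycle_of) (H1WA n)" by simp
  moreover have "(\<lambda>c. B1WA n #>\<^bsub>Z1WA n\<^esub> c) \<circ> cocycle_of = M0_to_H1 n" by (simp add: fun_eq_iff M0_to_H1_eq)
  ultimately show ?thesis by simp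
qed

text \<open>Changing a cocycle by the coboundary of \<open>a\<close> composes the automorphism \<open>g \<mapsto> c(g) g\<close> with the
  conjugation by \<open>a\<^sup>-\<^sup>1\<close>.\<close>

lemma H1_to_OutG_M0:
  assumes M: "M \<in> carrier (M0 n)"
  shows "H1_to_OutG n (M0_to_H1 n M) = out_class G (tmap n M)"
proof -
  let ?\<phi> = "\<lambda>c. \<lambda>g\<in>carrier G. c (q g) \<cdot> g"
  have tM: "?\<phi> (cocycle_of M) = tmap n M"
  proof -
    have "tmap n M \<in> extensional (carrier G)" using tmap_auto[OF M] by (simp add: auto_def Bij_def)
    then show ?thesis using tmap_cocycle_of[OF M] by (intro extensionalityI[of _ "carrier G"]) auto
  qed
  have "the_elem ((\<lambda>c. out_class G (?\<phi> c)) ` (B1WA n #>\<^bsub>Z1WA n\<^esub> cocycle_of M)) = out_class G (?\<phi> (cocycle_of M))"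
  proof (rule the_elem_coset[OF Z.is_group normal_imp_subgroup[OF B1_normal] cocycle_of_Z1[OF M]])
    fix k assume "k \<in> B1WA n"
    then obtain a where a: "a \<in> setA n" "k = cocycle_of (iota n a)" unfolding B1_eq by auto
    note Mi = iota_mem[OF a(1)]
    have MM: "iota n a \<otimes>\<^bsub>M0 n\<^esub> M \<in> carrier (M0 n)"
      using M Mi group_M0 by (meson group.is_monoid monoid.m_closed)
    have k: "k \<otimes>\<^bsub>Z1WA n\<^esub> cocycle_of M = cocycle_of (iota n a \<otimes>\<^bsub>M0 n\<^esub> M)" unfolding a(2) by (rule cocycle_of_mult[OF Mi M, symmetric])
    have "?\<phi> (cocycle_of (iota n a \<otimes>\<^bsub>M0 n\<^esub> M)) = tmap n (iota n a \<otimes>\<^bsub>M0 n\<^esub> M)"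
    proof -
      have "tmap n (iota n a \<otimes>\<^bsub>M0 n\<^esub> M) \<in> extensional (carrier G)"
        using tmap_auto[OF MM] by (simp add: auto_def Bij_def)
      then show ?thesis using tmap_cocycle_of[OF MM] by (intro extensionalityI[of _ "carrier G"]) auto
    qed
    also have "\<dots> = conj_auto G a \<otimes>\<^bsub>AutG n\<^esub> tmap n M"
      using hom_mult[OF tmap_hom Mi M] tmap_iota[OF a(1)] by simp
    finally show "out_class G (?\<phi> (k \<otimes>\<^bsub>Z1WA n\<^esub> cocycle_of M)) = out_class G (?\<phi> (cocycle_of M))"
      unfolding k tM
      using G.out_class_eq_iff[of "conj_auto G a \<otimes>\<^bsub>AutG n\<^esub> tmap n M" "tmap n M"]
        AG.m_closed[of "conj_auto G a" "tmap n M"] tmap_auto[OF M] A_closed[OF a(1)] by auto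
  qed
  then show ?thesis unfolding H1_to_OutG_def M0_to_H1_eq tM .
qed


section \<open>The groups in the bottom row up to isomorphism\<close>

text \<open>In column \<open>j\<close> the image of \<open>\<iota>\<close> consists of the even constant vectors, so that the quotient of
  the column is described by the differences with the entry in row \<open>other j\<close> and the parity of that entry.\<close>

lemma ses_M0_product:
  "\<exists>\<gamma>. ses A (iota n) (M0 n) \<gamma> (Z_pow (n * (n - 2)) \<times>\<times> Z2_pow n)"
proof -
  let ?N = "n * (n - 2)" and ?I = "SIGMA j:{..<n}. {..<n} - {j, other j}"
  let ?T = "Z_pow ?N \<times>\<times> Z2_pow n"
  have "card ?I = (\<Sum>j<n. card ({..<n} - {j, other j}))" by simp
  also have "\<dots> = (\<Sum>j<n. n - 2)"
  proof (rule sum.cong)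
    fix j assume "j \<in> {..<n}"
    then have "card ({..<n} - {j, other j}) = card {..<n} - card {j, other j}"
      using other by (intro card_Diff_subset) auto
    then show "card ({..<n} - {j, other j}) = n - 2" using other(2)[of j] by auto
  qed simp
  finally have "card ?I = ?N" by simp
  \<comment> \<open>\<open>h\<close> enumerates the pairs of a column \<open>j\<close> and a row other than \<open>j\<close> and \<open>other j\<close>.\<close>
  then obtain h where h: "bij_betw h {..<?N} ?I"
    using ex_bij_betw_nat_finite[of ?I] by (auto simp: atLeast0LessThan)
  define h' where "h' = inv_into {..<?N} h"
  have hI: "fst (h k) < n" "snd (h k) < n" "snd (h k) \<noteq> fst (h k)" "snd (h k) \<noteq> other (fst (h k))"
    if "k < ?N" for k
  proof -
    obtain j i where "h k = (j, i)" by fastforce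
    moreover have "h k \<in> ?I" using bij_betwE[OF h] that by blast
    ultimately show "fst (h k) < n" "snd (h k) < n" "snd (h k) \<noteq> fst (h k)"
      "snd (h k) \<noteq> other (fst (h k))" by auto
  qed
  have h': "h' (j, i) < ?N" "h (h' (j, i)) = (j, i)"
    if "i < n" "j < n" "i \<noteq> j" "i \<noteq> other j" for i j
  proof -
    have "(j, i) \<in> h ` {..<?N}" using h that by (simp add: bij_betw_def)
    from inv_into_into[OF this] f_inv_into_f[OF this]
    show "h' (j, i) < ?N" "h (h' (j, i)) = (j, i)" by (simp_all add: h'_def)
  qed
  have h'h: "h' (h k) = k" if "k < ?N" for k
    using that h by (simp add: h'_def bij_betw_def)
  define \<gamma> where "\<gamma> M = (\<lambda>k\<in>{..<?N}. M $$ (snd (h k), fst (h k)) - M $$ (other (fst (h k)), fst (h k)),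
    \<lambda>j\<in>{..<n}. M $$ (other j, j) mod 2)" for M :: "int mat"
  have "group ?T" by (intro DirProd_group) simp_all
  have "ses A (iota n) (M0 n) \<gamma> ?T"
  proof (rule sesI[OF A.is_group group_M0 \<open>group ?T\<close> iota_hom])
    show "\<gamma> \<in> hom (M0 n) ?T"
    proof (rule homI)
      fix M N assume "M \<in> carrier (M0 n)" "N \<in> carrier (M0 n)"
      then show "\<gamma> (M \<otimes>\<^bsub>M0 n\<^esub> N) = \<gamma> M \<otimes>\<^bsub>?T\<^esub> \<gamma> N"
        using other(1) hI by (auto simp: \<gamma>_def mod_add_eq intro!: restrict_ext)
    qed (auto simp: \<gamma>_def carrier_integer_mod_group)
    show "a = \<one>\<^bsub>A\<^esub>" if "a \<in> carrier A" "iota n a = \<one>\<^bsub>M0 n\<^esub>" for a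
      using iota_mon that unfolding mon_iff_hom_one[OF A.is_group group_M0] by blast
    show "\<exists>M\<in>carrier (M0 n). \<gamma> M = z" if zc: "z \<in> carrier ?T" for z
    proof -
      obtain u v where z: "z = (u, v)" by fastforce
      have u: "u \<in> {..<?N} \<rightarrow>\<^sub>E UNIV" and v: "v \<in> {..<n} \<rightarrow>\<^sub>E {0..<2}"
        using zc by (simp_all add: z carrier_integer_mod_group)
      define M where "M = mat n n (\<lambda>(i, j). if i = j then 0 else if i = other j then v j else v j + u (h' (j, i)))"
      have e: "M $$ (i, j) = (if i = j then 0 else if i = other j then v j else v j + u (h' (j, i)))"
        if "i < n" "j < n" for i j using that by (simp add: M_def)
      have "fst (\<gamma> M) = u"
        using u hI h'h other by (intro extensionalityI[of _ "{..<?N}"]) (auto simp: \<gamma>_def e PiE_def)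
      moreover have "snd (\<gamma> M) = v"
      proof (rule extensionalityI[of _ "{..<n}"])
        fix j assume j: "j \<in> {..<n}"
        then have "v j \<in> {0..<2}" using v by (auto simp: PiE_def)
        then show "snd (\<gamma> M) j = v j" using j other by (simp add: \<gamma>_def e)
      qed (use v in \<open>auto simp: \<gamma>_def PiE_def\<close>)
      moreover have "M \<in> carrier (M0 n)" by (simp add: M_def)
      ultimately show ?thesis unfolding z by (metis prod.collapse)
    qed
    show "\<gamma> (iota n a) = \<one>\<^bsub>?T\<^esub>" if "a \<in> carrier A" for a
    proof -
      have "a \<in> setA n" using that by simp
      then obtain e where "a = A_elt n e" by (rule A_elt_exists)
      then show ?thesis using other hI by (auto simp: \<gamma>_def iota_A_elt intro!: restrict_ext)
    qed
    show "\<exists>a\<in>carrier A. iota n a = M" if M: "M \<in> carrier (M0 n)" and one: "\<gamma> M = \<one>\<^bsub>?T\<^esub>" for M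
    proof -
      have f: "fst (\<gamma> M) = (\<lambda>k\<in>{..<?N}. 0)" and s: "snd (\<gamma> M) = (\<lambda>j\<in>{..<n}. 0)"
        using one by simp_all
      have col: "M $$ (i, j) = M $$ (other j, j)" if ij: "i < n" "j < n" "i \<noteq> j" for i j
      proof (cases "i = other j")
        case False
        have "fst (\<gamma> M) (h' (j, i)) = 0" using h'(1)[OF ij False] by (simp add: f)
        then show ?thesis using h'[OF ij False] by (simp add: \<gamma>_def)
      qed simp
      have ev: "M $$ (other j, j) mod 2 = 0" if "j < n" for j
        using fun_cong[OF s, of j] that by (simp add: \<gamma>_def)
      have "iota n (A_elt n (\<lambda>j. - (M $$ (other j, j) div 2))) = M"
        unfolding iota_A_elt using M
      proof (intro eq_matI)
        fix i j assume "i < dim_row M" "j < dim_col M"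
        then have ij: "i < n" "j < n" using M by auto
        have "2 * (M $$ (other j, j) div 2) = M $$ (other j, j)"
          using ev[OF ij(2)] by (simp add: minus_mod_eq_mult_div[symmetric])
        then show "mat n n (\<lambda>(i, j). if i = j then 0 else - 2 * - (M $$ (other j, j) div 2)) $$ (i, j) = M $$ (i, j)"
          using ij M col[OF ij] by auto
      qed auto
      then show ?thesis by (intro bexI[of _ "A_elt n (\<lambda>j. - (M $$ (other j, j) div 2))"]) simp_all
    qed
  qed
  then show ?thesis by blast
qed

lemma sq_neq_inv: "i < n \<Longrightarrow> sq n i \<noteq> inv\<^bsub>G\<^esub> sq n i"
  using sq_pow_eq_iff[of i 1 "-1"] by (auto simp: G.int_pow_neg)

text \<open>The isomorphism records the signs by which a module automorphism acts on the squares of the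
  generators.\<close>

lemma AutWA_iso: "\<exists>\<beta>. \<beta> \<in> iso (AutWA n) (Z2_pow n)"
proof -
  define \<beta> where "\<beta> f = (\<lambda>i\<in>{..<n}. if f (sq n i) = sq n i then 0 else 1 :: int)" for f
  have "group (Z2_pow n)" by simp
  have "\<beta> \<in> hom (AutWA n) (Z2_pow n)"
  proof (rule homI)
    fix f g assume fg: "f \<in> carrier (AutWA n)" "g \<in> carrier (AutWA n)"
    then have a: "f \<in> auto A" "g \<in> auto A" by (auto simp: mod_Aut_carrier)
    show "\<beta> (f \<otimes>\<^bsub>AutWA n\<^esub> g) = \<beta> f \<otimes>\<^bsub>Z2_pow n\<^esub> \<beta> g"
    proof (rule extensionalityI[of _ "{..<n}"])
      fix i assume "i \<in> {..<n}"
      then have i: "i < n" by simp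
      have "(f \<otimes>\<^bsub>AutWA n\<^esub> g) (sq n i) = f (g (sq n i))"
        using a i by (simp add: mod_Aut_mult compose_def)
      moreover have "f (inv\<^bsub>G\<^esub> sq n i) = inv\<^bsub>G\<^esub> f (sq n i)"
        using auto_inv[OF A.is_group a(1), of "sq n i"] auto_closed[OF a(1), of "sq n i"] i by simp
      ultimately show "\<beta> (f \<otimes>\<^bsub>AutWA n\<^esub> g) i = (\<beta> f \<otimes>\<^bsub>Z2_pow n\<^esub> \<beta> g) i"
        using AutWA_sq[OF fg(1) i] AutWA_sq[OF fg(2) i] sq_neq_inv[OF i] i by (auto simp: \<beta>_def)
    qed (auto simp: \<beta>_def)
  qed (auto simp: \<beta>_def carrier_integer_mod_group)
  moreover have "inj_on \<beta> (carrier (AutWA n))"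
  proof (rule inj_onI)
    fix f g assume fg: "f \<in> carrier (AutWA n)" "g \<in> carrier (AutWA n)" and eq: "\<beta> f = \<beta> g"
    show "f = g"
    proof (rule AutWA_eqI[OF fg])
      fix i assume i: "i < n"
      have "\<beta> f i = \<beta> g i" using eq by simp
      then have "f (sq n i) = sq n i \<longleftrightarrow> g (sq n i) = sq n i" using i by (auto simp: \<beta>_def split: if_splits)
      then show "f (sq n i) = g (sq n i)" using AutWA_sq[OF fg(1) i] AutWA_sq[OF fg(2) i] by auto
    qed
  qed
  moreover have "c \<in> \<beta> ` carrier (AutWA n)" if c: "c \<in> carrier (Z2_pow n)" for c
  proof -
    obtain \<phi> where \<phi>: "\<phi> \<in> auto G" "\<And>g. g \<in> carrier G \<Longrightarrow> q (\<phi> g) = q g"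
      "\<And>i. i < n \<Longrightarrow> \<phi> (sq n i) = (if c i \<noteq> 0 then inv\<^bsub>G\<^esub> sq n i else sq n i)"
      using sign_auto_exists[of "\<lambda>i. c i \<noteq> 0"] by blast
    have "snd (r \<phi>) = (\<lambda>w\<in>carrier W. w)"
    proof (rule extensionalityI[of _ "carrier W"])
      show "snd (r \<phi>) \<in> extensional (carrier W)" by (simp add: AutG_to_AutSA_def)
      fix w assume w: "w \<in> carrier W"
      then obtain g where "g \<in> carrier G" "w = q g" by (rule W_lift)
      then show "snd (r \<phi>) w = (\<lambda>w\<in>carrier W. w) w" using r_snd[OF \<phi>(1)] \<phi>(2) by simp
    qed simp
    then have m: "fst (r \<phi>) \<in> carrier (AutWA n)" using AutWA_fst(1)[OF r_mem[OF \<phi>(1)]] by blast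
    have "\<beta> (fst (r \<phi>)) = c"
    proof (rule extensionalityI[of _ "{..<n}"])
      show "c \<in> extensional {..<n}" using c by (auto simp: PiE_def)
      fix i assume "i \<in> {..<n}"
      then have i: "i < n" by simp
      have "c i \<in> {0..<2}" using c i by (auto simp: carrier_integer_mod_group PiE_def Pi_def)
      then have "c i = 0 \<or> c i = 1" by auto
      then show "\<beta> (fst (r \<phi>)) i = c i"
        using \<phi>(3)[OF i] sq_neq_inv[OF i] i by (auto simp: \<beta>_def r_fst)
    qed (simp add: \<beta>_def)
    then show ?thesis using m by blast
  qed
  ultimately have "\<beta> \<in> iso (AutWA n) (Z2_pow n)"
    unfolding iso_iff using hom_carrier by blast
  then show ?thesis by blast
qed


section \<open>The diagram\<close>

lemma split_act_hom:
  assumes "splitting n s"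
  shows "split_act n s \<in> hom (OutW n) (AutoGroup (AutWA n))"
    and "split_iso n s \<in> iso (AutWA_OutW n s) (AutSA_mod_W n)"
proof -
  have s: "s \<in> hom (OutW n) (AutSA_mod_W n)" "\<And>x. x \<in> carrier (OutW n) \<Longrightarrow> ext_proj n (s x) = x"
    using assms by (auto simp: splitting_def)
  have a: "split_act n s = (\<lambda>q. \<lambda>f\<in>carrier (AutWA n). inv_into (carrier (AutWA n)) (ext_incl n)
     (s q \<otimes>\<^bsub>AutSA_mod_W n\<^esub> ext_incl n f \<otimes>\<^bsub>AutSA_mod_W n\<^esub> inv\<^bsub>AutSA_mod_W n\<^esub> (s q)))"
    by (rule ext) (simp only: split_act_def)
  show "split_act n s \<in> hom (OutW n) (AutoGroup (AutWA n))"
    unfolding a by (rule split_extension(1)[OF ses_ext s])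
  show "split_iso n s \<in> iso (AutWA_OutW n s) (AutSA_mod_W n)"
    unfolding AutWA_OutW_def split_iso_def a by (rule split_extension(2)[OF ses_ext s])
qed

lemma group_AutWA_OutW:
  assumes "splitting n s" shows "group (AutWA_OutW n s)"
  unfolding AutWA_OutW_def
  by (rule group_semidirect[OF WA.is_group OW.is_group split_act_hom(1)[OF assms]])

lemma ses_AutSA:
  assumes "splitting n s"
  shows "ses W (W_to_AutSA n) (AutSA n) (AutSA_to_semidirect n s) (AutWA_OutW n s)"
proof -
  note g = group_AutWA_OutW[OF assms]
  have "inv_into (carrier (AutWA_OutW n s)) (split_iso n s) \<in> iso (AutSA_mod_W n) (AutWA_OutW n s)"
    by (rule group.iso_set_sym[OF g split_act_hom(2)[OF assms]])
  from ses_iso_right[OF ses_AutSA_class this g]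
  have "ses W (W_to_AutSA n) (AutSA n)
    (inv_into (carrier (AutWA_OutW n s)) (split_iso n s) \<circ> AutSA_class n) (AutWA_OutW n s)" .
  moreover have "inv_into (carrier (AutWA_OutW n s)) (split_iso n s) \<circ> AutSA_class n = AutSA_to_semidirect n s"
    by (rule ext) (simp add: AutSA_to_semidirect_def)
  ultimately show ?thesis by simp
qed

text \<open>An inner automorphism of \<open>G\<close> induces an element of the image of \<open>W\<close>, which is divided out on the
  right-hand side.\<close>

lemma OutG_to_semidirect_class:
  assumes \<phi>: "\<phi> \<in> auto G"
  shows "OutG_to_semidirect n s (out_class G \<phi>) = AutSA_to_semidirect n s (r \<phi>)"
  unfolding OutG_to_semidirect_def out_class_def
proof (rule the_elem_coset[OF AG.is_group normal_imp_subgroup[OF G.Inn_normal]])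
  show "\<phi> \<in> carrier (AutG n)" using \<phi> by simp
  fix k assume "k \<in> Inn G"
  then obtain g where g: "g \<in> carrier G" "k = conj_auto G g" unfolding Inn_def by blast
  have "r (k \<otimes>\<^bsub>AutG n\<^esub> \<phi>) = W_to_AutSA n (q g) \<otimes>\<^bsub>AutSA n\<^esub> r \<phi>"
    using \<phi> g r_conj[OF g(1)] by (simp del: mult_AutoGroup)
  then show "AutSA_to_semidirect n s (r (k \<otimes>\<^bsub>AutG n\<^esub> \<phi>)) = AutSA_to_semidirect n s (r \<phi>)"
    unfolding AutSA_to_semidirect_def using AutSA_class_W[of "q g" "r \<phi>"] g r_mem[OF \<phi>] by simp
qed

lemma ses_OutG:
  assumes "splitting n s"
  shows "ses (H1WA n) (H1_to_OutG n) (OutG n) (OutG_to_semidirect n s) (AutWA_OutW n s)"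
  by (rule nine_lemma[OF ses_G ses_AutG ses_M0 G.ses_conj_auto[OF centre_G] ses_AutSA[OF assms]])
    (use tmap_iota r_conj H1_to_OutG_M0 OutG_to_semidirect_class in auto)

lemma bottom_row:
  assumes s: "splitting n s"
  shows "\<exists>\<alpha> \<beta> \<theta>.
          \<alpha> \<in> iso (H1WA n) (Z_pow (n * (n - 2)) \<times>\<times> Z2_pow n) \<and>
          \<beta> \<in> iso (AutWA n) (Z2_pow n) \<and>
          \<theta> \<in> hom (OutW n) (AutoGroup (Z2_pow n)) \<and>
          (\<forall>q\<in>carrier (OutW n). \<forall>f\<in>carrier (AutWA n). \<theta> q (\<beta> f) = \<beta> (split_act n s q f)) \<and>
          map_prod \<beta> id \<in> iso (AutWA_OutW n s) (semidirect (Z2_pow n) (OutW n) \<theta>) \<and>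
          ses (Z_pow (n * (n - 2)) \<times>\<times> Z2_pow n)
              (H1_to_OutG n \<circ> inv_into (carrier (H1WA n)) \<alpha>)
              (OutG n)
              (map_prod \<beta> id \<circ> OutG_to_semidirect n s)
              (semidirect (Z2_pow n) (OutW n) \<theta>)"
proof -
  let ?T = "Z_pow (n * (n - 2)) \<times>\<times> Z2_pow n"
  have T: "group ?T" by (intro DirProd_group) simp_all
  have Z2: "group (Z2_pow n)" by simp
  obtain \<gamma> where "ses A (iota n) (M0 n) \<gamma> ?T" using ses_M0_product by blast
  then obtain \<alpha> where \<alpha>: "\<alpha> \<in> iso (H1WA n) ?T" using ses_quotient_unique[OF ses_M0] by blast
  obtain \<beta> where \<beta>: "\<beta> \<in> iso (AutWA n) (Z2_pow n)" using AutWA_iso by blast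
  define \<theta> where "\<theta> = (\<lambda>x. \<lambda>c\<in>carrier (Z2_pow n). \<beta> (split_act n s x (inv_into (carrier (AutWA n)) \<beta> c)))"
  note tr = semidirect_transport[OF WA.is_group Z2 OW.is_group \<beta> split_act_hom(1)[OF s], folded \<theta>_def]
  note \<theta> = tr(1)
  have sd: "group (semidirect (Z2_pow n) (OutW n) \<theta>)"
    by (rule group_semidirect[OF Z2 OW.is_group \<theta>])
  have m: "map_prod \<beta> id \<in> iso (AutWA_OutW n s) (semidirect (Z2_pow n) (OutW n) \<theta>)"
    unfolding AutWA_OutW_def by (rule tr(3))
  have "group (H1WA n)" using sesD(3)[OF ses_M0] .
  then have \<alpha>': "inv_into (carrier (H1WA n)) \<alpha> \<in> iso ?T (H1WA n)" using group.iso_set_sym \<alpha> by blast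
  have "ses ?T (H1_to_OutG n \<circ> inv_into (carrier (H1WA n)) \<alpha>) (OutG n)
      (map_prod \<beta> id \<circ> OutG_to_semidirect n s) (semidirect (Z2_pow n) (OutW n) \<theta>)"
    by (rule ses_iso_right[OF ses_iso_left[OF ses_OutG[OF s] \<alpha>' T] m sd])
  moreover have "\<theta> x (\<beta> f) = \<beta> (split_act n s x f)" if "f \<in> carrier (AutWA n)" for x f
    using tr(2)[OF that, of x] by (simp only: \<theta>_def)
  ultimately show ?thesis
    using \<alpha> \<beta> \<theta> m by (intro exI[of _ \<alpha>] exI[of _ \<beta>] exI[of _ \<theta>] conjI ballI) assumption+
qed

end

theorem theorem7p2:
  fixes n :: nat
  assumes "n \<ge> 3"
  shows
    \<comment> \<open>the extension defining the lower right corner, and a splitting of it\<close>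
    "ses (AutWA n) (ext_incl n) (AutSA_mod_W n) (ext_proj n) (OutW n) \<and>
     (\<exists>s. splitting n s) \<and>
     (\<forall>s. splitting n s \<longrightarrow>
       split_act n s \<in> hom (OutW n) (AutoGroup (AutWA n)) \<and>
       split_iso n s \<in> iso (AutWA_OutW n s) (AutSA_mod_W n) \<and>
       \<comment> \<open>rows\<close>
       ses (grpA n) (\<lambda>a. a) (grpG n) (G_to_W n) (grpW n) \<and>
       ses (M0 n) (tmap n) (AutG n) (AutG_to_AutSA n) (AutSA n) \<and>
       ses (H1WA n) (H1_to_OutG n) (OutG n) (OutG_to_semidirect n s) (AutWA_OutW n s) \<and>
       \<comment> \<open>columns\<close>
       ses (grpA n) (iota n) (M0 n) (M0_to_H1 n) (H1WA n) \<and>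
       ses (grpG n) (conj_auto (grpG n)) (AutG n) (out_class (grpG n)) (OutG n) \<and>
       ses (grpW n) (W_to_AutSA n) (AutSA n) (AutSA_to_semidirect n s) (AutWA_OutW n s) \<and>
       \<comment> \<open>the four squares\<close>
       (\<forall>a\<in>carrier (grpA n). tmap n (iota n a) = conj_auto (grpG n) a) \<and>
       (\<forall>g\<in>carrier (grpG n). AutG_to_AutSA n (conj_auto (grpG n) g) = W_to_AutSA n (G_to_W n g)) \<and>
       (\<forall>M\<in>carrier (M0 n). H1_to_OutG n (M0_to_H1 n M) = out_class (grpG n) (tmap n M)) \<and>
       (\<forall>\<phi>\<in>carrier (AutG n).
          OutG_to_semidirect n s (out_class (grpG n) \<phi>) = AutSA_to_semidirect n s (AutG_to_AutSA n \<phi>)) \<and>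
       \<comment> \<open>the bottom row up to isomorphism, with the transported action on \<open>(\<int>/2)\<^sup>n\<close>\<close>
       (\<exists>\<alpha> \<beta> \<theta>.
          \<alpha> \<in> iso (H1WA n) (Z_pow (n * (n - 2)) \<times>\<times> Z2_pow n) \<and>
          \<beta> \<in> iso (AutWA n) (Z2_pow n) \<and>
          \<theta> \<in> hom (OutW n) (AutoGroup (Z2_pow n)) \<and>
          (\<forall>q\<in>carrier (OutW n). \<forall>f\<in>carrier (AutWA n). \<theta> q (\<beta> f) = \<beta> (split_act n s q f)) \<and>
          map_prod \<beta> id \<in> iso (AutWA_OutW n s) (semidirect (Z2_pow n) (OutW n) \<theta>) \<and>
          ses (Z_pow (n * (n - 2)) \<times>\<times> Z2_pow n)
              (H1_to_OutG n \<circ> inv_into (carrier (H1WA n)) \<alpha>)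
              (OutG n)
              (map_prod \<beta> id \<circ> OutG_to_semidirect n s)
              (semidirect (Z2_pow n) (OutW n) \<theta>)))"
proof -
  interpret square_inversion3 n by unfold_locales (rule assms)
  have G_col: "ses G (conj_auto G) (AutG n) (out_class G) (OutG n)"
    by (rule G.ses_conj_auto[OF centre_G])
  have sq1: "\<forall>a\<in>carrier A. tmap n (iota n a) = conj_auto G a" using tmap_iota by simp
  have sq2: "\<forall>g\<in>carrier G. r (conj_auto G g) = W_to_AutSA n (q g)" using r_conj by simp
  have sq3: "\<forall>M\<in>carrier (M0 n). H1_to_OutG n (M0_to_H1 n M) = out_class G (tmap n M)"
    using H1_to_OutG_M0 by blast
  have sq4: "\<forall>\<phi>\<in>carrier (AutG n). OutG_to_semidirect n s (out_class G \<phi>) = AutSA_to_semidirect n s (r \<phi>)" for s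
    using OutG_to_semidirect_class by simp
  show ?thesis
    by (intro conjI allI impI) (rule ses_ext splitting_exists split_act_hom ses_G ses_AutG ses_OutG ses_M0
        G_col ses_AutSA sq1 sq2 sq3 sq4 bottom_row | assumption)+
qed

end
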